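(* Let $c\in(0,1]$ and let $H$, $F$, $\underline F$, $\underline m$, $\underline g$ be as in the context. Assume that $\int t\,\mathrm{d}H(s,t)<\infty$, $\int t^{-1}\,\mathrm{d}H(s,t)<\infty$ and $\int (s/t)\,\mathrm{d}H(s,t)\le 1/c$. Let $x_0\in S_{\underline F}^c\cap(0,\infty)$, where $S_{\underline F}^c$ is the complement in $\mathbb{R}$ of the support of $\underline F$. Then: (a) $\underline m(z)=\int(t-z)^{-1}\mathrm{d}\underline F(t)$ is analytic in a neighborhood $D_{x_0}$ of $x_0$, and there exists a co-solution $\underline g(z)$ which is also analytic in $D_{x_0}$. For each $x\in D_{x_0}\cap(0,\infty)$ the triple $(x,\underline m(x),\underline g(x))$ is an extended solution of the system $$z=-\frac{1-c}{\underline m}-\frac{c}{\underline m}\int\frac{\mathrm{d}H(s,t)}{1+s\underline g+t\underline m},\qquad z=-\frac1{\underline g}+c\int\frac{t\,\mathrm{d}H(s,t)}{1+s\underline g+t\underline m},\tag{E}$$ and satisfies $V<x$, where $V$ is computed at $(\underline m(x),\underline g(x))$. (b) For any support point $(s,t)$ of $H$, $s\,\underline g(x_0)+t\,\underline m(x_0)\ne-1$. Conversely, suppose $x_0>0$ and $(x_0,\underline m_0,\underline g_0)$ is an extended solution of (E) with $\underline m_0,\underline g_0$ real, satisfying $s\underline g_0+t\underline m_0\neq-1$ for every support point $(s,t)$ of $H$. Then there is an open interval containing $\underline g_0$ on which the equation $$c\,\underline g^2\int\frac{s\,\mathrm{d}H(s,t)}{1+s\underline g+t\underline m}+\underline m-\underline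 g=0$$ determines $\underline m=\underline m(\underline g)$ (with $\underline m(\underline g_0)=\underline m_0$), giving a real analytic function $x=x(\underline g)$ on this interval, with $x(\underline g_0)=x_0$, such that $(x(\underline g),\underline m(\underline g),\underline g)$ satisfies (E); and if $x'(\underline g_0)\ne0$, then $x_0\in S_{\underline F}^c$.
   Context: Setting. $\mathbb{C}^+=\{z\in\mathbb{C}:\Im z>0\}$; the Stieltjes transform of a distribution function $G$ is $m_G(z)=\int\frac{1}{\lambda-z}\mathrm{d}G(\lambda)$, $z\in\mathbb{C}^+$. Let $c\in(0,1]$ and $H$ a probability distribution on $[0,\infty)^2$. For each $n$ let $N=N(n)$ with $n/N\to c$ as $\min\{n,N\}\to\infty$; let $X_n=(x_{jk}^{(n)})$ be an $n\times N$ random matrix with independent entries of mean $0$ and $\mathbf{E}|x_{jk}^{(n)}|^2=1$ with $\frac{1}{\eta^2nN}\sum_{j,k}\mathbf{E}(|x^{(n)}_{jk}|^2I(|x^{(n)}_{jk}|\ge\eta\sqrt n))\to0$ for every $\eta>0$; let $T_n$ ($n\times n$, nonnegative definite) and $R_n$ ($n\times N$) be nonrandom with $T_n$ and $R_nR_n^*$ commuting, and such that $n^{-1}\sum_{i=1}^nI(s_i\le s,t_i\le t)$ converges weakly to $H$, where $(s_i,t_i)$ are the eigenvalues of $\frac1NR_nR_n^*$ and $T_n$ paired by a common orthonormal eigenbasis. $F$ is the (nonrandom) almost sure weak limit of the empirical spectral distributions of $B_n=\frac1N(R_n+T_n^{1/2}X_n)(R_n+T_n^{1/2}X_n)^*$,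 with Stieltjes transform $m(z)$, and $\underline F=(1-c)I_{[0,\infty)}+cF$ is the corresponding limit for the $N\times N$ matrices $\frac1N(R_n+T_n^{1/2}X_n)^*(R_n+T_n^{1/2}X_n)$. Its Stieltjes transform is $\underline m(z)=-\frac{1-c}{z}+c\,m(z)$. There is a companion function $g(z)$ on $\mathbb{C}^+$ such that $$m=\int\frac{\mathrm{d}H(s,t)}{\frac{s}{1+cg}-(1+cmt)z+t(1-c)},\qquad g=\int\frac{t\,\mathrm{d}H(s,t)}{\frac{s}{1+cg}-(1+cmt)z+t(1-c)},$$ and $\underline g(z)=-\frac{1}{z(1+cg(z))}$ is the Stieltjes transform of a probability measure on $[0,\infty)$. In terms of $\underline m,\underline g$ these equations are the system (E) of the claim, for every $z\in\mathbb{C}^+$. Extended solution: a triple $(z,\tilde m,\tilde g)$ such that there are $z_n\in\mathbb{C}^+$ with $z_n\to z$, $\underline m(z_n)\to\tilde m$, $\underline g(z_n)\to\tilde g$ (finite limits); here $z$ may be real. For a solution or extended solution put $$A_j=\int\frac{st^{j-1}\mathrm{d}H(s,t)}{|1+s\underline g+t\underline m|^2},\qquad B_j=\int\frac{t^{j}\mathrm{d}H(s,t)}{|1+s\underline g+t\underline m|^2},\qquad V_0=|\underline g|^{-2}-cA_2,\qquad V=c^2A_1B_2V_0^{-1}+cB_1 .$$ The support $S_G$ of a distribution function $G$ on $\mathbb{R}$ is the set of $x$ with $G(x+\varepsilon)-G(x-\varepsilon)>0$ for all $\varepsilon>0$; the support of $H$ is its closed topological support in $[0,\infty)^2$. *)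

theory Defs
  imports
    "HOL-Probability.Probability"
    "HOL-Complex_Analysis.Complex_Analysis"
    "Jordan_Normal_Form.Schur_Decomposition"
begin

section \<open>Distribution functions and Stieltjes transforms\<close>

definition df_support :: "(real \<Rightarrow> real) \<Rightarrow> real set" where
  "df_support G = {x. \<forall>\<epsilon>>0. G (x + \<epsilon>) - G (x - \<epsilon>) > 0}"

definition top_support :: "'a::topological_space measure \<Rightarrow> 'a set" where
  "top_support M = {p. \<forall>U. open U \<and> p \<in> U \<longrightarrow> emeasure M U > 0}"

definition stieltjes :: "real measure \<Rightarrow> complex \<Rightarrow> complex" where
  "stieltjes G z = (LINT l|G. 1 / (of_real l - z))"

text \<open>Weak convergence of bivariate distribution functions, stated as
  \<^const>\<open>weak_conv\<close> is stated for univariate ones.\<close>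

definition weak_conv2 :: "(nat \<Rightarrow> real \<times> real \<Rightarrow> real) \<Rightarrow> (real \<times> real) measure \<Rightarrow> bool" where
  "weak_conv2 Gs H \<longleftrightarrow>
     (let G = (\<lambda>p. measure H ({..fst p} \<times> {..snd p}))
      in \<forall>p. isCont G p \<longrightarrow> (\<lambda>n. Gs n p) \<longlonglongrightarrow> G p)"

definition underF :: "real \<Rightarrow> real measure \<Rightarrow> real measure" where
  "underF c F = interval_measure (\<lambda>x. (1 - c) * indicator {0..} x + c * cdf F x)"


section \<open>The matrix model\<close>

definition psd_mat :: "nat \<Rightarrow> complex Matrix.mat \<Rightarrow> bool" where
  "psd_mat n A \<longleftrightarrow> A \<in> carrier_mat n n \<and> mat_adjoint A = A \<and>
     (\<forall>v \<in> carrier_vec n. 0 \<le> Re (scalar_prod (mult_mat_vec A v) (conjugate v)))"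

text \<open>Eigenvalues are counted with their algebraic multiplicity.  Only the real ones enter, which
  are all of them for the Hermitian matrices the definition is used for.\<close>

definition esd :: "complex Matrix.mat \<Rightarrow> real \<Rightarrow> real" where
  "esd A x = (\<Sum>a | poly (char_poly A) (of_real a) = 0 \<and> a \<le> x.
                real (Polynomial.order (of_real a) (char_poly A))) / real (dim_row A)"

text \<open>\<open>Th n\<close> is the nonnegative definite square root of \<open>T n\<close>.  The vectors \<open>u n i\<close> with \<open>i < n\<close> form
  a common orthonormal eigenbasis of \<open>R n (R n)\<^sup>* / N n\<close> and \<open>T n\<close>, with eigenvalues
  \<open>\<sigma> n i\<close> and \<open>\<tau> n i\<close>.  That \<open>N n\<close> tends to infinity follows from \<open>ratio\<close> and \<open>c_pos\<close>.
  Integrability of the entries and of their squared moduli follows from \<open>unit_var\<close>, since the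
  Bochner integral of a nonintegrable function is 0.\<close>

locale info_plus_noise = prob_space M for M :: "'w measure" +
  fixes c :: real
    and H :: "(real \<times> real) measure"
    and N :: "nat \<Rightarrow> nat"
    and X :: "nat \<Rightarrow> nat \<Rightarrow> nat \<Rightarrow> 'w \<Rightarrow> complex"
    and T Th R :: "nat \<Rightarrow> complex Matrix.mat"
    and u :: "nat \<Rightarrow> nat \<Rightarrow> complex Matrix.vec"
    and \<sigma> \<tau> :: "nat \<Rightarrow> nat \<Rightarrow> real"
    and F :: "real measure"
  assumes c_pos: "0 < c" and c_le_1: "c \<le> 1"
    and H_prob: "prob_space H" and H_borel: "sets H = sets borel"
    and H_nonneg: "AE (s, t) in H. 0 \<le> s \<and> 0 \<le> t"
    and ratio: "(\<lambda>n. real n / real (N n)) \<longlonglongrightarrow> c"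
    and indep: "\<And>n. indep_vars (\<lambda>_. borel) (\<lambda>(j, k). X n j k) ({..<n} \<times> {..<N n})"
    and mean_0: "\<And>n j k. j < n \<Longrightarrow> k < N n \<Longrightarrow> expectation (X n j k) = 0"
    and unit_var: "\<And>n j k. j < n \<Longrightarrow> k < N n \<Longrightarrow> expectation (\<lambda>\<omega>. (cmod (X n j k \<omega>))\<^sup>2) = 1"
    and lindeberg: "\<And>\<eta>. \<eta> > 0 \<Longrightarrow>
      (\<lambda>n. 1 / (\<eta>\<^sup>2 * real n * real (N n)) *
             (\<Sum>j<n. \<Sum>k<N n. expectation
                (\<lambda>\<omega>. (cmod (X n j k \<omega>))\<^sup>2 * of_bool (cmod (X n j k \<omega>) \<ge> \<eta> * sqrt (real n)))))
      \<longlonglongrightarrow> 0"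
    and T_psd: "\<And>n. psd_mat n (T n)"
    and Th_psd: "\<And>n. psd_mat n (Th n)" and Th_sqrt: "\<And>n. Th n * Th n = T n"
    and R_carrier: "\<And>n. R n \<in> carrier_mat n (N n)"
    and commute: "\<And>n. T n * (R n * mat_adjoint (R n)) = (R n * mat_adjoint (R n)) * T n"
    and u_carrier: "\<And>n i. i < n \<Longrightarrow> u n i \<in> carrier_vec n"
    and u_orthonormal: "\<And>n i j. i < n \<Longrightarrow> j < n \<Longrightarrow>
      scalar_prod (u n i) (conjugate (u n j)) = (if i = j then 1 else 0)"
    and eigen_R: "\<And>n i. i < n \<Longrightarrow>
      mult_mat_vec (of_real (1 / real (N n)) \<cdot>\<^sub>m (R n * mat_adjoint (R n))) (u n i)
        = of_real (\<sigma> n i) \<cdot>\<^sub>v u n i"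
    and eigen_T: "\<And>n i. i < n \<Longrightarrow> mult_mat_vec (T n) (u n i) = of_real (\<tau> n i) \<cdot>\<^sub>v u n i"
    and conv_H: "weak_conv2
      (\<lambda>n p. 1 / real n * (\<Sum>i<n. of_bool (\<sigma> n i \<le> fst p \<and> \<tau> n i \<le> snd p))) H"
    and F_distr: "real_distribution F"
    and conv_F: "AE \<omega> in M. weak_conv
      (\<lambda>n. let Y = R n + Th n * Matrix.mat n (N n) (\<lambda>(j, k). X n j k \<omega>)
            in esd (of_real (1 / real (N n)) \<cdot>\<^sub>m (Y * mat_adjoint Y)))
      (cdf F)"


section \<open>The limiting system\<close>

abbreviation qden :: "complex \<Rightarrow> complex \<Rightarrow> real \<Rightarrow> real \<Rightarrow> complex" where
  "qden m g s t \<equiv> 1 + of_real s * g + of_real t * m"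

definition underg :: "real \<Rightarrow> (complex \<Rightarrow> complex) \<Rightarrow> complex \<Rightarrow> complex" where
  "underg c g z = - 1 / (z * (1 + of_real c * g z))"

definition is_companion ::
    "real \<Rightarrow> (real \<times> real) measure \<Rightarrow> real measure \<Rightarrow> (complex \<Rightarrow> complex) \<Rightarrow> bool" where
  "is_companion c H F g \<longleftrightarrow>
     (\<forall>z. Im z > 0 \<longrightarrow>
        (let m = stieltjes F;
             d = (\<lambda>s t. of_real s / (1 + of_real c * g z)
                        - (1 + of_real c * m z * of_real t) * z + of_real (t * (1 - c)))
         in has_bochner_integral H (\<lambda>(s, t). 1 / d s t) (m z) \<and>
            has_bochner_integral H (\<lambda>(s, t). of_real t / d s t) (g z))) \<and>
     (\<exists>G. real_distribution G \<and> (AE x in G. 0 \<le> x) \<and>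
          (\<forall>z. Im z > 0 \<longrightarrow> underg c g z = stieltjes G z))"

definition solves_E ::
    "real \<Rightarrow> (real \<times> real) measure \<Rightarrow> complex \<Rightarrow> complex \<Rightarrow> complex \<Rightarrow> bool" where
  "solves_E c H z m g \<longleftrightarrow>
     m \<noteq> 0 \<and> g \<noteq> 0 \<and> (AE (s, t) in H. qden m g s t \<noteq> 0) \<and>
     integrable H (\<lambda>(s, t). 1 / qden m g s t) \<and>
     integrable H (\<lambda>(s, t). of_real t / qden m g s t) \<and>
     z = - of_real (1 - c) / m - of_real c / m * integral\<^sup>L H (\<lambda>(s, t). 1 / qden m g s t) \<and>
     z = - 1 / g + of_real c * integral\<^sup>L H (\<lambda>(s, t). of_real t / qden m g s t)"

definition extended_solution ::
    "real \<Rightarrow> real measure \<Rightarrow> (complex \<Rightarrow> complex) \<Rightarrow> complex \<Rightarrow> complex \<Rightarrow> complex \<Rightarrow> bool" where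
  "extended_solution c F g z m' g' \<longleftrightarrow>
     (\<exists>zs :: nat \<Rightarrow> complex. (\<forall>n. Im (zs n) > 0) \<and> zs \<longlonglongrightarrow> z \<and>
        (\<lambda>n. stieltjes (underF c F) (zs n)) \<longlonglongrightarrow> m' \<and>
        (\<lambda>n. underg c g (zs n)) \<longlonglongrightarrow> g')"

definition A_integrand :: "complex \<Rightarrow> complex \<Rightarrow> nat \<Rightarrow> real \<times> real \<Rightarrow> real" where
  "A_integrand m g j = (\<lambda>(s, t). s * t ^ (j - 1) / (cmod (qden m g s t))\<^sup>2)"

definition B_integrand :: "complex \<Rightarrow> complex \<Rightarrow> nat \<Rightarrow> real \<times> real \<Rightarrow> real" where
  "B_integrand m g j = (\<lambda>(s, t). t ^ j / (cmod (qden m g s t))\<^sup>2)"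

definition A_int :: "(real \<times> real) measure \<Rightarrow> complex \<Rightarrow> complex \<Rightarrow> nat \<Rightarrow> real" where
  "A_int H m g j = (LINT p|H. A_integrand m g j p)"

definition B_int :: "(real \<times> real) measure \<Rightarrow> complex \<Rightarrow> complex \<Rightarrow> nat \<Rightarrow> real" where
  "B_int H m g j = (LINT p|H. B_integrand m g j p)"

definition V0 :: "real \<Rightarrow> (real \<times> real) measure \<Rightarrow> complex \<Rightarrow> complex \<Rightarrow> real" where
  "V0 c H m g = 1 / (cmod g)\<^sup>2 - c * A_int H m g 2"

definition V :: "real \<Rightarrow> (real \<times> real) measure \<Rightarrow> complex \<Rightarrow> complex \<Rightarrow> real" where
  "V c H m g = c\<^sup>2 * A_int H m g 1 * B_int H m g 2 / V0 c H m g + c * B_int H m g 1"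

text \<open>Rules out that \<^const>\<open>V\<close> gets its value from a division by 0 or a divergent integral.\<close>

definition V_defined :: "real \<Rightarrow> (real \<times> real) measure \<Rightarrow> complex \<Rightarrow> complex \<Rightarrow> bool" where
  "V_defined c H m g \<longleftrightarrow>
     g \<noteq> 0 \<and> (AE (s, t) in H. qden m g s t \<noteq> 0) \<and>
     (\<forall>j\<in>{1, 2}. integrable H (A_integrand m g j) \<and> integrable H (B_integrand m g j)) \<and>
     V0 c H m g \<noteq> 0"

definition curve_eq :: "real \<Rightarrow> (real \<times> real) measure \<Rightarrow> real \<Rightarrow> real \<Rightarrow> bool" where
  "curve_eq c H \<gamma> \<mu> \<longleftrightarrow>
     (AE (s, t) in H. 1 + s * \<gamma> + t * \<mu> \<noteq> 0) \<and>
     integrable H (\<lambda>(s, t). s / (1 + s * \<gamma> + t * \<mu>)) \<and>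
     c * \<gamma>\<^sup>2 * integral\<^sup>L H (\<lambda>(s, t). s / (1 + s * \<gamma> + t * \<mu>)) + \<mu> - \<gamma> = 0"

definition real_analytic_on :: "(real \<Rightarrow> real) \<Rightarrow> real set \<Rightarrow> bool" where
  "real_analytic_on f S \<longleftrightarrow>
     (\<forall>x\<in>S. \<exists>r>0. \<exists>a. \<forall>y. \<bar>y - x\<bar> < r \<longrightarrow> (\<lambda>n. a n * (y - x) ^ n) sums f y)"

end

theory Submission
  imports Defs
begin

text \<open>Write \<open>m\<close> and \<open>g\<close> for the Stieltjes transforms of \<open>underF c F\<close> and of the probability measure \<open>G\<close> behind
the co-solution, and \<open>q(s,t) = 1 + s g + t m\<close>.  In the upper half plane \<open>m\<close> and \<open>g\<close> solve the system,
and everything is extracted from its imaginary parts.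

\<^bold>\<open>Two identities.\<close>  Substitute \<open>z = w\<^sup>2\<close> with \<open>w\<close> in the first quadrant.  The functions \<open>w m\<close> and \<open>w g\<close>
again have positive imaginary part, and dividing it by \<open>Im w\<close> gives \<open>im_ratio\<close>, which stays between
positive bounds when \<open>z\<close> approaches a real point off the support.  Taking imaginary parts of the
system in this form (\<open>ratio_identities\<close>) expresses \<open>im_ratio\<close> of either measure through the moments
\<open>A\<^sub>j\<close>, \<open>B\<^sub>j\<close> with nonnegative coefficients.  Eliminating the \<open>im_ratio\<close> of \<open>G\<close> yields \<open>(|z| - V) P > 0\<close> for
the \<open>im_ratio\<close> \<open>P\<close> of \<open>underF c F\<close>, that is \<open>V < |z|\<close>; it also yields \<open>V\<^sub>0 > 0\<close> and bounds for all moments.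

\<^bold>\<open>Off the support.\<close>  Let \<open>x0\<close> have a neighbourhood that is null for \<open>underF c F\<close>.  The first identity
bounds the product of \<open>A\<^sub>1\<close> with the \<open>im_ratio\<close> of \<open>G\<close>, and \<open>A\<^sub>1\<close> is bounded below unless \<open>g\<close> is large
or \<open>s = 0\<close> almost surely; in the latter case \<open>g = m\<close>.  That \<open>g\<close> blows up is impossible (\<open>no_pole_of_gS\<close>): \<open>1/q\<close> would tend to \<open>0\<close> where \<open>s > 0\<close>, and the moment
bounds allow passing to the limit in the system, which would lead to \<open>x0 = 0\<close>.  So the density of \<open>G\<close>
vanishes near \<open>x0\<close>, \<open>g\<close> continues analytically, and Fatou's lemma carries \<open>V < |z|\<close> to the real axis; the
inequality stays strict because of the term \<open>\<integral> 1/|q|\<^sup>2\<close>.  The same term is locally bounded in real \<open>x\<close>.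
Since \<open>m\<close> and \<open>g\<close> increase along the real axis, a zero of \<open>q\<close> at a support point of \<open>H\<close> would produce
a zero at some \<open>x\<close> near \<open>x0\<close> for all points of a neighbourhood, a set of positive measure; the bound
excludes this (\<open>no_zero_on_support\<close>).

\<^bold>\<open>The converse.\<close>  Along a sequence defining an extended solution with real values \<open>m0\<close>, \<open>g0\<close>, the
quantity \<open>V\<^sub>0\<close> is bounded below, and
\<open>\<integral> s/t dH \<le> 1/c\<close> turns this into \<open>|1 - m0/g0| < 1\<close>.  Hence \<open>m0\<close> and \<open>g0\<close> are nonzero of equal sign, so
\<open>|q|\<close> is bounded below by a multiple of \<open>1 + s + t\<close> on the support of \<open>H\<close>, which may be unbounded.  This
uniform nondegeneracy makes all integrals analytic in \<open>(g, m)\<close> near \<open>(g0, m0)\<close>.  The partial derivative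
of the curve equation in \<open>m\<close> is \<open>g0\<^sup>2 V\<^sub>0 \<noteq> 0\<close>, so a contraction argument gives a holomorphic solution \<open>h(g)\<close>
(\<open>implicit_curve\<close>) and with it \<open>x\<close>.  If \<open>x'(g0) \<noteq> 0\<close>, invert \<open>x\<close> near \<open>x0\<close>.  Along the given sequence
\<open>g\<close> agrees with the inverse, hence on a half disc by the identity theorem.  So \<open>m\<close> continues
analytically across \<open>x0\<close> with real values, and the measure is null there.\<close>

section \<open>Limits of integrals and null sets\<close>

text \<open>Cauchy's estimate bounds the difference quotients uniformly in \<open>p\<close>, so dominated convergence
applies to them.\<close>

lemma holomorphic_on_integral:
  fixes f :: "complex \<Rightarrow> 'a \<Rightarrow> complex"
  assumes "finite_measure M" and op: "open S"
    and meas: "\<And>z. z \<in> S \<Longrightarrow> f z \<in> borel_measurable M"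
    and hol: "AE p in M. (\<lambda>z. f z p) holomorphic_on S"
    and bd: "AE p in M. \<forall>z\<in>S. cmod (f z p) \<le> B"
  shows "(\<lambda>z. integral\<^sup>L M (f z)) holomorphic_on S"
proof -
  interpret finite_measure M by fact
  have int: "integrable M (f z)" if "z \<in> S" for z
    using bd that by (intro integrable_const_bound[where B = B] meas that) (auto elim!: eventually_mono)
  have "(\<lambda>z. integral\<^sup>L M (f z)) field_differentiable at z0" if z0: "z0 \<in> S" for z0
  proof -
    obtain r where r: "r > 0" "cball z0 (2 * r) \<subseteq> S"
    proof -
      obtain e where "e > 0" "cball z0 e \<subseteq> S" using op z0 open_contains_cball by blast
      then show ?thesis using that[of "e / 2"] by auto
    qed
    have lip: "AE p in M. \<forall>z\<in>ball z0 r. cmod (f z p - f z0 p) \<le> B / r * cmod (z - z0)"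
      using hol bd
    proof eventually_elim
      case (elim p)
      have cb: "cball z r \<subseteq> S" if "z \<in> ball z0 r" for z
      proof
        fix x assume "x \<in> cball z r"
        then have "dist z0 x \<le> 2 * r"
          using that dist_triangle[of z0 x z] by (simp add: dist_commute)
        then show "x \<in> S" using r by auto
      qed
      have der: "((\<lambda>z. f z p) has_field_derivative deriv (\<lambda>z. f z p) z) (at z within ball z0 r)"
        if "z \<in> ball z0 r" for z
        using elim(1) op cb[OF that] r(1)
        by (meson DERIV_subset centre_in_cball holomorphic_derivI less_imp_le subsetD subset_UNIV)
      have dbd: "cmod (deriv (\<lambda>z. f z p) z) \<le> B / r" if "z \<in> ball z0 r" for z
      proof -
        have "cmod ((deriv ^^ 1) (\<lambda>z. f z p) z) \<le> fact 1 * B / r ^ 1"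
        proof (rule Cauchy_inequality)
          show "(\<lambda>z. f z p) holomorphic_on ball z r"
            using elim(1) cb[OF that] ball_subset_cball holomorphic_on_subset by blast
          show "continuous_on (cball z r) (\<lambda>z. f z p)"
            using elim(1) cb[OF that] holomorphic_on_imp_continuous_on continuous_on_subset by blast
          show "cmod (f x p) \<le> B" if "cmod (z - x) = r" for x
            using elim(2) cb[OF \<open>z \<in> ball z0 r\<close>] that by (auto simp: dist_norm)
        qed (use r in auto)
        then show ?thesis by simp
      qed
      show ?case
        using field_differentiable_bound[OF convex_ball der dbd] r(1) by simp
    qed
    define f' where "f' p = deriv (\<lambda>z. f z p) z0" for p
    have quot: "AE p in M. ((\<lambda>z. (f z p - f z0 p) / (z - z0)) \<longlongrightarrow> f' p) (at z0)"
      using hol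
    proof eventually_elim
      case (elim p)
      show ?case
        using holomorphic_derivI[OF elim op z0] unfolding f'_def has_field_derivative_iff .
    qed
    define f'' where "f'' p = lim (\<lambda>n. (f (z0 + of_real (r / (Suc n + 1))) p - f z0 p) / of_real (r / (Suc n + 1)))" for p
    have inS: "z \<in> S" if "z \<in> ball z0 r" for z
      using that r by auto
    have in_ball: "z0 + of_real (r / (Suc n + 1)) \<in> ball z0 r" for n
    proof -
      have "r / real (Suc n + 1) < r" using r(1) by (simp add: divide_less_eq_1 divide_less_eq field_simps add_pos_nonneg)
      then show ?thesis using r(1) by (simp add: dist_norm norm_divide del: of_real_divide)
    qed
    have "f'' \<in> borel_measurable M"
      unfolding f''_def
      by (intro borel_measurable_lim_metric borel_measurable_divide borel_measurable_diff meas inS in_ball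
          borel_measurable_const z0)
    moreover have "AE p in M. f'' p = f' p"
      using quot
    proof eventually_elim
      case (elim p)
      have "filterlim (\<lambda>n. z0 + of_real (r / (Suc n + 1))) (at z0) sequentially"
      proof -
        have "(\<lambda>n. r / real (Suc n + 1)) \<longlonglongrightarrow> 0"
          by real_asymp
        then have "(\<lambda>n. z0 + complex_of_real (r / (Suc n + 1))) \<longlonglongrightarrow> z0 + of_real 0"
          by (intro tendsto_intros) (simp add: add.commute)
        moreover have "complex_of_real (r / (Suc n + 1)) \<noteq> 0" for n
          using r(1) by (simp del: of_real_divide)
        ultimately show ?thesis by (auto simp: filterlim_at simp del: of_real_divide of_nat_Suc)
      qed
      from filterlim_compose[OF elim this] show ?case
        unfolding f''_def by (intro limI) simp
    qed
    ultimately have tend: "((\<lambda>z. (integral\<^sup>L M (f z) - integral\<^sup>L M (f z0)) / (z - z0)) \<longlongrightarrow> integral\<^sup>L M f'') (at z0)"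
    proof (subst tendsto_at_iff_sequentially, intro allI impI)
      fix X :: "nat \<Rightarrow> complex"
      assume f''[measurable]: "f'' \<in> borel_measurable M" and eq: "AE p in M. f'' p = f' p"
        and X: "\<forall>i. X i \<in> UNIV - {z0}" and lim: "X \<longlonglongrightarrow> z0"
      have "eventually (\<lambda>i. X i \<in> ball z0 r) sequentially"
        using lim r(1) by (intro topological_tendstoD) auto
      then obtain i0 where i0: "\<And>i. i \<ge> i0 \<Longrightarrow> X i \<in> ball z0 r"
        by (auto simp: eventually_sequentially)
      define Y where "Y i = X (i + i0)" for i
      have Y: "Y i \<in> ball z0 r" "Y i \<noteq> z0" for i using i0 X by (auto simp: Y_def)
      have Ylim: "Y \<longlonglongrightarrow> z0" unfolding Y_def using lim by (rule LIMSEQ_ignore_initial_segment)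
      have "(\<lambda>i. integral\<^sup>L M (\<lambda>p. (f (Y i) p - f z0 p) / (Y i - z0))) \<longlonglongrightarrow> integral\<^sup>L M f''"
      proof (rule integral_dominated_convergence[where w = "\<lambda>_. B / r"])
        show "AE p in M. (\<lambda>i. (f (Y i) p - f z0 p) / (Y i - z0)) \<longlonglongrightarrow> f'' p"
          using quot eq
        proof eventually_elim
          case (elim p)
          have "filterlim Y (at z0) sequentially" using Ylim Y by (simp add: filterlim_at)
          from filterlim_compose[OF elim(1) this] elim(2) show ?case by simp
        qed
        show "AE p in M. cmod ((f (Y i) p - f z0 p) / (Y i - z0)) \<le> B / r" for i
          using lip
        proof eventually_elim
          case (elim p)
          have "cmod (f (Y i) p - f z0 p) \<le> B / r * cmod (Y i - z0)" using elim Y by blast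
          then show ?case using Y(2)[of i] by (simp add: norm_divide divide_le_eq)
        qed
        show "(\<lambda>p. (f (Y i) p - f z0 p) / (Y i - z0)) \<in> borel_measurable M" for i
          using meas[OF inS[OF Y(1)], of i] meas[OF z0] by measurable
      qed auto
      also have "(\<lambda>i. integral\<^sup>L M (\<lambda>p. (f (Y i) p - f z0 p) / (Y i - z0)))
          = (\<lambda>i. (integral\<^sup>L M (f (Y i)) - integral\<^sup>L M (f z0)) / (Y i - z0))"
        using int[OF inS[OF Y(1)]] int[OF z0] by (simp add: Bochner_Integration.integral_diff)
      finally show "((\<lambda>z. (integral\<^sup>L M (f z) - integral\<^sup>L M (f z0)) / (z - z0)) \<circ> X) \<longlonglongrightarrow> integral\<^sup>L M f''"
        unfolding Y_def o_def by (rule LIMSEQ_offset)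
    qed
    then show ?thesis
      unfolding field_differentiable_def has_field_derivative_iff by blast
  qed
  then show ?thesis
    by (auto simp: holomorphic_on_def intro: field_differentiable_at_within)
qed

text \<open>A bounded second moment makes the sequence uniformly integrable: cut \<open>|f|\<close> off at a level \<open>L\<close>; what
lies above the level contributes at most \<open>K / L\<close>.\<close>

lemma (in finite_measure) integral_tendsto_0_if_L2_bounded:
  fixes f :: "nat \<Rightarrow> 'a \<Rightarrow> complex"
  assumes [measurable]: "\<And>n. f n \<in> borel_measurable M"
    and lim: "AE p in M. (\<lambda>n. f n p) \<longlonglongrightarrow> 0"
    and int: "\<And>n. integrable M (\<lambda>p. (cmod (f n p))\<^sup>2)"
    and bd: "\<And>n. (\<integral>p. (cmod (f n p))\<^sup>2 \<partial>M) \<le> K"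
  shows "(\<lambda>n. integral\<^sup>L M (f n)) \<longlonglongrightarrow> 0"
proof (rule LIMSEQ_I)
  fix e :: real assume e: "e > 0"
  define L where "L = (\<bar>K\<bar> + 1) * 2 / e"
  have L: "L > 0" using e by (simp add: L_def)
  have "(\<lambda>n. \<integral>p. min (cmod (f n p)) L \<partial>M) \<longlonglongrightarrow> (\<integral>p. 0 \<partial>M)"
  proof (rule integral_dominated_convergence[where w = "\<lambda>_. L"])
    show "AE p in M. (\<lambda>n. min (cmod (f n p)) L) \<longlonglongrightarrow> 0"
      using lim
    proof eventually_elim
      case (elim p)
      have "(\<lambda>n. min (cmod (f n p)) L) \<longlonglongrightarrow> min (cmod 0) L" by (intro tendsto_intros elim)
      then show ?case using L by simp
    qed
  qed (use L in auto)
  then have "eventually (\<lambda>n. (\<integral>p. min (cmod (f n p)) L \<partial>M) < e / 2) sequentially"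
    using e by (intro order_tendstoD) auto
  then obtain n0 where n0: "\<And>n. n \<ge> n0 \<Longrightarrow> (\<integral>p. min (cmod (f n p)) L \<partial>M) < e / 2"
    by (auto simp: eventually_sequentially)
  have "cmod (integral\<^sup>L M (f n)) < e" if "n \<ge> n0" for n
  proof -
    have i1: "integrable M (\<lambda>p. min (cmod (f n p)) L)"
      by (rule integrable_const_bound[where B = L]) (use L in auto)
    have i2: "integrable M (\<lambda>p. (cmod (f n p))\<^sup>2 / L)" using int by simp
    have "cmod (integral\<^sup>L M (f n)) \<le> (\<integral>p. cmod (f n p) \<partial>M)" by (rule integral_norm_bound)
    also have "\<dots> \<le> (\<integral>p. min (cmod (f n p)) L + (cmod (f n p))\<^sup>2 / L \<partial>M)"
    proof (rule integral_mono')
      show "integrable M (\<lambda>p. min (cmod (f n p)) L + (cmod (f n p))\<^sup>2 / L)" using i1 i2 by simp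
      show "cmod (f n p) \<le> min (cmod (f n p)) L + (cmod (f n p))\<^sup>2 / L" for p
      proof (cases "cmod (f n p) \<le> L")
        case False
        then have "cmod (f n p) * L \<le> cmod (f n p) * cmod (f n p)" by (intro mult_left_mono) auto
        then have "cmod (f n p) \<le> (cmod (f n p))\<^sup>2 / L"
          using L by (simp add: pos_le_divide_eq power2_eq_square)
        then show ?thesis using L False by (simp add: min_def)
      qed (use L in auto)
      show "0 \<le> min (cmod (f n p)) L + (cmod (f n p))\<^sup>2 / L" for p using L by simp
    qed
    also have "\<dots> = (\<integral>p. min (cmod (f n p)) L \<partial>M) + (\<integral>p. (cmod (f n p))\<^sup>2 \<partial>M) / L"
      using i1 i2 by simp
    also have "(\<integral>p. (cmod (f n p))\<^sup>2 \<partial>M) / L \<le> (\<bar>K\<bar> + 1) / L"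
      using bd[of n] L by (intro divide_right_mono) auto
    also have "(\<bar>K\<bar> + 1) / L = e / 2"
      using e by (simp add: L_def field_simps)
    finally show ?thesis using n0[OF that] by simp
  qed
  then show "\<exists>n0. \<forall>n\<ge>n0. norm (integral\<^sup>L M (f n) - 0) < e" by auto
qed

lemma integral_Fatou_bound:
  fixes f :: "nat \<Rightarrow> 'a \<Rightarrow> real"
  assumes [measurable]: "\<And>n. f n \<in> borel_measurable M" "h \<in> borel_measurable M"
    and pos: "\<And>n. AE p in M. 0 \<le> f n p"
    and lim: "AE p in M. (\<lambda>n. f n p) \<longlonglongrightarrow> h p"
    and int: "\<And>n. integrable M (f n)" and bd: "\<And>n. integral\<^sup>L M (f n) \<le> K n" and K: "K \<longlonglongrightarrow> K'"
  shows "integrable M h" "integral\<^sup>L M h \<le> K'"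
proof -
  have hpos: "AE p in M. 0 \<le> h p"
  proof -
    have "AE p in M. \<forall>n. 0 \<le> f n p" using pos by (simp add: AE_all_countable)
    then show ?thesis using lim by eventually_elim (meson LIMSEQ_le_const)
  qed
  have Kpos: "0 \<le> K n" for n
    using integral_nonneg_AE[OF pos[of n]] bd[of n] by simp
  have "(\<integral>\<^sup>+p. ennreal (h p) \<partial>M) = (\<integral>\<^sup>+p. liminf (\<lambda>n. ennreal (f n p)) \<partial>M)"
    using lim by (intro nn_integral_cong_AE, eventually_elim)
      (metis lim_imp_Liminf tendsto_ennrealI trivial_limit_sequentially)
  also have "\<dots> \<le> liminf (\<lambda>n. \<integral>\<^sup>+p. ennreal (f n p) \<partial>M)"
    by (rule nn_integral_liminf) measurable
  also have "\<dots> \<le> liminf (\<lambda>n. ennreal (K n))"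
    using bd by (intro Liminf_mono always_eventually allI)
      (simp add: nn_integral_eq_integral[OF int pos] ennreal_leI)
  also have "\<dots> = ennreal K'"
    using K by (intro lim_imp_Liminf) (auto intro: tendsto_ennrealI)
  finally have le: "(\<integral>\<^sup>+p. ennreal (h p) \<partial>M) \<le> ennreal K'" .
  show i: "integrable M h"
    using le hpos by (intro integrableI_nonneg) (auto simp: le_less_trans)
  have "0 \<le> K'" using K Kpos by (meson LIMSEQ_le_const)
  then show "integral\<^sup>L M h \<le> K'"
    using le nn_integral_eq_integral[OF i hpos] by simp
qed

text \<open>Halving the interval \<open>n\<close> times improves the quadratic bound by the factor \<open>2 ^ n\<close>.  It applies to
the mass of an interval when this is of the order of the squared length.\<close>

lemma subadditive_quadratic_imp_nonpos:
  fixes \<phi> :: "real \<Rightarrow> real \<Rightarrow> real"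
  assumes sub: "\<And>\<alpha> \<mu> \<beta>. a \<le> \<alpha> \<Longrightarrow> \<alpha> \<le> \<mu> \<Longrightarrow> \<mu> \<le> \<beta> \<Longrightarrow> \<beta> \<le> b \<Longrightarrow> \<phi> \<alpha> \<beta> \<le> \<phi> \<alpha> \<mu> + \<phi> \<mu> \<beta>"
    and quad: "\<And>\<alpha> \<beta>. a \<le> \<alpha> \<Longrightarrow> \<alpha> < \<beta> \<Longrightarrow> \<beta> \<le> b \<Longrightarrow> \<phi> \<alpha> \<beta> \<le> K * (\<beta> - \<alpha>)\<^sup>2"
    and "a < b"
  shows "\<phi> a b \<le> 0"
proof -
  have *: "\<phi> \<alpha> \<beta> \<le> K * (\<beta> - \<alpha>)\<^sup>2 / 2 ^ n" if "a \<le> \<alpha>" "\<alpha> < \<beta>" "\<beta> \<le> b" for n \<alpha> \<beta>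
    using that
  proof (induction n arbitrary: \<alpha> \<beta>)
    case (Suc n)
    define \<mu> where "\<mu> = (\<alpha> + \<beta>) / 2"
    have mu: "\<alpha> < \<mu>" "\<mu> < \<beta>" using Suc.prems by (auto simp: \<mu>_def)
    have "\<phi> \<alpha> \<beta> \<le> \<phi> \<alpha> \<mu> + \<phi> \<mu> \<beta>" using mu Suc.prems by (intro sub) auto
    also have "\<dots> \<le> K * (\<mu> - \<alpha>)\<^sup>2 / 2 ^ n + K * (\<beta> - \<mu>)\<^sup>2 / 2 ^ n"
      using mu Suc.prems by (intro add_mono Suc.IH) auto
    also have "\<dots> = K * (\<beta> - \<alpha>)\<^sup>2 / 2 ^ Suc n"
    proof -
      have "(\<mu> - \<alpha>) = (\<beta> - \<alpha>) / 2" "(\<beta> - \<mu>) = (\<beta> - \<alpha>) / 2" by (auto simp: \<mu>_def field_simps)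
      then show ?thesis by (simp only: power_divide) simp
    qed
    finally show ?case .
  qed (auto intro: quad)
  have "(\<lambda>n. K * (b - a)\<^sup>2 / 2 ^ n) \<longlonglongrightarrow> 0"
    by real_asymp
  then show ?thesis
    using *[of a b] \<open>a < b\<close> by (intro LIMSEQ_le_const) auto
qed

lemma AE_in_top_support:
  fixes M :: "'a::second_countable_topology measure"
  assumes "sets M = sets borel"
  shows "AE p in M. p \<in> top_support M"
proof -
  obtain \<B> :: "'a set set" where B: "countable \<B>" "topological_basis \<B>"
    using ex_countable_basis by blast
  have "AE p in M. p \<notin> U" if "U \<in> {U\<in>\<B>. emeasure M U = 0}" for U
    using that topological_basis_open[OF B(2)] assms by (auto intro!: AE_not_in null_setsI)
  then have "AE p in M. \<forall>U\<in>{U\<in>\<B>. emeasure M U = 0}. p \<notin> U"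
    using B(1) by (subst AE_ball_countable) auto
  then show ?thesis
  proof eventually_elim
    case (elim p)
    show ?case unfolding top_support_def
    proof (intro CollectI allI impI)
      fix U assume U: "open U \<and> p \<in> U"
      then obtain V where V: "V \<in> \<B>" "p \<in> V" "V \<subseteq> U" by (meson topological_basisE B(2))
      then have "emeasure M V \<noteq> 0" using elim by auto
      moreover have "emeasure M V \<le> emeasure M U"
        using V(3) U assms by (intro emeasure_mono) auto
      ultimately show "0 < emeasure M U" by (simp add: zero_less_iff_neq_zero) (metis le_zero_eq)
    qed
  qed
qed

lemma closed_top_support: "closed (top_support M)"
proof -
  have "- top_support M = \<Union>{U. open U \<and> emeasure M U = 0}"
    unfolding top_support_def by (auto simp: zero_less_iff_neq_zero)
  then show ?thesis by (simp add: closed_def open_Union)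
qed

text \<open>A zero of the limit would be a point where \<open>1 / |q|\<^sup>2\<close> diverges to infinity.  The formulation avoids
the value \<open>1 / 0 = 0\<close>, which makes Fatou's lemma useless for the limit itself.\<close>

lemma (in prob_space) AE_limit_nonzero:
  fixes q :: "nat \<Rightarrow> 'a \<Rightarrow> complex"
  assumes [measurable]: "\<And>n. q n \<in> borel_measurable M" "q' \<in> borel_measurable M"
    and ne: "AE p in M. \<forall>n. q n p \<noteq> 0" and lim: "AE p in M. (\<lambda>n. q n p) \<longlonglongrightarrow> q' p"
    and int: "\<And>n. integrable M (\<lambda>p. 1 / (cmod (q n p))\<^sup>2)"
    and bd: "\<And>n. (\<integral>p. 1 / (cmod (q n p))\<^sup>2 \<partial>M) \<le> K"
  shows "AE p in M. q' p \<noteq> 0"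
proof -
  define Z where "Z = {p\<in>space M. q' p = 0}"
  have [measurable]: "Z \<in> sets M" unfolding Z_def by measurable
  have le: "L * prob Z \<le> K" if L: "L > 0" for L
  proof -
    have "(\<lambda>n. \<integral>p. indicator Z p * min (1 / (cmod (q n p))\<^sup>2) L \<partial>M) \<longlonglongrightarrow> (\<integral>p. indicator Z p * L \<partial>M)"
    proof (rule integral_dominated_convergence[where w = "\<lambda>_. L"])
      show "AE p in M. (\<lambda>n. indicator Z p * min (1 / (cmod (q n p))\<^sup>2) L) \<longlonglongrightarrow> indicator Z p * L"
        using ne lim
      proof eventually_elim
        case (elim p)
        show ?case
        proof (cases "p \<in> Z")
          case True
          then have "(\<lambda>n. q n p) \<longlonglongrightarrow> 0" using elim by (simp add: Z_def)
          then have "(\<lambda>n. (cmod (q n p))\<^sup>2) \<longlonglongrightarrow> (cmod 0)\<^sup>2" by (intro tendsto_intros)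
          then have "eventually (\<lambda>n. (cmod (q n p))\<^sup>2 < 1 / L) sequentially"
            by (rule order_tendstoD) (use L in simp)
          then have "eventually (\<lambda>n. indicator Z p * min (1 / (cmod (q n p))\<^sup>2) L = indicator Z p * L) sequentially"
          proof eventually_elim
            case (elim n)
            have "0 < (cmod (q n p))\<^sup>2" using \<open>\<forall>n. q n p \<noteq> 0\<close> by simp
            then have "L \<le> 1 / (cmod (q n p))\<^sup>2" using elim L by (simp add: field_simps)
            then show ?case by simp
          qed
          then show ?thesis by (rule tendsto_eventually)
        qed simp
      qed
      show "AE p in M. norm (indicator Z p * min (1 / (cmod (q n p))\<^sup>2) L) \<le> L" for n
        using L by (intro AE_I2) (auto simp: indicator_def min_def)
    qed auto
    moreover have "(\<integral>p. indicator Z p * min (1 / (cmod (q n p))\<^sup>2) L \<partial>M) \<le> K" for n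
    proof -
      have "(\<integral>p. indicator Z p * min (1 / (cmod (q n p))\<^sup>2) L \<partial>M) \<le> (\<integral>p. 1 / (cmod (q n p))\<^sup>2 \<partial>M)"
        by (rule integral_mono'[OF int]) (use L in \<open>auto simp: indicator_def min_def\<close>)
      then show ?thesis using bd[of n] by linarith
    qed
    ultimately have "(\<integral>p. indicator Z p * L \<partial>M) \<le> K" by (intro LIMSEQ_le_const2) auto
    then show ?thesis by (simp add: mult.commute)
  qed
  have "prob Z = 0"
  proof (rule ccontr)
    assume "prob Z \<noteq> 0"
    then have "prob Z > 0" using measure_nonneg[of M Z] by linarith
    then have "(\<bar>K\<bar> + 1) / prob Z > 0" by simp
    from le[OF this] \<open>prob Z > 0\<close> show False by simp
  qed
  then have "AE p in M. p \<notin> Z" by (simp add: prob_eq_0)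
  then show ?thesis using AE_space by eventually_elim (auto simp: Z_def)
qed

section \<open>Stieltjes transforms of probability measures\<close>

lemma AE_nonneg_iff_cdf:
  assumes "real_distribution M"
  shows "(AE l in M. 0 \<le> l) \<longleftrightarrow> (\<forall>x<0. cdf M x = 0)"
proof -
  interpret real_distribution M by fact
  show ?thesis
  proof
    assume "AE l in M. 0 \<le> l"
    then have "AE l in M. l \<notin> {..x}" if "x < 0" for x by eventually_elim (use that in auto)
    then show "\<forall>x<0. cdf M x = 0"
      unfolding cdf_def by (simp add: prob_eq_0 del: atMost_iff)
  next
    assume "\<forall>x<0. cdf M x = 0"
    then have "AE l in M. l \<notin> {..- 1 / real (Suc n)}" for n
      unfolding cdf_def by (subst prob_eq_0[symmetric]) (auto simp: field_simps)
    then have "AE l in M. \<forall>n. l \<notin> {..- 1 / real (Suc n)}" by (simp add: AE_all_countable)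
    then show "AE l in M. 0 \<le> l"
    proof eventually_elim
      case (elim l)
      show ?case
      proof (rule ccontr)
        assume "\<not> 0 \<le> l"
        then obtain n where "inverse (real (Suc n)) < - l" using reals_Archimedean[of "- l"] by auto
        then show False using elim[rule_format, of n] by (simp add: field_simps)
      qed
    qed
  qed
qed

lemma not_in_df_support_iff:
  assumes "real_distribution M"
  shows "x \<notin> df_support (cdf M) \<longleftrightarrow> (\<exists>\<epsilon>>0. AE l in M. \<bar>l - x\<bar> \<ge> \<epsilon>)"
proof -
  interpret real_distribution M by fact
  have *: "cdf M (x + \<epsilon>) - cdf M (x - \<epsilon>) \<le> 0 \<longleftrightarrow> (AE l in M. l \<notin> {x - \<epsilon><..x + \<epsilon>})" if "\<epsilon> > 0" for \<epsilon>
    using that cdf_diff_eq[of "x - \<epsilon>" "x + \<epsilon>"] measure_nonneg[of M "{x - \<epsilon><..x + \<epsilon>}"]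
    by (subst prob_eq_0[symmetric]) (auto simp: order.antisym)
  show ?thesis
  proof
    assume "x \<notin> df_support (cdf M)"
    then obtain \<epsilon> where e: "\<epsilon> > 0" "\<not> cdf M (x + \<epsilon>) - cdf M (x - \<epsilon>) > 0" unfolding df_support_def by blast
    then have "AE l in M. l \<notin> {x - \<epsilon><..x + \<epsilon>}" using *[OF e(1)] by linarith
    then have "AE l in M. \<bar>l - x\<bar> \<ge> \<epsilon>" by eventually_elim auto
    then show "\<exists>\<epsilon>>0. AE l in M. \<bar>l - x\<bar> \<ge> \<epsilon>" using e by blast
  next
    assume "\<exists>\<epsilon>>0. AE l in M. \<bar>l - x\<bar> \<ge> \<epsilon>"
    then obtain \<epsilon> where e: "\<epsilon> > 0" and "AE l in M. \<bar>l - x\<bar> \<ge> \<epsilon>" by blast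
    from this(2) have "AE l in M. l \<notin> {x - \<epsilon> / 2<..x + \<epsilon> / 2}"
      by eventually_elim (use e in auto)
    then have "cdf M (x + \<epsilon> / 2) - cdf M (x - \<epsilon> / 2) \<le> 0" using *[of "\<epsilon> / 2"] e by simp
    then show "x \<notin> df_support (cdf M)" unfolding df_support_def using e by (auto intro!: exI[of _ "\<epsilon> / 2"])
  qed
qed

lemma cmod_of_real_diff_ge_Im: "\<bar>Im z\<bar> \<le> cmod (of_real l - z)"
  using abs_Im_le_cmod[of "of_real l - z"] by simp

lemma integrable_stieltjes:
  assumes "real_distribution M" and d: "\<delta> > 0" "AE l in M. \<delta> \<le> cmod (of_real l - z)"
  shows "integrable M (\<lambda>l. 1 / (of_real l - z))"
proof -
  interpret real_distribution M by fact
  show ?thesis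
  proof (rule integrable_const_bound[where B = "1 / \<delta>"])
    show "AE l in M. cmod (1 / (of_real l - z)) \<le> 1 / \<delta>"
      using d(2) by eventually_elim (use d(1) in \<open>simp add: norm_divide frac_le\<close>)
  qed simp
qed

text \<open>Every point of \<open>D\<close> keeps a positive distance from almost all \<open>l\<close>, so the integrand is locally
bounded.\<close>

lemma stieltjes_holomorphic:
  assumes "real_distribution M" "open D" "AE l in M. of_real l \<notin> D"
  shows "stieltjes M holomorphic_on D" "\<And>z. z \<in> D \<Longrightarrow> integrable M (\<lambda>l. 1 / (of_real l - z))"
proof -
  interpret real_distribution M by fact
  have gap: "\<exists>r>0. ball z r \<subseteq> D \<and> (\<forall>w\<in>ball z r. AE l in M. r \<le> cmod (of_real l - w)) \<and>
         (AE l in M. \<forall>w\<in>ball z r. r \<le> cmod (of_real l - w))" if "z \<in> D" for z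
  proof -
    obtain e where e: "e > 0" "ball z e \<subseteq> D" using openE[OF assms(2) \<open>z \<in> D\<close>] by blast
    have "AE l in M. \<forall>w\<in>ball z (e/2). e / 2 \<le> cmod (of_real l - w)"
      using assms(3)
    proof (eventually_elim, intro ballI)
      fix l w assume "of_real l \<notin> D" "w \<in> ball z (e/2)"
      then have "e \<le> dist z (of_real l)" "dist z w < e / 2"
        using e(2) by (auto simp: subset_iff not_less[symmetric])
      then show "e / 2 \<le> cmod (of_real l - w)"
        using dist_triangle[of z "of_real l" w] by (simp add: dist_norm norm_minus_commute)
    qed
    then show ?thesis using e by (intro exI[of _ "e / 2"]) (auto elim: eventually_mono)
  qed
  show "integrable M (\<lambda>l. 1 / (of_real l - z))" if "z \<in> D" for z
    using gap[OF that] integrable_stieltjes[OF assms(1)] by (metis centre_in_ball)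
  have "stieltjes M holomorphic_on ball z r" if r: "r > 0" "ball z r \<subseteq> D"
    "AE l in M. \<forall>w\<in>ball z r. r \<le> cmod (of_real l - w)" for z r
    unfolding stieltjes_def
  proof (rule holomorphic_on_integral[where B = "1 / r"])
    show "AE l in M. \<forall>w\<in>ball z r. cmod (1 / (of_real l - w)) \<le> 1 / r"
      using r(3) by eventually_elim (use r(1) in \<open>auto simp: norm_divide intro!: frac_le\<close>)
    show "AE l in M. (\<lambda>w. 1 / (of_real l - w)) holomorphic_on ball z r"
      using assms(3) by eventually_elim (use r in \<open>auto intro!: holomorphic_intros\<close>)
  qed (auto simp: finite_measure_axioms)
  then have "\<exists>r>0. stieltjes M holomorphic_on ball z r" if "z \<in> D" for z
    using gap[OF that] by blast
  then show "stieltjes M holomorphic_on D"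
    using holomorphic_on_imp_differentiable_at
    by (metis centre_in_ball field_differentiable_at_within holomorphic_on_def open_ball)
qed

lemma stieltjes_upper_half:
  assumes "real_distribution M"
  shows "stieltjes M holomorphic_on {z. Im z > 0}"
    "\<And>z. Im z > 0 \<Longrightarrow> integrable M (\<lambda>l. 1 / (of_real l - z))"
  using stieltjes_holomorphic[OF assms, of "{z. Im z > 0}"] by (auto simp: open_halfspace_Im_gt)

text \<open>With \<open>z = w\<^sup>2\<close>, the quantity below is the imaginary part of \<open>w\<close> times the Stieltjes transform
  at \<open>z\<close>, divided by the imaginary part of \<open>w\<close>; it stays finite when \<open>z\<close> becomes real outside the
  support.\<close>

definition im_ratio :: "real measure \<Rightarrow> complex \<Rightarrow> real" where
  "im_ratio M z = (LINT l|M. (l + cmod z) / (cmod (of_real l - z))\<^sup>2)"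

lemma im_ratio_integrand_bounds:
  assumes "\<delta> > 0" "\<delta> \<le> cmod (of_real l - z)" "0 \<le> l"
  shows "l / (cmod (of_real l - z))\<^sup>2 \<le> 1 / \<delta> + cmod z / \<delta>\<^sup>2"
    "1 / (cmod (of_real l - z))\<^sup>2 \<le> 1 / \<delta>\<^sup>2"
    "(l + cmod z) / (cmod (of_real l - z))\<^sup>2 \<le> 1 / \<delta> + 2 * cmod z / \<delta>\<^sup>2"
proof -
  define d where "d = cmod (of_real l - z)"
  have d: "d > 0" "\<delta> \<le> d" using assms by (auto simp: d_def)
  have "l \<le> d + cmod z"
    using norm_triangle_ineq[of "of_real l - z" z] assms(3) by (simp add: d_def)
  then have "l / d\<^sup>2 \<le> (d + cmod z) / d\<^sup>2" by (intro divide_right_mono) auto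
  also have "\<dots> = 1 / d + cmod z / d\<^sup>2" using d by (simp add: field_simps power2_eq_square)
  also have "\<dots> \<le> 1 / \<delta> + cmod z / \<delta>\<^sup>2"
    using d assms(1) by (intro add_mono divide_left_mono power_mono) auto
  finally show 1: "l / (cmod (of_real l - z))\<^sup>2 \<le> 1 / \<delta> + cmod z / \<delta>\<^sup>2" unfolding d_def .
  show 2: "1 / (cmod (of_real l - z))\<^sup>2 \<le> 1 / \<delta>\<^sup>2"
    using d assms(1) unfolding d_def[symmetric] by (intro divide_left_mono power_mono) auto
  have "cmod z * (1 / (cmod (of_real l - z))\<^sup>2) \<le> cmod z * (1 / \<delta>\<^sup>2)"
    by (intro mult_left_mono 2) auto
  with 1 show "(l + cmod z) / (cmod (of_real l - z))\<^sup>2 \<le> 1 / \<delta> + 2 * cmod z / \<delta>\<^sup>2"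
    by (simp add: add_divide_distrib)
qed

lemma im_ratio_integrable:
  assumes "real_distribution M" "AE l in M. 0 \<le> l" and d: "\<delta> > 0" "AE l in M. \<delta> \<le> cmod (of_real l - z)"
  shows "integrable M (\<lambda>l. (l + cmod z) / (cmod (of_real l - z))\<^sup>2)"
    "integrable M (\<lambda>l. l / (cmod (of_real l - z))\<^sup>2)"
    "integrable M (\<lambda>l. 1 / (cmod (of_real l - z))\<^sup>2)"
    "im_ratio M z \<le> 1 / \<delta> + 2 * cmod z / \<delta>\<^sup>2"
proof -
  interpret real_distribution M by fact
  show "integrable M (\<lambda>l. l / (cmod (of_real l - z))\<^sup>2)"
  proof (rule integrable_const_bound[where B = "1 / \<delta> + cmod z / \<delta>\<^sup>2"])
    show "AE l in M. norm (l / (cmod (of_real l - z))\<^sup>2) \<le> 1 / \<delta> + cmod z / \<delta>\<^sup>2"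
      using assms(2) d(2) by eventually_elim (use im_ratio_integrand_bounds(1)[OF d(1)] in auto)
  qed simp
  show "integrable M (\<lambda>l. 1 / (cmod (of_real l - z))\<^sup>2)"
  proof (rule integrable_const_bound[where B = "1 / \<delta>\<^sup>2"])
    show "AE l in M. norm (1 / (cmod (of_real l - z))\<^sup>2) \<le> 1 / \<delta>\<^sup>2"
      using assms(2) d(2) by eventually_elim (use im_ratio_integrand_bounds(2)[OF d(1)] in auto)
  qed simp
  show i: "integrable M (\<lambda>l. (l + cmod z) / (cmod (of_real l - z))\<^sup>2)"
  proof (rule integrable_const_bound[where B = "1 / \<delta> + 2 * cmod z / \<delta>\<^sup>2"])
    show "AE l in M. norm ((l + cmod z) / (cmod (of_real l - z))\<^sup>2) \<le> 1 / \<delta> + 2 * cmod z / \<delta>\<^sup>2"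
      using assms(2) d(2) by eventually_elim (use im_ratio_integrand_bounds(3)[OF d(1)] in auto)
  qed simp
  have "im_ratio M z \<le> (\<integral>l. 1 / \<delta> + 2 * cmod z / \<delta>\<^sup>2 \<partial>M)"
    unfolding im_ratio_def
  proof (rule integral_mono_AE[OF i])
    show "AE l in M. (l + cmod z) / (cmod (of_real l - z))\<^sup>2 \<le> 1 / \<delta> + 2 * cmod z / \<delta>\<^sup>2"
      using assms(2) d(2) by eventually_elim (use im_ratio_integrand_bounds(3)[OF d(1)] in auto)
  qed simp
  then show "im_ratio M z \<le> 1 / \<delta> + 2 * cmod z / \<delta>\<^sup>2" using prob_space by simp
qed

text \<open>The bound comes from \<open>|l - z| \<le> l + |z|\<close>; it only depends on a bound for \<open>|z|\<close>.\<close>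

lemma im_ratio_lower_bound:
  assumes "real_distribution M" "AE l in M. 0 \<le> l"
  shows "\<exists>k>0. \<forall>z. z \<noteq> 0 \<longrightarrow> cmod z \<le> R \<longrightarrow> (\<exists>\<delta>>0. AE l in M. \<delta> \<le> cmod (of_real l - z)) \<longrightarrow> k \<le> im_ratio M z"
proof (cases "R > 0")
  case True
  interpret real_distribution M by fact
  define k where "k = (\<integral>l. 1 / (\<bar>l\<bar> + R) \<partial>M)"
  have int: "integrable M (\<lambda>l. 1 / (\<bar>l\<bar> + R))"
    by (rule integrable_const_bound[where B = "1 / R"]) (use True in \<open>auto intro!: AE_I2 divide_left_mono\<close>)
  have "k > 0"
    unfolding k_def using True
    by (intro expectation_greater int) (auto simp: add_nonneg_pos)
  moreover have "k \<le> im_ratio M z" if z: "z \<noteq> 0" "cmod z \<le> R" and "\<delta> > 0" "AE l in M. \<delta> \<le> cmod (of_real l - z)" for z \<delta>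
    unfolding k_def im_ratio_def
  proof (rule integral_mono_AE[OF int im_ratio_integrable(1)[OF assms that(3,4)]])
    show "AE l in M. 1 / (\<bar>l\<bar> + R) \<le> (l + cmod z) / (cmod (complex_of_real l - z))\<^sup>2"
      using assms(2) that(4)
    proof eventually_elim
      case (elim l)
      have pos: "0 < l + cmod z" using elim z by (simp add: add_nonneg_pos)
      have "cmod (of_real l - z) \<le> l + cmod z" using norm_triangle_ineq4[of "of_real l" z] elim by simp
      then have "(cmod (of_real l - z))\<^sup>2 \<le> (l + cmod z)\<^sup>2" by (intro power_mono) auto
      then have "(l + cmod z) / (l + cmod z)\<^sup>2 \<le> (l + cmod z) / (cmod (of_real l - z))\<^sup>2"
        using pos elim that(3) by (intro divide_left_mono mult_pos_pos) auto
      moreover have "1 / (\<bar>l\<bar> + R) \<le> 1 / (l + cmod z)" using pos z elim by (intro divide_left_mono) auto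
      ultimately show ?case using pos by (simp add: power2_eq_square)
    qed
  qed
  ultimately show ?thesis by blast
next
  case False
  then have "\<not> (z \<noteq> 0 \<and> cmod z \<le> R)" for z by (meson less_le_trans zero_less_norm_iff)
  then show ?thesis by (intro exI[of _ 1]) auto
qed

lemma im_ratio_tendsto:
  assumes "real_distribution M" "AE l in M. 0 \<le> l" and d: "\<delta> > 0"
    "\<And>n. AE l in M. \<delta> \<le> cmod (of_real l - Z n)" and Z: "Z \<longlonglongrightarrow> z"
  shows "(\<lambda>n. im_ratio M (Z n)) \<longlonglongrightarrow> im_ratio M z"
  unfolding im_ratio_def
proof -
  interpret real_distribution M by fact
  obtain B where B: "\<And>n. cmod (Z n) \<le> B"
    using convergent_imp_Bseq[of Z] Z by (auto simp: convergent_def Bseq_def)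
  have all: "AE l in M. \<forall>n. \<delta> \<le> cmod (of_real l - Z n)" using d(2) by (simp add: AE_all_countable)
  show "(\<lambda>n. LINT l|M. (l + cmod (Z n)) / (cmod (of_real l - Z n))\<^sup>2)
      \<longlonglongrightarrow> (LINT l|M. (l + cmod z) / (cmod (of_real l - z))\<^sup>2)"
  proof (rule integral_dominated_convergence[where w = "\<lambda>_. 1 / \<delta> + 2 * B / \<delta>\<^sup>2"])
    show "AE l in M. (\<lambda>n. (l + cmod (Z n)) / (cmod (of_real l - Z n))\<^sup>2) \<longlonglongrightarrow> (l + cmod z) / (cmod (of_real l - z))\<^sup>2"
      using all
    proof eventually_elim
      case (elim l)
      have "(\<lambda>n. cmod (of_real l - Z n)) \<longlonglongrightarrow> cmod (of_real l - z)" by (intro tendsto_intros Z)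
      then have "\<delta> \<le> cmod (of_real l - z)" using elim by (meson LIMSEQ_le_const)
      then show ?case using d(1) by (intro tendsto_intros Z) auto
    qed
    show "AE l in M. norm ((l + cmod (Z n)) / (cmod (of_real l - Z n))\<^sup>2) \<le> 1 / \<delta> + 2 * B / \<delta>\<^sup>2" for n
      using d(2)[of n] assms(2)
    proof eventually_elim
      case (elim l)
      have "(l + cmod (Z n)) / (cmod (of_real l - Z n))\<^sup>2 \<le> 1 / \<delta> + 2 * cmod (Z n) / \<delta>\<^sup>2"
        by (rule im_ratio_integrand_bounds(3)) (use elim d in auto)
      also have "\<dots> \<le> 1 / \<delta> + 2 * B / \<delta>\<^sup>2" using B d(1) by (intro add_mono divide_right_mono) auto
      finally show ?case using elim by simp
    qed
  qed auto
qed

lemma Im_stieltjes: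
  assumes "real_distribution M" "AE l in M. 0 \<le> l" "Im z > 0"
  shows "Im (stieltjes M z) = Im z * (LINT l|M. 1 / (cmod (of_real l - z))\<^sup>2)"
    "Im (z * stieltjes M z) = Im z * (LINT l|M. l / (cmod (of_real l - z))\<^sup>2)"
    "Im z * im_ratio M z = Im (z * stieltjes M z) + cmod z * Im (stieltjes M z)"
    "0 < Im (stieltjes M z)" "0 \<le> Im (z * stieltjes M z)"
proof -
  interpret real_distribution M by fact
  have d: "AE l in M. Im z \<le> cmod (of_real l - z)"
    using cmod_of_real_diff_ge_Im[of z] assms(3) by (intro AE_I2) (metis abs_of_pos)
  note int = im_ratio_integrable[OF assms(1-3) d] and i0 = stieltjes_upper_half(2)[OF assms(1,3)]
  have ne: "of_real l - z \<noteq> 0" for l using assms(3) by (auto simp: complex_eq_iff)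
  show 1: "Im (stieltjes M z) = Im z * (LINT l|M. 1 / (cmod (of_real l - z))\<^sup>2)"
  proof -
    have "Im (stieltjes M z) = (LINT l|M. Im (1 / (of_real l - z)))"
      unfolding stieltjes_def by (rule integral_Im[OF i0, symmetric])
    also have "\<dots> = (LINT l|M. Im z * (1 / (cmod (of_real l - z))\<^sup>2))"
      by (intro Bochner_Integration.integral_cong refl) (simp add: Im_divide cmod_power2)
    also have "\<dots> = Im z * (LINT l|M. 1 / (cmod (of_real l - z))\<^sup>2)"
      by (rule Bochner_Integration.integral_mult_right_zero)
    finally show ?thesis .
  qed
  show 2: "Im (z * stieltjes M z) = Im z * (LINT l|M. l / (cmod (of_real l - z))\<^sup>2)"
  proof -
    have "z * stieltjes M z = (LINT l|M. z * (1 / (of_real l - z)))"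
      unfolding stieltjes_def by (rule Bochner_Integration.integral_mult_right_zero[symmetric])
    then have "Im (z * stieltjes M z) = (LINT l|M. Im (z * (1 / (of_real l - z))))"
      using Bochner_Integration.integrable_mult_right[OF i0, of z] by (subst integral_Im) simp_all
    also have "\<dots> = (LINT l|M. Im z * (l / (cmod (of_real l - z))\<^sup>2))"
      by (intro Bochner_Integration.integral_cong refl) (simp add: Im_divide cmod_power2 algebra_simps)
    also have "\<dots> = Im z * (LINT l|M. l / (cmod (of_real l - z))\<^sup>2)"
      by (rule Bochner_Integration.integral_mult_right_zero)
    finally show ?thesis .
  qed
  have "im_ratio M z = (LINT l|M. l / (cmod (of_real l - z))\<^sup>2 + cmod z * (1 / (cmod (of_real l - z))\<^sup>2))"
    unfolding im_ratio_def by (simp add: add_divide_distrib)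
  also have "\<dots> = (LINT l|M. l / (cmod (of_real l - z))\<^sup>2) + cmod z * (LINT l|M. 1 / (cmod (of_real l - z))\<^sup>2)"
    by (simp only: Bochner_Integration.integral_add[OF int(2) Bochner_Integration.integrable_mult_right[OF int(3), of "cmod z"]]
        Bochner_Integration.integral_mult_right_zero)
  finally show "Im z * im_ratio M z = Im (z * stieltjes M z) + cmod z * Im (stieltjes M z)"
    unfolding 1 2 by (simp add: algebra_simps)
  have "0 < (LINT l|M. 1 / (cmod (of_real l - z))\<^sup>2)"
    using ne int by (intro expectation_greater) auto
  then show "0 < Im (stieltjes M z)" unfolding 1 using assms(3) by simp
  have "0 \<le> (LINT l|M. l / (cmod (of_real l - z))\<^sup>2)"
    by (rule integral_nonneg_AE) (use assms(2) in eventually_elim, auto)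
  then show "0 \<le> Im (z * stieltjes M z)" unfolding 2 using assms(3) by simp
qed

text \<open>At height \<open>\<delta>\<close> above the centre of an interval of length \<open>2 \<delta>\<close>, the Poisson kernel is at least
\<open>1 / (2 \<delta>)\<close> on the interval.  So the bound gives the interval a mass of order \<open>\<delta>\<^sup>2\<close>, and mass is
subadditive.\<close>

lemma null_if_Im_stieltjes_le:
  assumes M: "real_distribution M" and r: "r > 0"
    and bd: "\<And>z. Im z > 0 \<Longrightarrow> cmod (z - of_real x) < r \<Longrightarrow> Im (stieltjes M z) \<le> K * Im z"
  shows "AE l in M. \<bar>l - x\<bar> \<ge> r / 2"
proof -
  interpret real_distribution M by fact
  have "measure M {x - r / 2<..x + r / 2} \<le> 0"
  proof (rule subadditive_quadratic_imp_nonpos[where \<phi> = "\<lambda>\<alpha> \<beta>. measure M {\<alpha><..\<beta>}" and a = "x - r/2" and b = "x + r/2" and K = "K / 2"])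
    fix \<alpha> \<mu> \<beta> :: real
    assume "\<alpha> \<le> \<mu>" "\<mu> \<le> \<beta>"
    then have "{\<alpha><..\<beta>} = {\<alpha><..\<mu>} \<union> {\<mu><..\<beta>}" by auto
    then show "measure M {\<alpha><..\<beta>} \<le> measure M {\<alpha><..\<mu>} + measure M {\<mu><..\<beta>}"
      by (simp add: measure_Un_le)
  next
    fix \<alpha> \<beta> assume ab: "x - r / 2 \<le> \<alpha>" "\<alpha> < \<beta>" "\<beta> \<le> x + r / 2"
    define \<delta> where "\<delta> = (\<beta> - \<alpha>) / 2"
    define z where "z = Complex ((\<alpha> + \<beta>) / 2) \<delta>"
    have del: "\<delta> > 0" using ab by (simp add: \<delta>_def)
    have "cmod (z - of_real x) \<le> \<bar>(\<alpha> + \<beta>) / 2 - x\<bar> + \<delta>"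
      using cmod_le[of "z - of_real x"] del by (simp add: z_def)
    also have "\<dots> < r" using ab r by (simp add: \<delta>_def field_simps abs_if)
    finally have "Im (stieltjes M z) \<le> K * \<delta>" using bd[of z] del by (simp add: z_def)
    moreover have "measure M {\<alpha><..\<beta>} * (1 / (2 * \<delta>)) \<le> Im (stieltjes M z)"
    proof -
      have i0: "integrable M (\<lambda>l. 1 / (of_real l - z))"
        using stieltjes_upper_half(2)[OF M, of z] del by (simp add: z_def)
      have "measure M {\<alpha><..\<beta>} * (1 / (2 * \<delta>)) = (LINT l|M. indicator {\<alpha><..\<beta>} l * (1 / (2 * \<delta>)))"
        by simp
      also have "\<dots> \<le> (LINT l|M. Im (1 / (of_real l - z)))"
      proof (rule integral_mono)
        show "integrable M (\<lambda>l. Im (1 / (of_real l - z)))" using i0 by (rule integrable_Im)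
        show "indicator {\<alpha><..\<beta>} l * (1 / (2 * \<delta>)) \<le> Im (1 / (of_real l - z))" for l
        proof -
          have eq: "Im (1 / (of_real l - z)) = \<delta> / ((l - (\<alpha> + \<beta>) / 2)\<^sup>2 + \<delta>\<^sup>2)"
            by (simp add: Im_divide z_def)
          show ?thesis
          proof (cases "l \<in> {\<alpha><..\<beta>}")
            case True
            then have "\<bar>l - (\<alpha> + \<beta>) / 2\<bar> \<le> \<delta>" by (auto simp: \<delta>_def abs_if field_simps)
            then have "(l - (\<alpha> + \<beta>) / 2)\<^sup>2 \<le> \<delta>\<^sup>2" using del by (metis abs_le_square_iff abs_of_pos)
            then have "\<delta> / (2 * \<delta>\<^sup>2) \<le> \<delta> / ((l - (\<alpha> + \<beta>) / 2)\<^sup>2 + \<delta>\<^sup>2)"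
              using del by (intro divide_left_mono) (auto intro!: mult_pos_pos add_nonneg_pos)
            then show ?thesis unfolding eq using True del by (simp add: power2_eq_square)
          qed (use del eq in auto)
        qed
        show "integrable M (\<lambda>l. indicator {\<alpha><..\<beta>} l * (1 / (2 * \<delta>)))"
          by (intro Bochner_Integration.integrable_mult_left integrable_real_indicator)
             (auto simp: emeasure_eq_measure)
      qed
      also have "\<dots> = Im (stieltjes M z)" unfolding stieltjes_def by (rule integral_Im[OF i0])
      finally show ?thesis .
    qed
    ultimately have "measure M {\<alpha><..\<beta>} * (1 / (2 * \<delta>)) \<le> K * \<delta>" by linarith
    then have "measure M {\<alpha><..\<beta>} \<le> K * \<delta> * (2 * \<delta>)" using del by (simp add: pos_divide_le_eq)
    also have "\<dots> = K / 2 * (\<beta> - \<alpha>)\<^sup>2" by (simp add: \<delta>_def power2_eq_square)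
    finally show "measure M {\<alpha><..\<beta>} \<le> K / 2 * (\<beta> - \<alpha>)\<^sup>2" .
  qed (use r in auto)
  then have "AE l in M. l \<notin> {x - r / 2<..x + r / 2}"
    by (subst prob_eq_0[symmetric]) (auto simp: measure_le_0_iff)
  then show ?thesis by eventually_elim (auto simp: abs_real_def split: if_splits)
qed

lemma gap_near:
  assumes "AE l in M. \<epsilon> \<le> \<bar>l - x\<bar>" "cmod (z - of_real x) \<le> \<epsilon> / 2"
  shows "AE l in M. \<epsilon> / 2 \<le> cmod (of_real l - z)"
  using assms(1)
proof eventually_elim
  case (elim l)
  have "\<bar>l - x\<bar> = cmod (of_real l - of_real x)" by (simp only: of_real_diff[symmetric] norm_of_real)
  also have "\<dots> \<le> cmod (of_real l - z) + cmod (z - of_real x)"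
    using norm_triangle_ineq[of "of_real l - z" "z - of_real x"] by simp
  finally show ?case using elim assms(2) by linarith
qed

lemma stieltjes_gap_bound:
  assumes "real_distribution M" "\<delta> > 0" "AE l in M. \<delta> \<le> cmod (of_real l - z)"
  shows "cmod (stieltjes M z) \<le> 1 / \<delta>"
proof -
  interpret M: real_distribution M by fact
  have "cmod (stieltjes M z) \<le> (\<integral>l. cmod (1 / (of_real l - z)) \<partial>M)"
    unfolding stieltjes_def by (rule integral_norm_bound)
  also have "\<dots> \<le> (\<integral>l. 1 / \<delta> \<partial>M)"
  proof (rule integral_mono_AE')
    show "AE l in M. cmod (1 / (of_real l - z)) \<le> 1 / \<delta>"
      using assms(3) by eventually_elim (use assms(2) in \<open>auto simp: norm_divide intro!: frac_le\<close>)
  qed (use assms(2) in auto)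
  finally show ?thesis using M.prob_space by simp
qed

lemma stieltjes_tendsto_gap:
  assumes "real_distribution M" "\<epsilon> > 0" "AE l in M. \<epsilon> \<le> \<bar>l - x\<bar>" "Z \<longlonglongrightarrow> of_real x"
  shows "(\<lambda>n. stieltjes M (Z n)) \<longlonglongrightarrow> stieltjes M (of_real x)"
proof -
  have "AE l in M. of_real l \<notin> ball (complex_of_real x) \<epsilon>"
    using assms(3)
  proof eventually_elim
    case (elim l)
    have "dist (complex_of_real x) (of_real l) = \<bar>l - x\<bar>"
      by (metis abs_minus_commute dist_norm norm_of_real of_real_diff)
    then show ?case using elim by simp
  qed
  from stieltjes_holomorphic(1)[OF assms(1) open_ball this]
  have "isCont (stieltjes M) (of_real x)"
    using assms(2) by (meson centre_in_ball continuous_on_eq_continuous_at holomorphic_on_imp_continuous_on open_ball)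
  then show ?thesis using assms(4) isCont_tendsto_compose by blast
qed

lemma stieltjes_of_real: "stieltjes M (of_real x) = of_real (LINT l|M. 1 / (l - x))"
proof -
  have "1 / (of_real l - of_real x) = complex_of_real (1 / (l - x))" for l by simp
  then show ?thesis unfolding stieltjes_def by (simp only: integral_complex_of_real)
qed

text \<open>Seen from almost every \<open>l\<close>, the points \<open>x\<close> and \<open>y\<close> lie on the same side, so
\<open>1 / (l - y) - 1 / (l - x) = (y - x) / ((l - x) (l - y))\<close> is positive.\<close>

lemma stieltjes_increasing_in_gap:
  assumes "real_distribution M" and e: "\<epsilon> > 0" and gap: "AE l in M. \<epsilon> \<le> \<bar>l - x0\<bar>"
    and xy: "\<bar>x - x0\<bar> \<le> \<epsilon> / 2" "\<bar>y - x0\<bar> \<le> \<epsilon> / 2" "x < y"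
  shows "Re (stieltjes M (of_real x)) < Re (stieltjes M (of_real y))"
    "Re (stieltjes M (of_real y)) - Re (stieltjes M (of_real x)) \<le> (y - x) * (4 / \<epsilon>\<^sup>2)"
proof -
  interpret real_distribution M by fact
  have int: "integrable M (\<lambda>l. 1 / (l - u))" if "\<bar>u - x0\<bar> \<le> \<epsilon> / 2" for u
  proof (rule integrable_const_bound[where B = "2 / \<epsilon>"])
    show "AE l in M. norm (1 / (l - u)) \<le> 2 / \<epsilon>"
      using gap
    proof eventually_elim
      case (elim l)
      then have "\<epsilon> / 2 \<le> \<bar>l - u\<bar>" using that by linarith
      then have "1 / \<bar>l - u\<bar> \<le> 1 / (\<epsilon> / 2)" using e by (intro frac_le) auto
      then show ?case by simp
    qed
  qed simp
  have key: "AE l in M. 0 < 1 / (l - y) - 1 / (l - x) \<and> 1 / (l - y) - 1 / (l - x) \<le> (y - x) * (4 / \<epsilon>\<^sup>2)"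
    using gap
  proof eventually_elim
    case (elim l)
    have far: "\<epsilon> / 2 \<le> \<bar>l - x\<bar>" "\<epsilon> / 2 \<le> \<bar>l - y\<bar>" using elim xy by linarith+
    have same: "0 < (l - x) * (l - y)"
    proof (cases "l < x0")
      case True
      then have "l - x < 0" "l - y < 0" using elim xy e by linarith+
      then show ?thesis by (rule mult_neg_neg)
    next
      case False
      then have "0 < l - x" "0 < l - y" using elim xy e by linarith+
      then show ?thesis by (rule mult_pos_pos)
    qed
    have "(\<epsilon> / 2) * (\<epsilon> / 2) \<le> \<bar>l - x\<bar> * \<bar>l - y\<bar>" using far e by (intro mult_mono) auto
    then have ge: "\<epsilon>\<^sup>2 / 4 \<le> (l - x) * (l - y)" using same by (simp add: abs_mult[symmetric] power2_eq_square)
    have ne: "l - x \<noteq> 0" "l - y \<noteq> 0" using same by auto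
    have eq: "1 / (l - y) - 1 / (l - x) = (y - x) / ((l - x) * (l - y))" using ne by (simp add: field_simps)
    have "(y - x) / ((l - x) * (l - y)) \<le> (y - x) / (\<epsilon>\<^sup>2 / 4)"
      using ge same e xy by (intro divide_left_mono) auto
    then show ?case unfolding eq using same xy by simp
  qed
  have diff: "Re (stieltjes M (of_real y)) - Re (stieltjes M (of_real x)) = (LINT l|M. 1 / (l - y) - 1 / (l - x))"
    unfolding stieltjes_of_real using int[OF xy(1)] int[OF xy(2)] by simp
  have i: "integrable M (\<lambda>l. 1 / (l - y) - 1 / (l - x))" using int[OF xy(1)] int[OF xy(2)] by simp
  have "0 < (LINT l|M. 1 / (l - y) - 1 / (l - x))"
    by (rule expectation_greater[OF i]) (use key in eventually_elim, blast)
  then show "Re (stieltjes M (of_real x)) < Re (stieltjes M (of_real y))" using diff by linarith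
  have "(LINT l|M. 1 / (l - y) - 1 / (l - x)) \<le> (LINT l|M. (y - x) * (4 / \<epsilon>\<^sup>2))"
    by (rule integral_mono_AE[OF i]) (simp, use key in eventually_elim, blast)
  then show "Re (stieltjes M (of_real y)) - Re (stieltjes M (of_real x)) \<le> (y - x) * (4 / \<epsilon>\<^sup>2)"
    using diff prob_space by simp
qed

text \<open>Since \<open>f\<close> is Lipschitz and real on the real axis, the imaginary part is of the order of the height.\<close>

lemma gap_if_real_extension:
  assumes M: "real_distribution M" and f: "f holomorphic_on ball (of_real x0) \<sigma>" "\<sigma> > 0"
    and re: "\<And>x. of_real x \<in> ball (complex_of_real x0) \<sigma> \<Longrightarrow> Im (f (of_real x)) = 0"
    and eq: "\<And>z. z \<in> ball (of_real x0) \<sigma> \<Longrightarrow> Im z > 0 \<Longrightarrow> stieltjes M z = f z"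
  shows "\<exists>e>0. AE l in M. e \<le> \<bar>l - x0\<bar>"
proof -
  let ?C = "cball (complex_of_real x0) (\<sigma> / 2)"
  have sub: "?C \<subseteq> ball (of_real x0) \<sigma>" using f(2) by auto
  have "deriv f holomorphic_on ball (of_real x0) \<sigma>" using f(1) by (rule holomorphic_deriv) simp
  then have "continuous_on ?C (deriv f)" using sub holomorphic_on_imp_continuous_on continuous_on_subset by blast
  then have "bounded (deriv f ` ?C)" by (intro compact_imp_bounded compact_continuous_image compact_cball)
  then obtain K where K: "\<And>z. z \<in> ?C \<Longrightarrow> cmod (deriv f z) \<le> K" unfolding bounded_iff by blast
  have lip: "cmod (f z - f w) \<le> K * cmod (z - w)" if "z \<in> ?C" "w \<in> ?C" for z w
  proof (rule field_differentiable_bound[OF convex_cball _ K that])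
    show "(f has_field_derivative deriv f u) (at u within ?C)" if "u \<in> ?C" for u
      using holomorphic_derivI[OF f(1) open_ball, of u] sub that by (meson DERIV_subset subsetD subset_UNIV)
  qed
  have "AE l in M. \<sigma> / 2 / 2 \<le> \<bar>l - x0\<bar>"
  proof (rule null_if_Im_stieltjes_le[OF M, where K = K])
    fix z assume z: "Im z > 0" "cmod (z - of_real x0) < \<sigma> / 2"
    have zC: "z \<in> ?C" using z by (simp add: dist_norm norm_minus_commute)
    have "cmod (of_real (Re z) - of_real x0) \<le> cmod (z - of_real x0)"
      using abs_Re_le_cmod[of "z - of_real x0"] by (simp only: of_real_diff[symmetric] norm_of_real) simp
    then have wC: "of_real (Re z) \<in> ?C" using z by (simp add: dist_norm norm_minus_commute)
    have "z \<in> ball (of_real x0) \<sigma>" "of_real (Re z) \<in> ball (complex_of_real x0) \<sigma>" using zC wC sub by blast+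
    then have "Im (stieltjes M z) = Im (f z - f (of_real (Re z)))"
      by (simp only: eq z(1) re minus_complex.sel diff_zero)
    also have "\<dots> \<le> cmod (f z - f (of_real (Re z)))" using abs_Im_le_cmod by (meson abs_le_D1)
    also have "\<dots> \<le> K * cmod (z - of_real (Re z))" by (rule lip[OF zC wC])
    also have "cmod (z - of_real (Re z)) = Im z" using z(1) by (simp add: cmod_def)
    finally show "Im (stieltjes M z) \<le> K * Im z" .
  qed (use f(2) in simp)
  then show ?thesis using f(2) by (intro exI[of _ "\<sigma> / 2 / 2"]) auto
qed

text \<open>The measure \<open>underF c F\<close> is the mixture of the point mass at \<open>0\<close> and \<open>F\<close> with weights \<open>1 - c\<close> and \<open>c\<close>.
It is realised as the law of a variable that is drawn from \<open>F\<close> or set to \<open>0\<close> by an independent coin.\<close>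

lemma underF_mixture:
  assumes F: "real_distribution F" and c: "0 < c" "c \<le> 1" and F_nonneg: "\<forall>x<0. cdf F x = 0"
  shows "real_distribution (underF c F)" "AE l in underF c F. 0 \<le> l"
    "\<And>(f :: real \<Rightarrow> complex) B. f \<in> borel_measurable borel \<Longrightarrow> (\<And>l. cmod (f l) \<le> B) \<Longrightarrow>
       integral\<^sup>L (underF c F) f = of_real (1 - c) * f 0 + of_real c * integral\<^sup>L F f"
proof -
  interpret F: real_distribution F by fact
  let ?b = "measure_pmf (bernoulli_pmf c)"
  define Q where "Q = distr (?b \<Otimes>\<^sub>M F) borel (\<lambda>(b, x). if b then x else 0)"
  interpret P: pair_prob_space ?b F ..
  have meas[measurable]: "(\<lambda>(b, x). if b then x else 0) \<in> borel_measurable (?b \<Otimes>\<^sub>M F)"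
    by measurable
  interpret Q: real_distribution Q
    unfolding Q_def by (rule P.P.real_distribution_distr) simp
  have int: "integral\<^sup>L Q f = of_real (1 - c) * f 0 + of_real c * integral\<^sup>L F f"
    if meas[measurable]: "f \<in> borel_measurable borel" and bd: "\<And>l. cmod (f l) \<le> B" for f :: "real \<Rightarrow> complex" and B :: real
  proof -
    have "integral\<^sup>L Q f = (\<integral>p. f (if fst p then snd p else 0) \<partial>(?b \<Otimes>\<^sub>M F))"
      unfolding Q_def by (subst integral_distr) (auto simp: case_prod_beta)
    also have "\<dots> = (\<integral>b. (\<integral>x. f (if fst (b, x) then snd (b, x) else 0) \<partial>F) \<partial>?b)"
      using bd by (intro P.integral_fst'[symmetric] P.P.integrable_const_bound[where B = B]) auto
    also have "\<dots> = of_real (1 - c) * f 0 + of_real c * integral\<^sup>L F f"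
      using c F.prob_space by (subst integral_measure_pmf[where A = UNIV]) (auto simp: UNIV_bool scaleR_conv_of_real F.prob_space)
    finally show ?thesis .
  qed
  have "cdf Q x = (1 - c) * indicator {0..} x + c * cdf F x" for x
  proof -
    have "complex_of_real (cdf Q x) = integral\<^sup>L Q (\<lambda>l. of_real (indicator {..x} l))"
      unfolding integral_complex_of_real cdf_def by simp
    also have "\<dots> = of_real (1 - c) * of_real (indicator {..x} (0::real)) + of_real c * integral\<^sup>L F (\<lambda>l. of_real (indicator {..x} l))"
      by (rule int[of _ 1]) (auto simp: indicator_def)
    also have "\<dots> = of_real ((1 - c) * indicator {0..} x + c * cdf F x)"
    proof -
      have "indicator {..x} (0::real) = (indicator {0..} x :: real)" by (simp add: indicator_def)
      then show ?thesis unfolding integral_complex_of_real cdf_def by simp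
    qed
    finally show ?thesis using of_real_eq_iff by blast
  qed
  then have eq: "(\<lambda>x. (1 - c) * indicator {0..} x + c * cdf F x) = cdf Q" by auto
  have "real_distribution (interval_measure (cdf Q))"
    by (rule real_distribution_interval_measure)
       (auto simp: Q.cdf_nondecreasing Q.cdf_is_right_cont Q.cdf_lim_at_bot Q.cdf_lim_at_top_prob)
  moreover have "cdf (interval_measure (cdf Q)) = cdf Q"
    by (rule cdf_interval_measure)
       (auto simp: Q.cdf_nondecreasing Q.cdf_is_right_cont Q.cdf_lim_at_bot)
  ultimately have "interval_measure (cdf Q) = Q"
    using cdf_unique Q.real_distribution_axioms by blast
  then have uF: "underF c F = Q" unfolding underF_def eq .
  show "real_distribution (underF c F)" unfolding uF ..
  show "AE l in underF c F. 0 \<le> l" unfolding uF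
    by (subst AE_nonneg_iff_cdf) (auto simp: Q.real_distribution_axioms eq[symmetric] F_nonneg)
  show "integral\<^sup>L (underF c F) f = of_real (1 - c) * f 0 + of_real c * integral\<^sup>L F f"
    if "f \<in> borel_measurable borel" "\<And>l. cmod (f l) \<le> B" for f :: "real \<Rightarrow> complex" and B
    unfolding uF using int that by blast
qed

section \<open>The denominators and their moments\<close>

abbreviation qd :: "complex \<Rightarrow> complex \<Rightarrow> real \<times> real \<Rightarrow> complex" where
  "qd m g p \<equiv> qden m g (fst p) (snd p)"

locale spectral_pair = prob_space H for H :: "(real \<times> real) measure" +
  assumes sets_H[measurable_cong]: "sets H = sets borel"
    and H_quadrant: "AE p in H. 0 \<le> fst p \<and> 0 < snd p"
begin

lemma measurable_coordinates[measurable]: "fst \<in> borel_measurable H" "snd \<in> borel_measurable H"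
  by (auto simp: measurable_cong_sets[OF sets_H refl] intro!: borel_measurable_continuous_onI continuous_intros)

text \<open>The weight \<open>1 + s + t\<close> makes this stable under small changes of \<open>m\<close> and \<open>g\<close> although \<open>H\<close> may have unbounded
support, and it bounds all integrands that occur.\<close>

definition nondegenerate :: "real \<Rightarrow> complex \<Rightarrow> complex \<Rightarrow> bool" where
  "nondegenerate \<epsilon> m g \<longleftrightarrow> \<epsilon> > 0 \<and> (AE p in H. \<epsilon> * (1 + fst p + snd p) \<le> cmod (qd m g p))"

lemma nondegenerate_bounds:
  assumes "nondegenerate \<epsilon> m g"
  shows "\<epsilon> > 0" "AE p in H. 0 \<le> fst p \<and> 0 < snd p \<and> qd m g p \<noteq> 0 \<and> 0 < cmod (qd m g p) \<and>
    (1 + fst p + snd p) / cmod (qd m g p) \<le> 1 / \<epsilon>"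
proof -
  show e: "\<epsilon> > 0" using assms by (simp add: nondegenerate_def)
  have "AE p in H. \<epsilon> * (1 + fst p + snd p) \<le> cmod (qd m g p)" using assms by (simp add: nondegenerate_def)
  with H_quadrant show "AE p in H. 0 \<le> fst p \<and> 0 < snd p \<and> qd m g p \<noteq> 0 \<and> 0 < cmod (qd m g p) \<and>
    (1 + fst p + snd p) / cmod (qd m g p) \<le> 1 / \<epsilon>"
  proof eventually_elim
    case (elim p)
    then have "0 < \<epsilon> * (1 + fst p + snd p)" using e by simp
    then have "0 < cmod (qd m g p)" using elim by linarith
    then show ?case using elim e by (auto simp: divide_le_eq field_simps)
  qed
qed

text \<open>For large \<open>s + t\<close> the imaginary part of \<open>q\<close> gives the bound; for small \<open>s + t\<close> the value is close to \<open>1\<close>.\<close>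

lemma nondegenerate_upper_half:
  assumes "Im m > 0" "Im g > 0"
  shows "\<exists>\<epsilon>. nondegenerate \<epsilon> m g"
proof -
  define a where "a = min (Im m) (Im g)"
  define b where "b = cmod m + cmod g"
  define \<epsilon> where "\<epsilon> = a / (1 + 2 * b)"
  have a: "a > 0" using assms by (simp add: a_def)
  have "a \<le> cmod m" using abs_Im_le_cmod[of m] by (simp add: a_def)
  then have b: "a \<le> b" "b > 0" using a by (auto simp: b_def add_increasing2 intro: less_le_trans)
  have e: "\<epsilon> > 0" using a b by (simp add: \<epsilon>_def)
  have "\<epsilon> * (1 + s + t) \<le> cmod (qden m g s t)" if "0 \<le> s" "0 \<le> t" for s t
  proof -
    have "a * (s + t) = s * a + t * a" by (simp add: algebra_simps)
    also have "\<dots> \<le> s * Im g + t * Im m" using that by (intro add_mono mult_left_mono) (auto simp: a_def)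
    also have "\<dots> = Im (qden m g s t)" by simp
    also have "\<dots> \<le> cmod (qden m g s t)" using abs_Im_le_cmod by (meson abs_le_D1)
    finally have 1: "a * (s + t) \<le> cmod (qden m g s t)" .
    have "cmod (of_real s * g + of_real t * m) \<le> s * cmod g + t * cmod m"
      using norm_triangle_ineq[of "of_real s * g" "of_real t * m"] that by (simp add: norm_mult)
    also have "\<dots> \<le> s * b + t * b" using that by (intro add_mono mult_left_mono) (auto simp: b_def)
    finally have "1 - b * (s + t) \<le> 1 - cmod (of_real s * g + of_real t * m)" by (simp add: algebra_simps)
    also have "\<dots> \<le> cmod (qden m g s t)"
      using norm_triangle_ineq2[of 1 "- (of_real s * g + of_real t * m)"]
      by (simp only: norm_minus_cancel norm_one diff_minus_eq_add add.assoc)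
    finally have 2: "1 - b * (s + t) \<le> cmod (qden m g s t)" .
    show ?thesis
    proof (cases "2 * b * (s + t) \<ge> 1")
      case True
      then have "\<epsilon> * (1 + s + t) \<le> \<epsilon> * ((1 + 2 * b) * (s + t))"
        using e by (intro mult_left_mono) (auto simp: algebra_simps)
      also have "\<dots> = a * (s + t)" using b by (simp add: \<epsilon>_def)
      finally show ?thesis using 1 by linarith
    next
      case False
      then have "2 * b * (1 + s + t) \<le> 2 * b + 1" by (simp add: algebra_simps)
      then have "a * (2 * b * (1 + s + t)) \<le> a * (2 * b + 1)" using a by (intro mult_left_mono) auto
      then have "2 * b * (\<epsilon> * (1 + s + t)) \<le> a" using b by (simp add: \<epsilon>_def field_simps)
      also have "\<dots> \<le> 2 * b * (1 / 2)" using b by simp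
      finally have "\<epsilon> * (1 + s + t) \<le> 1 / 2" using b mult_le_cancel_left_pos[of "2 * b"] by simp
      then show ?thesis using 2 False by (simp add: algebra_simps)
    qed
  qed
  note * = this
  have "AE p in H. \<epsilon> * (1 + fst p + snd p) \<le> cmod (qd m g p)"
    using H_quadrant by eventually_elim (use * in auto)
  then show ?thesis using e by (auto simp: nondegenerate_def)
qed

lemma integrable_over_qd:
  assumes nd: "nondegenerate \<epsilon> m g" and [measurable]: "a \<in> borel_measurable H"
    and a: "AE p in H. \<bar>a p\<bar> \<le> 1 + fst p + snd p"
  shows "integrable H (\<lambda>p. of_real (a p) / qd m g p)"
    and "AE p in H. cmod (of_real (a p) / qd m g p) \<le> 1 / \<epsilon>"
proof -
  show bd: "AE p in H. cmod (of_real (a p) / qd m g p) \<le> 1 / \<epsilon>"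
    using nondegenerate_bounds(2)[OF nd] a
  proof eventually_elim
    case (elim p)
    then have "\<bar>a p\<bar> / cmod (qd m g p) \<le> (1 + fst p + snd p) / cmod (qd m g p)"
      by (intro divide_right_mono) auto
    then show ?case using elim by (simp add: norm_divide)
  qed
  show "integrable H (\<lambda>p. of_real (a p) / qd m g p)"
    by (rule integrable_const_bound[OF bd]) measurable
qed

lemma integrable_over_qd_qd:
  assumes nd: "nondegenerate \<epsilon> m g" "nondegenerate \<epsilon> m' g'" and [measurable]: "a \<in> borel_measurable H"
    and a: "AE p in H. \<bar>a p\<bar> \<le> (1 + fst p + snd p)\<^sup>2"
  shows "integrable H (\<lambda>p. of_real (a p) / (qd m g p * qd m' g' p))"
    and "AE p in H. cmod (of_real (a p) / (qd m g p * qd m' g' p)) \<le> 1 / \<epsilon>\<^sup>2"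
proof -
  show bd: "AE p in H. cmod (of_real (a p) / (qd m g p * qd m' g' p)) \<le> 1 / \<epsilon>\<^sup>2"
    using nondegenerate_bounds(2)[OF nd(1)] nondegenerate_bounds(2)[OF nd(2)] a
  proof eventually_elim
    case (elim p)
    let ?u = "1 + fst p + snd p"
    have "\<bar>a p\<bar> / (cmod (qd m g p) * cmod (qd m' g' p)) \<le> (?u / cmod (qd m g p)) * (?u / cmod (qd m' g' p))"
      using elim by (simp add: power2_eq_square divide_right_mono)
    also have "\<dots> \<le> (1 / \<epsilon>) * (1 / \<epsilon>)"
      using elim nondegenerate_bounds(1)[OF nd(1)] by (intro mult_mono) auto
    finally show ?case by (simp add: norm_divide norm_mult power2_eq_square)
  qed
  show "integrable H (\<lambda>p. of_real (a p) / (qd m g p * qd m' g' p))"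
    by (rule integrable_const_bound[OF bd]) measurable
qed

lemma integrable_over_norm_qd:
  assumes nd: "nondegenerate \<epsilon> m g" and [measurable]: "a \<in> borel_measurable H"
    and a: "AE p in H. \<bar>a p\<bar> \<le> (1 + fst p + snd p)\<^sup>2"
  shows "integrable H (\<lambda>p. a p / (cmod (qd m g p))\<^sup>2)"
proof -
  have "integrable H (\<lambda>p. cmod (of_real (a p) / (qd m g p * qd m g p)))"
    by (intro integrable_norm integrable_over_qd_qd(1)[OF nd nd] a) measurable
  then have "integrable H (\<lambda>p. \<bar>a p\<bar> / (cmod (qd m g p))\<^sup>2)"
    by (simp add: norm_divide norm_mult power2_eq_square)
  then show ?thesis
    by (rule Bochner_Integration.integrable_bound) (auto simp: abs_divide)
qed

lemma monomial_bounds: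
  "AE p in H. \<bar>1\<bar> \<le> 1 + fst p + snd p" "AE p in H. \<bar>fst p\<bar> \<le> 1 + fst p + snd p"
  "AE p in H. \<bar>snd p\<bar> \<le> 1 + fst p + snd p"
  "AE p in H. \<bar>1\<bar> \<le> (1 + fst p + snd p)\<^sup>2" "AE p in H. \<bar>fst p\<bar> \<le> (1 + fst p + snd p)\<^sup>2"
  "AE p in H. \<bar>snd p\<bar> \<le> (1 + fst p + snd p)\<^sup>2" "AE p in H. \<bar>fst p * snd p\<bar> \<le> (1 + fst p + snd p)\<^sup>2"
  "AE p in H. \<bar>(snd p)\<^sup>2\<bar> \<le> (1 + fst p + snd p)\<^sup>2" "AE p in H. \<bar>(fst p)\<^sup>2\<bar> \<le> (1 + fst p + snd p)\<^sup>2"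
proof -
  have *: "\<bar>1\<bar> \<le> (1 + s + t)\<^sup>2 \<and> \<bar>s\<bar> \<le> (1 + s + t)\<^sup>2 \<and> \<bar>t\<bar> \<le> (1 + s + t)\<^sup>2 \<and> \<bar>s * t\<bar> \<le> (1 + s + t)\<^sup>2
     \<and> \<bar>t\<^sup>2\<bar> \<le> (1 + s + t)\<^sup>2 \<and> \<bar>s\<^sup>2\<bar> \<le> (1 + s + t)\<^sup>2" if "0 \<le> s" "0 \<le> t" for s t :: real
  proof -
    let ?u = "1 + s + t"
    have "1 * 1 \<le> ?u * ?u" "s * 1 \<le> ?u * ?u" "t * 1 \<le> ?u * ?u" "s * t \<le> ?u * ?u"
      "s * s \<le> ?u * ?u" "t * t \<le> ?u * ?u" by (rule mult_mono; use that in simp)+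
    then show ?thesis using that by (simp add: power2_eq_square)
  qed
  show "AE p in H. \<bar>1\<bar> \<le> 1 + fst p + snd p" "AE p in H. \<bar>fst p\<bar> \<le> 1 + fst p + snd p"
    "AE p in H. \<bar>snd p\<bar> \<le> 1 + fst p + snd p"
    using H_quadrant by (eventually_elim, simp)+
  show "AE p in H. \<bar>1\<bar> \<le> (1 + fst p + snd p)\<^sup>2" "AE p in H. \<bar>fst p\<bar> \<le> (1 + fst p + snd p)\<^sup>2"
    "AE p in H. \<bar>snd p\<bar> \<le> (1 + fst p + snd p)\<^sup>2" "AE p in H. \<bar>fst p * snd p\<bar> \<le> (1 + fst p + snd p)\<^sup>2"
    "AE p in H. \<bar>(snd p)\<^sup>2\<bar> \<le> (1 + fst p + snd p)\<^sup>2" "AE p in H. \<bar>(fst p)\<^sup>2\<bar> \<le> (1 + fst p + snd p)\<^sup>2"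
    using H_quadrant by (eventually_elim, use * in fastforce)+
qed

lemma AB_int_eq:
  "A_int H m g 1 = (\<integral>p. fst p / (cmod (qd m g p))\<^sup>2 \<partial>H)"
  "A_int H m g 2 = (\<integral>p. fst p * snd p / (cmod (qd m g p))\<^sup>2 \<partial>H)"
  "B_int H m g 0 = (\<integral>p. 1 / (cmod (qd m g p))\<^sup>2 \<partial>H)"
  "B_int H m g 1 = (\<integral>p. snd p / (cmod (qd m g p))\<^sup>2 \<partial>H)"
  "B_int H m g 2 = (\<integral>p. (snd p)\<^sup>2 / (cmod (qd m g p))\<^sup>2 \<partial>H)"
  by (simp_all add: A_int_def B_int_def A_integrand_def B_integrand_def case_prod_beta)

lemma AB_int_nonneg: "0 \<le> A_int H m g j" "0 \<le> B_int H m g j"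
  unfolding A_int_def B_int_def A_integrand_def B_integrand_def case_prod_beta
  by (rule integral_nonneg_AE, use H_quadrant in eventually_elim, auto)+

lemma AB_integrable:
  assumes nd: "nondegenerate \<epsilon> m g"
  shows "integrable H (\<lambda>p. 1 / (cmod (qd m g p))\<^sup>2)" "integrable H (\<lambda>p. fst p / (cmod (qd m g p))\<^sup>2)"
    "integrable H (\<lambda>p. snd p / (cmod (qd m g p))\<^sup>2)" "integrable H (\<lambda>p. fst p * snd p / (cmod (qd m g p))\<^sup>2)"
    "integrable H (\<lambda>p. (snd p)\<^sup>2 / (cmod (qd m g p))\<^sup>2)"
  by (rule integrable_over_norm_qd[OF nd], measurable, rule monomial_bounds)+

text \<open>The factor \<open>cnj w\<close> is taken to be \<open>1\<close> or \<open>cnj z\<close> below.  It follows from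
\<open>cnj w / q = cnj (w q) / |q|\<^sup>2\<close>, whose imaginary part is linear in \<open>Im w\<close>, \<open>Im (w g)\<close> and \<open>Im (w m)\<close>.\<close>

lemma Im_cnj_integral_over_qd:
  assumes nd: "nondegenerate \<epsilon> m g" and [measurable]: "a \<in> borel_measurable H"
    and a: "AE p in H. 0 \<le> a p \<and> a p \<le> 1 + fst p + snd p"
  shows "Im (cnj w * (\<integral>p. of_real (a p) / qd m g p \<partial>H)) =
    - (Im w * (\<integral>p. a p / (cmod (qd m g p))\<^sup>2 \<partial>H) + Im (w * g) * (\<integral>p. a p * fst p / (cmod (qd m g p))\<^sup>2 \<partial>H)
       + Im (w * m) * (\<integral>p. a p * snd p / (cmod (qd m g p))\<^sup>2 \<partial>H))"
proof -
  have i: "integrable H (\<lambda>p. of_real (a p) / qd m g p)"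
  proof (rule integrable_over_qd(1)[OF nd])
    show "AE p in H. \<bar>a p\<bar> \<le> 1 + fst p + snd p" using a by eventually_elim auto
  qed measurable
  have le: "AE p in H. \<bar>a p\<bar> \<le> (1 + fst p + snd p)\<^sup>2 \<and> \<bar>a p * fst p\<bar> \<le> (1 + fst p + snd p)\<^sup>2
      \<and> \<bar>a p * snd p\<bar> \<le> (1 + fst p + snd p)\<^sup>2"
    using a H_quadrant
  proof eventually_elim
    case (elim p)
    let ?u = "1 + fst p + snd p"
    have "a p * 1 \<le> ?u * ?u" "a p * fst p \<le> ?u * ?u" "a p * snd p \<le> ?u * ?u"
      by (rule mult_mono; use elim in simp)+
    then show ?case using elim by (simp add: power2_eq_square)
  qed
  have i1: "integrable H (\<lambda>p. a p / (cmod (qd m g p))\<^sup>2)"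
    and i2: "integrable H (\<lambda>p. a p * fst p / (cmod (qd m g p))\<^sup>2)"
    and i3: "integrable H (\<lambda>p. a p * snd p / (cmod (qd m g p))\<^sup>2)"
    by (rule integrable_over_norm_qd[OF nd assms(2)]
          integrable_over_norm_qd[OF nd borel_measurable_times[OF assms(2) measurable_coordinates(1)]]
          integrable_over_norm_qd[OF nd borel_measurable_times[OF assms(2) measurable_coordinates(2)]],
        use le in \<open>eventually_elim, simp\<close>)+
  have "Im (cnj w * (\<integral>p. of_real (a p) / qd m g p \<partial>H)) = Im (\<integral>p. cnj w * (of_real (a p) / qd m g p) \<partial>H)"
    by (simp only: Bochner_Integration.integral_mult_right_zero)
  also have "\<dots> = (\<integral>p. Im (cnj w * (of_real (a p) / qd m g p)) \<partial>H)"
    by (rule integral_Im[symmetric]) (rule Bochner_Integration.integrable_mult_right[OF i])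
  also have "\<dots> = (\<integral>p. - (Im w * (a p / (cmod (qd m g p))\<^sup>2) + Im (w * g) * (a p * fst p / (cmod (qd m g p))\<^sup>2)
       + Im (w * m) * (a p * snd p / (cmod (qd m g p))\<^sup>2)) \<partial>H)"
  proof (rule Bochner_Integration.integral_cong[OF refl])
    fix p
    have "cnj w * (of_real (a p) / qd m g p) = of_real (a p / (cmod (qd m g p))\<^sup>2) * cnj (w * qd m g p)"
      by (simp add: complex_div_cnj[of _ "qd m g p"] del: complex_cnj_add)
    also have "Im \<dots> = - (a p / (cmod (qd m g p))\<^sup>2) * Im (w * qd m g p)"
    proof -
      have "Im (of_real r * cnj v) = - r * Im v" for r v by simp
      then show ?thesis .
    qed
    also have "Im (w * qd m g p) = Im w + fst p * Im (w * g) + snd p * Im (w * m)"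
      by (simp add: algebra_simps)
    finally show "Im (cnj w * (of_real (a p) / qd m g p)) = - (Im w * (a p / (cmod (qd m g p))\<^sup>2) + Im (w * g) * (a p * fst p / (cmod (qd m g p))\<^sup>2)
       + Im (w * m) * (a p * snd p / (cmod (qd m g p))\<^sup>2))"
      by (simp add: algebra_simps add_divide_distrib diff_divide_distrib)
  qed
  also have "\<dots> = - (Im w * (\<integral>p. a p / (cmod (qd m g p))\<^sup>2 \<partial>H) + Im (w * g) * (\<integral>p. a p * fst p / (cmod (qd m g p))\<^sup>2 \<partial>H)
       + Im (w * m) * (\<integral>p. a p * snd p / (cmod (qd m g p))\<^sup>2 \<partial>H))"
    by (simp only: Bochner_Integration.integral_minus Bochner_Integration.integral_add Bochner_Integration.integrable_add
        Bochner_Integration.integral_mult_right_zero Bochner_Integration.integrable_mult_right[OF i1]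
        Bochner_Integration.integrable_mult_right[OF i2] Bochner_Integration.integrable_mult_right[OF i3])
  finally show ?thesis .
qed

text \<open>The imaginary parts of the two equations of the system, each taken as it stands and after
multiplication by \<open>cnj z\<close>.  The products with \<open>cnj z\<close> control \<open>Im (z m)\<close> and \<open>Im (z g)\<close>, the other
nonnegative quantities at hand.\<close>

lemma imaginary_parts:
  assumes nd: "nondegenerate \<epsilon> m g" and "g \<noteq> 0"
    and E1: "z * m = - of_real (1 - c) - of_real c * (\<integral>p. 1 / qd m g p \<partial>H)"
    and E2: "- 1 / g = z - of_real c * (\<integral>p. of_real (snd p) / qd m g p \<partial>H)"
  shows "Im (z * m) = c * (A_int H m g 1 * Im g + B_int H m g 1 * Im m)"
    and "(cmod z)\<^sup>2 * Im m = (1 - c + c * B_int H m g 0) * Im z + c * (A_int H m g 1 * Im (z * g) + B_int H m g 1 * Im (z * m))"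
    and "V0 c H m g * Im g = Im z + c * B_int H m g 2 * Im m"
    and "V0 c H m g * Im (z * g) = c * B_int H m g 1 * Im z + c * B_int H m g 2 * Im (z * m)"
proof -
  have le: "AE p in H. 0 \<le> (1::real) \<and> 1 \<le> 1 + fst p + snd p" "AE p in H. 0 \<le> snd p \<and> snd p \<le> 1 + fst p + snd p"
    using H_quadrant by (eventually_elim, simp)+
  have I1: "Im (cnj w * (\<integral>p. 1 / qd m g p \<partial>H)) = - (Im w * B_int H m g 0 + Im (w * g) * A_int H m g 1 + Im (w * m) * B_int H m g 1)" for w
    using Im_cnj_integral_over_qd[OF nd _ le(1), of w] by (simp add: AB_int_eq[unfolded One_nat_def])
  have It: "Im (cnj w * (\<integral>p. of_real (snd p) / qd m g p \<partial>H)) = - (Im w * B_int H m g 1 + Im (w * g) * A_int H m g 2 + Im (w * m) * B_int H m g 2)" for w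
    using Im_cnj_integral_over_qd[OF nd _ le(2), of w]
    by (simp add: AB_int_eq[unfolded One_nat_def] power2_eq_square mult.commute)
  have E1': "Im (cnj w * (z * m)) = (1 - c) * Im w - c * Im (cnj w * (\<integral>p. 1 / qd m g p \<partial>H))" for w
    unfolding E1 by (simp add: algebra_simps)
  have ginv: "Im (cnj w * (- 1 / g)) = Im (w * g) / (cmod g)\<^sup>2" for w
  proof -
    have "cnj w * (- 1 / g) = - cnj (w * g) / of_real ((cmod g)\<^sup>2)"
      by (simp add: complex_div_cnj[of _ g])
    also have "Im \<dots> = Im (w * g) / (cmod g)\<^sup>2" by (simp only: Im_divide_of_real) simp
    finally show ?thesis .
  qed
  have E2': "Im (w * g) / (cmod g)\<^sup>2 = Im (cnj w * z) - c * Im (cnj w * (\<integral>p. of_real (snd p) / qd m g p \<partial>H))" for w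
    unfolding ginv[symmetric] E2 by (simp add: algebra_simps)
  have zz: "cnj z * z = of_real ((cmod z)\<^sup>2)" by (simp add: complex_norm_square mult.commute del: of_real_power)
  show "Im (z * m) = c * (A_int H m g 1 * Im g + B_int H m g 1 * Im m)"
    using E1'[of 1, unfolded I1] by (simp add: algebra_simps)
  have "Im (cnj z * (z * m)) = (cmod z)\<^sup>2 * Im m"
    unfolding mult.assoc[symmetric] zz by simp
  then show "(cmod z)\<^sup>2 * Im m = (1 - c + c * B_int H m g 0) * Im z + c * (A_int H m g 1 * Im (z * g) + B_int H m g 1 * Im (z * m))"
    using E1'[of z, unfolded I1] by (simp only: algebra_simps minus_add_distrib mult_minus_right diff_minus_eq_add)
  show "V0 c H m g * Im g = Im z + c * B_int H m g 2 * Im m"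
    using E2'[of 1, unfolded It] by (simp add: V0_def algebra_simps)
  have "Im (cnj z * z) = 0" unfolding zz by simp
  then show "V0 c H m g * Im (z * g) = c * B_int H m g 1 * Im z + c * B_int H m g 2 * Im (z * m)"
    using E2'[of z, unfolded It] by (simp add: V0_def algebra_simps add_divide_distrib)
qed

text \<open>The three integrands add up to \<open>q / q = 1\<close>.\<close>

lemma curve_identity:
  assumes nd: "nondegenerate \<epsilon> m g"
  shows "(\<integral>p. 1 / qd m g p \<partial>H) + g * (\<integral>p. of_real (fst p) / qd m g p \<partial>H) + m * (\<integral>p. of_real (snd p) / qd m g p \<partial>H) = 1"
proof -
  note i = integrable_over_qd(1)[OF nd _ monomial_bounds(1)] integrable_over_qd(1)[OF nd _ monomial_bounds(2)]
    integrable_over_qd(1)[OF nd _ monomial_bounds(3)]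
  have "(\<integral>p. 1 / qd m g p \<partial>H) + g * (\<integral>p. of_real (fst p) / qd m g p \<partial>H) + m * (\<integral>p. of_real (snd p) / qd m g p \<partial>H)
     = (\<integral>p. 1 / qd m g p + g * (of_real (fst p) / qd m g p) + m * (of_real (snd p) / qd m g p) \<partial>H)"
    using i by (simp only: Bochner_Integration.integral_add Bochner_Integration.integrable_add of_real_1
        Bochner_Integration.integral_mult_right_zero Bochner_Integration.integrable_mult_right measurable_coordinates borel_measurable_const)
  also have "\<dots> = (\<integral>p. 1 \<partial>H)"
  proof (rule integral_cong_AE)
    show "AE p in H. 1 / qd m g p + g * (of_real (fst p) / qd m g p) + m * (of_real (snd p) / qd m g p) = 1"
      using nondegenerate_bounds(2)[OF nd]
    proof eventually_elim
      case (elim p)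
      have "1 / q + g * (s / q) + m * (t / q) = (1 + s * g + t * m) / q" for q s t :: complex
        by (simp add: add_divide_distrib mult.commute)
      then show ?case using elim by simp
    qed
  qed measurable
  finally show ?thesis by (simp add: prob_space)
qed

text \<open>Eliminating \<open>z\<close> from the two equations of the system.\<close>

lemma curve_of_system:
  assumes nd: "nondegenerate \<epsilon> m g" and "g \<noteq> 0"
    and E1: "z * m = - of_real (1 - c) - of_real c * (\<integral>p. 1 / qd m g p \<partial>H)"
    and E2: "- 1 / g = z - of_real c * (\<integral>p. of_real (snd p) / qd m g p \<partial>H)"
  shows "of_real c * g\<^sup>2 * (\<integral>p. of_real (fst p) / qd m g p \<partial>H) + m - g = 0"
proof -
  define I S T where "I = (\<integral>p. 1 / qd m g p \<partial>H)" and "S = (\<integral>p. of_real (fst p) / qd m g p \<partial>H)"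
    and "T = (\<integral>p. of_real (snd p) / qd m g p \<partial>H)"
  have "I + g * S + m * T = 1" using curve_identity[OF nd] by (simp add: I_def S_def T_def)
  then have I: "I = 1 - g * S - m * T" by (simp add: algebra_simps)
  have z: "z = of_real c * T - 1 / g" using E2 by (simp add: T_def algebra_simps)
  have "(z * m) * g = (- of_real (1 - c) - of_real c * I) * g" using E1 by (simp add: I_def)
  moreover have "(z * m) * g = of_real c * T * m * g - m" unfolding z using \<open>g \<noteq> 0\<close> by (simp add: field_simps)
  ultimately have "of_real c * T * m * g - m = (- of_real (1 - c) - of_real c * I) * g" by simp
  then have "g = m + of_real c * g\<^sup>2 * S"
    unfolding I of_real_diff of_real_1 by (simp add: algebra_simps power2_eq_square)
  then have "of_real c * g\<^sup>2 * S + m - g = 0" by (simp add: add.commute)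
  then show ?thesis by (simp add: S_def)
qed

text \<open>Uniform in \<open>m\<close> and \<open>g\<close>, because \<open>|q| \<le> (1 + s + t) (1 + |m| + |g|)\<close>.\<close>

lemma moment_lower_bound:
  assumes nd: "nondegenerate \<epsilon> m g" and [measurable]: "a \<in> borel_measurable H"
    and a: "AE p in H. 0 \<le> a p \<and> a p \<le> (1 + fst p + snd p)\<^sup>2"
  shows "(\<integral>p. a p / (1 + fst p + snd p)\<^sup>2 \<partial>H) / (1 + cmod m + cmod g)\<^sup>2 \<le> (\<integral>p. a p / (cmod (qd m g p))\<^sup>2 \<partial>H)"
proof -
  let ?b = "1 + cmod m + cmod g"
  have "(\<integral>p. a p / (1 + fst p + snd p)\<^sup>2 \<partial>H) / ?b\<^sup>2 = (\<integral>p. a p / (1 + fst p + snd p)\<^sup>2 / ?b\<^sup>2 \<partial>H)"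
    by (rule Bochner_Integration.integral_divide_zero[symmetric])
  also have "\<dots> \<le> (\<integral>p. a p / (cmod (qd m g p))\<^sup>2 \<partial>H)"
  proof (rule integral_mono_AE')
    show "integrable H (\<lambda>p. a p / (cmod (qd m g p))\<^sup>2)"
      by (rule integrable_over_norm_qd[OF nd], measurable, use a in \<open>eventually_elim, simp\<close>)
    show "AE p in H. a p / (1 + fst p + snd p)\<^sup>2 / ?b\<^sup>2 \<le> a p / (cmod (qd m g p))\<^sup>2"
      using a nondegenerate_bounds(2)[OF nd]
    proof eventually_elim
      case (elim p)
      have "cmod (qd m g p) \<le> 1 + fst p * cmod g + snd p * cmod m"
        using norm_triangle_ineq[of "1 + of_real (fst p) * g" "of_real (snd p) * m"]
          norm_triangle_ineq[of 1 "of_real (fst p) * g"] elim by (simp add: norm_mult)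
      also have "\<dots> \<le> (1 + fst p + snd p) * ?b" using elim by (simp add: algebra_simps)
      finally have "(cmod (qd m g p))\<^sup>2 \<le> ((1 + fst p + snd p) * ?b)\<^sup>2" by (intro power_mono) auto
      then have "a p / ((1 + fst p + snd p) * ?b)\<^sup>2 \<le> a p / (cmod (qd m g p))\<^sup>2"
        using elim by (intro divide_left_mono mult_pos_pos) (auto intro!: mult_pos_pos add_pos_nonneg)
      then show ?case by (simp add: power_mult_distrib)
    qed
    show "AE p in H. 0 \<le> a p / (cmod (qd m g p))\<^sup>2" using a by eventually_elim auto
  qed
  finally show ?thesis .
qed

lemma fst_moment_pos:
  assumes "\<not> (AE p in H. fst p = 0)"
  shows "0 < (\<integral>p. fst p / (1 + fst p + snd p)\<^sup>2 \<partial>H)"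
proof -
  have bd: "AE p in H. norm (fst p / (1 + fst p + snd p)\<^sup>2) \<le> 1"
    using monomial_bounds(5) H_quadrant
    by eventually_elim (auto simp: abs_divide divide_le_eq)
  have int: "integrable H (\<lambda>p. fst p / (1 + fst p + snd p)\<^sup>2)"
    by (rule integrable_const_bound[OF bd]) measurable
  have nn: "AE p in H. 0 \<le> fst p / (1 + fst p + snd p)\<^sup>2" using H_quadrant by eventually_elim auto
  show ?thesis
  proof (rule ccontr)
    assume "\<not> ?thesis"
    then have "(\<integral>p. fst p / (1 + fst p + snd p)\<^sup>2 \<partial>H) = 0"
      using integral_nonneg_AE[OF nn] by linarith
    then have "AE p in H. fst p / (1 + fst p + snd p)\<^sup>2 = 0"
      using integral_nonneg_eq_0_iff_AE[OF int nn] by simp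
    then have "AE p in H. fst p = 0" using H_quadrant by eventually_elim auto
    then show False using assms by simp
  qed
qed

end

section \<open>The limiting system in the upper half plane\<close>

text \<open>The part of the model that the analysis depends on: two Stieltjes transforms of probability measures
on the half line that solve the system in the upper half plane.\<close>

locale limit_system = spectral_pair H for H :: "(real \<times> real) measure" +
  fixes c :: real and Fu G :: "real measure"
  assumes c: "0 < c" "c \<le> 1"
    and Fu: "real_distribution Fu" and Fu_nonneg: "AE l in Fu. 0 \<le> l"
    and G: "real_distribution G" and G_nonneg: "AE l in G. 0 \<le> l"
    and t_integrable: "integrable H snd"
    and E1: "\<And>z. Im z > 0 \<Longrightarrow> z * stieltjes Fu z =
      - of_real (1 - c) - of_real c * (\<integral>p. 1 / qd (stieltjes Fu z) (stieltjes G z) p \<partial>H)"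
    and E2: "\<And>z. Im z > 0 \<Longrightarrow> - 1 / stieltjes G z =
      z - of_real c * (\<integral>p. of_real (snd p) / qd (stieltjes Fu z) (stieltjes G z) p \<partial>H)"
begin

abbreviation mS :: "complex \<Rightarrow> complex" where "mS \<equiv> stieltjes Fu"
abbreviation gS :: "complex \<Rightarrow> complex" where "gS \<equiv> stieltjes G"
abbreviation A :: "nat \<Rightarrow> complex \<Rightarrow> real" where "A j z \<equiv> A_int H (mS z) (gS z) j"
abbreviation B :: "nat \<Rightarrow> complex \<Rightarrow> real" where "B j z \<equiv> B_int H (mS z) (gS z) j"

lemma upper_half:
  assumes "Im z > 0"
  shows "0 < Im (mS z)" "0 < Im (gS z)" "mS z \<noteq> 0" "gS z \<noteq> 0" "\<exists>\<epsilon>. nondegenerate \<epsilon> (mS z) (gS z)"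
    "0 < im_ratio Fu z" "0 < im_ratio G z"
proof -
  note F = Im_stieltjes[OF Fu Fu_nonneg assms] and G = Im_stieltjes[OF G G_nonneg assms]
  show *: "0 < Im (mS z)" "0 < Im (gS z)" by (fact F(4) G(4))+
  then show "mS z \<noteq> 0" "gS z \<noteq> 0" by auto
  show "\<exists>\<epsilon>. nondegenerate \<epsilon> (mS z) (gS z)" by (rule nondegenerate_upper_half[OF *])
  have "z \<noteq> 0" using assms by auto
  then have "0 < Im z * im_ratio Fu z" "0 < Im z * im_ratio G z"
    unfolding F(3) G(3) using * F(5) G(5) by (simp_all add: add_nonneg_pos)
  then show "0 < im_ratio Fu z" "0 < im_ratio G z" using assms by (simp_all add: zero_less_mult_iff)
qed

lemma curve_upper_half:
  assumes "Im z > 0"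
  shows "of_real c * (gS z)\<^sup>2 * (\<integral>p. of_real (fst p) / qd (mS z) (gS z) p \<partial>H) + mS z - gS z = 0"
  using curve_of_system[OF _ upper_half(4)[OF assms] E1[OF assms] E2[OF assms]] upper_half(5)[OF assms] by blast

text \<open>Sums of the identities in \<open>imaginary_parts\<close>, with weights \<open>|z|\<close> and \<open>1\<close>.\<close>

lemma ratio_identities:
  assumes z: "Im z > 0"
  shows "cmod z * im_ratio Fu z = 1 - c + c * B 0 z + c * A 1 z * im_ratio G z + c * B 1 z * im_ratio Fu z"
    and "V0 c H (mS z) (gS z) * im_ratio G z = cmod z + c * B 1 z + c * B 2 z * im_ratio Fu z"
proof -
  obtain \<epsilon> where nd: "nondegenerate \<epsilon> (mS z) (gS z)" using upper_half(5)[OF z] by blast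
  note I = imaginary_parts[OF nd upper_half(4)[OF z] E1[OF z] E2[OF z]]
  note PF = Im_stieltjes(3)[OF Fu Fu_nonneg z] and PG = Im_stieltjes(3)[OF G G_nonneg z]
  have "Im z * (cmod z * im_ratio Fu z) = cmod z * (Im z * im_ratio Fu z)" by simp
  also have "\<dots> = cmod z * Im (z * mS z) + (cmod z)\<^sup>2 * Im (mS z)"
    unfolding PF by (simp only: distrib_left power2_eq_square mult.assoc)
  also have "\<dots> = Im z * (1 - c + c * B 0 z) + c * A 1 z * (Im (z * gS z) + cmod z * Im (gS z))
      + c * B 1 z * (Im (z * mS z) + cmod z * Im (mS z))"
    unfolding I(2) by (subst I(1)) (simp only: algebra_simps)
  also have "\<dots> = Im z * (1 - c + c * B 0 z + c * A 1 z * im_ratio G z + c * B 1 z * im_ratio Fu z)"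
    unfolding PF[symmetric] PG[symmetric] by (simp only: algebra_simps)
  finally show "cmod z * im_ratio Fu z = 1 - c + c * B 0 z + c * A 1 z * im_ratio G z + c * B 1 z * im_ratio Fu z"
    using z by simp
  have "Im z * (V0 c H (mS z) (gS z) * im_ratio G z) = V0 c H (mS z) (gS z) * (Im z * im_ratio G z)" by simp
  also have "\<dots> = V0 c H (mS z) (gS z) * Im (z * gS z) + cmod z * (V0 c H (mS z) (gS z) * Im (gS z))"
    unfolding PG by (simp only: algebra_simps)
  also have "\<dots> = Im z * (cmod z + c * B 1 z) + c * B 2 z * (Im (z * mS z) + cmod z * Im (mS z))"
    unfolding I(3,4) by (simp only: algebra_simps)
  also have "\<dots> = Im z * (cmod z + c * B 1 z + c * B 2 z * im_ratio Fu z)"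
    unfolding PF[symmetric] by (simp only: algebra_simps)
  finally show "V0 c H (mS z) (gS z) * im_ratio G z = cmod z + c * B 1 z + c * B 2 z * im_ratio Fu z"
    using z by simp
qed

text \<open>All terms in \<open>ratio_identities\<close> are nonnegative, so each of them is bounded by the whole.  The last
inequality eliminates the ratio of \<open>G\<close> between the two.\<close>

lemma moment_bounds:
  assumes z: "Im z > 0"
  shows "c * B 1 z \<le> cmod z" "c * B 0 z \<le> cmod z * im_ratio Fu z" "c * A 1 z * im_ratio G z \<le> cmod z * im_ratio Fu z"
    "0 < V0 c H (mS z) (gS z)" "V0 c H (mS z) (gS z) \<le> 1 / (cmod (gS z))\<^sup>2"
    "c * B 2 z * im_ratio Fu z \<le> V0 c H (mS z) (gS z) * im_ratio G z"
    "c\<^sup>2 * A 1 z * B 2 z \<le> cmod z * V0 c H (mS z) (gS z)"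
proof -
  note I = ratio_identities[OF z] and pos = upper_half(6,7)[OF z]
  let ?V = "V0 c H (mS z) (gS z)"
  have z0: "0 < cmod z" using z by auto
  have nn: "0 \<le> c * B j z" "0 \<le> c * A j z" for j using AB_int_nonneg c by auto
  have nn': "0 \<le> c * A 1 z * im_ratio G z" "0 \<le> c * B 1 z * im_ratio Fu z" "0 \<le> c * B 2 z * im_ratio Fu z"
    using AB_int_nonneg c pos by simp_all
  show "c * B 0 z \<le> cmod z * im_ratio Fu z" "c * A 1 z * im_ratio G z \<le> cmod z * im_ratio Fu z"
    using I nn' nn(1)[of 0] nn(1)[of 1] c by (auto simp: algebra_simps)
  have "c * B 1 z * im_ratio Fu z \<le> cmod z * im_ratio Fu z"
    using I nn' nn[of 0] c by (auto simp: algebra_simps)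
  then show "c * B 1 z \<le> cmod z" using pos by simp
  have "0 < ?V * im_ratio G z" unfolding I(2) using nn nn' z0 by (simp add: add_pos_nonneg)
  then show V: "0 < ?V" using pos by (simp add: zero_less_mult_iff)
  show "?V \<le> 1 / (cmod (gS z))\<^sup>2" using nn[of 2] by (simp add: V0_def)
  show le: "c * B 2 z * im_ratio Fu z \<le> ?V * im_ratio G z" unfolding I(2) using nn z0 by simp
  have "(c\<^sup>2 * A 1 z * B 2 z) * im_ratio Fu z = c * A 1 z * (c * B 2 z * im_ratio Fu z)"
    by (simp add: power2_eq_square)
  also have "\<dots> \<le> c * A 1 z * (?V * im_ratio G z)" using le nn by (intro mult_left_mono) auto
  also have "\<dots> = ?V * (c * A 1 z * im_ratio G z)" by simp
  also have "\<dots> \<le> ?V * (cmod z * im_ratio Fu z)"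
    using \<open>c * A 1 z * im_ratio G z \<le> cmod z * im_ratio Fu z\<close> V by (intro mult_left_mono) auto
  finally have "(c\<^sup>2 * A 1 z * B 2 z) * im_ratio Fu z \<le> (cmod z * ?V) * im_ratio Fu z" by (simp add: algebra_simps)
  then show "c\<^sup>2 * A 1 z * B 2 z \<le> cmod z * ?V" using pos by simp
qed

text \<open>By the arithmetic-geometric mean inequality \<open>t / |q| \<le> (t + t / |q|\<^sup>2) / 2\<close>, and both terms on the right
have bounded integrals.  So \<open>- 1 / g = z - c \<integral> t / q dH\<close> is bounded.\<close>

lemma inverse_gS_bound:
  assumes z: "Im z > 0"
  shows "1 / cmod (gS z) \<le> 2 * cmod z + (\<integral>p. snd p \<partial>H)"
proof -
  obtain \<epsilon> where nd: "nondegenerate \<epsilon> (mS z) (gS z)" using upper_half(5)[OF z] by blast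
  let ?q = "qd (mS z) (gS z)"
  have i: "integrable H (\<lambda>p. snd p / (cmod (?q p))\<^sup>2)" by (rule AB_integrable[OF nd])
  have "cmod (\<integral>p. of_real (snd p) / ?q p \<partial>H) \<le> (\<integral>p. cmod (of_real (snd p) / ?q p) \<partial>H)"
    by (rule integral_norm_bound)
  also have "\<dots> \<le> (\<integral>p. snd p / 2 + (snd p / (cmod (?q p))\<^sup>2) / 2 \<partial>H)"
  proof (rule integral_mono_AE')
    show "integrable H (\<lambda>p. snd p / 2 + (snd p / (cmod (?q p))\<^sup>2) / 2)"
      using i t_integrable by (intro Bochner_Integration.integrable_add Bochner_Integration.integrable_divide)
    show "AE p in H. cmod (of_real (snd p) / ?q p) \<le> snd p / 2 + (snd p / (cmod (?q p))\<^sup>2) / 2"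
      using H_quadrant
    proof eventually_elim
      case (elim p)
      have "r \<le> (1 + r\<^sup>2) / 2" for r :: real using sum_squares_bound[of r 1] by simp
      from mult_left_mono[OF this[of "1 / cmod (?q p)"], of "snd p"] show ?case
        using elim by (simp add: norm_divide power_divide field_simps)
    qed
    show "AE p in H. 0 \<le> snd p / 2 + (snd p / (cmod (?q p))\<^sup>2) / 2"
      using H_quadrant by eventually_elim auto
  qed
  also have "\<dots> = (\<integral>p. snd p \<partial>H) / 2 + B 1 z / 2"
    using i t_integrable
    by (simp only: AB_int_eq Bochner_Integration.integral_add Bochner_Integration.integrable_divide
        Bochner_Integration.integral_divide_zero)
  finally have "c * cmod (\<integral>p. of_real (snd p) / ?q p \<partial>H) \<le> c * ((\<integral>p. snd p \<partial>H) / 2 + B 1 z / 2)"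
    using c by (intro mult_left_mono) auto
  also have "\<dots> = c * (\<integral>p. snd p \<partial>H) / 2 + c * B 1 z / 2" by (simp add: algebra_simps)
  also have "\<dots> \<le> (\<integral>p. snd p \<partial>H) + cmod z"
  proof (rule add_mono)
    have t: "0 \<le> (\<integral>p. snd p \<partial>H)" by (rule integral_nonneg_AE) (use H_quadrant in eventually_elim, auto)
    then have "c * (\<integral>p. snd p \<partial>H) \<le> 1 * (\<integral>p. snd p \<partial>H)" using c by (intro mult_right_mono) auto
    then show "c * (\<integral>p. snd p \<partial>H) / 2 \<le> (\<integral>p. snd p \<partial>H)" using t by simp
    show "c * B 1 z / 2 \<le> cmod z" using moment_bounds(1)[OF z] norm_ge_zero[of z] by linarith
  qed
  finally have "c * cmod (\<integral>p. of_real (snd p) / ?q p \<partial>H) \<le> (\<integral>p. snd p \<partial>H) + cmod z" .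
  moreover have "1 / cmod (gS z) = cmod (z - of_real c * (\<integral>p. of_real (snd p) / ?q p \<partial>H))"
    unfolding E2[OF z, symmetric] by (simp add: norm_divide)
  moreover have "\<dots> \<le> cmod z + c * cmod (\<integral>p. of_real (snd p) / ?q p \<partial>H)"
    using norm_triangle_ineq4[of z "of_real c * (\<integral>p. of_real (snd p) / ?q p \<partial>H)"] c by (simp add: norm_mult)
  ultimately show ?thesis by linarith
qed

lemma gS_limit_nonzero:
  assumes Z: "\<And>n. Im (Z n) > 0" and Zlim: "Z \<longlonglongrightarrow> z" and g: "(\<lambda>n. gS (Z n)) \<longlonglongrightarrow> g"
  shows "g \<noteq> 0"
proof
  assume "g = 0"
  obtain b where b: "\<And>n. cmod (Z n) \<le> b" using convergent_imp_Bseq[of Z] Zlim by (auto simp: convergent_def Bseq_def)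
  define L where "L = 2 * b + (\<integral>p. snd p \<partial>H)"
  have "1 / cmod (gS (Z n)) \<le> L" for n using inverse_gS_bound[OF Z, of n] b[of n] by (simp add: L_def)
  then have *: "1 \<le> L * cmod (gS (Z n))" for n using upper_half(4)[OF Z, of n] by (simp add: divide_le_eq)
  have "(\<lambda>n. L * cmod (gS (Z n))) \<longlonglongrightarrow> L * cmod g" by (intro tendsto_intros g)
  then have "1 \<le> L * cmod g" using * by (meson LIMSEQ_le_const)
  then show False using \<open>g = 0\<close> by simp
qed

lemma mS_eq_gS_if_no_signal:
  assumes "AE p in H. fst p = 0" and z: "Im z > 0"
  shows "mS z = gS z"
proof -
  have "(\<integral>p. of_real (fst p) / qd (mS z) (gS z) p \<partial>H) = 0"
    by (rule integral_eq_zero_AE) (use assms(1) in eventually_elim, simp)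
  then show ?thesis using curve_upper_half[OF z] by simp
qed

lemma A1_lower_bound:
  assumes z: "Im z > 0"
  shows "(\<integral>p. fst p / (1 + fst p + snd p)\<^sup>2 \<partial>H) \<le> A 1 z * (1 + cmod (mS z) + cmod (gS z))\<^sup>2"
proof -
  obtain \<epsilon> where nd: "nondegenerate \<epsilon> (mS z) (gS z)" using upper_half(5)[OF z] by blast
  have "AE p in H. 0 \<le> fst p \<and> fst p \<le> (1 + fst p + snd p)\<^sup>2"
    using monomial_bounds(5) H_quadrant by eventually_elim auto
  note le = moment_lower_bound[OF nd measurable_coordinates(1) this]
  have "0 < (1 + cmod (mS z) + cmod (gS z))\<^sup>2" by (intro zero_less_power add_pos_nonneg) auto
  then show ?thesis using le unfolding AB_int_eq(1) by (simp only: pos_divide_le_eq)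
qed

text \<open>Suppose \<open>g\<close> tends to infinity.  Then \<open>(1 + t m) / q\<close> tends to \<open>0\<close> where \<open>s > 0\<close> and equals \<open>1\<close> where \<open>s = 0\<close>,
while by the system its integral tends to \<open>- (1 - c) / c \<le> 0\<close>.  Hence \<open>s > 0\<close> almost everywhere, so that
\<open>\<integral> t / q dH\<close> tends to \<open>0\<close> too; but by the system it tends to \<open>x / c\<close>.\<close>

lemma no_pole_of_gS:
  assumes x: "x > 0" and Z: "\<And>n. Im (Z n) > 0" "Z \<longlonglongrightarrow> of_real x"
    and mbd: "\<And>n. cmod (mS (Z n)) \<le> M" and B0: "\<And>n. B 0 (Z n) \<le> K0" and B2: "\<And>n. B 2 (Z n) \<le> K2"
    and ginf: "(\<lambda>n. 1 / gS (Z n)) \<longlonglongrightarrow> 0"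
  shows False
proof -
  let ?q = "\<lambda>n. qd (mS (Z n)) (gS (Z n))"
  have M: "M \<ge> 0" using mbd[of 0] norm_ge_zero order_trans by blast
  have nd: "\<exists>\<epsilon>. nondegenerate \<epsilon> (mS (Z n)) (gS (Z n))" for n using upper_half(5)[OF Z(1)] .
  have qne: "AE p in H. \<forall>n. ?q n p \<noteq> 0"
    unfolding AE_all_countable
  proof
    fix n
    obtain \<epsilon> where "nondegenerate \<epsilon> (mS (Z n)) (gS (Z n))" using nd by blast
    from nondegenerate_bounds(2)[OF this] show "AE p in H. ?q n p \<noteq> 0" by eventually_elim simp
  qed
  \<comment> \<open>Where \<open>s > 0\<close> the denominators grow like \<open>s g\<close>.\<close>
  have qinf: "(\<lambda>n. 1 / ?q n p) \<longlonglongrightarrow> 0" if "fst p > 0" for p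
  proof -
    have mg: "(\<lambda>n. mS (Z n) * (1 / gS (Z n))) \<longlonglongrightarrow> 0"
    proof (rule Lim_null_comparison)
      show "eventually (\<lambda>n. norm (mS (Z n) * (1 / gS (Z n))) \<le> M * norm (1 / gS (Z n))) sequentially"
        by (intro always_eventually allI) (simp only: norm_mult, rule mult_right_mono, rule mbd, rule norm_ge_zero)
      show "(\<lambda>n. M * norm (1 / gS (Z n))) \<longlonglongrightarrow> 0"
        using tendsto_mult[OF tendsto_const[of M] tendsto_norm[OF ginf]] by simp
    qed
    have "(\<lambda>n. (1 / gS (Z n)) / (1 / gS (Z n) + of_real (fst p) + of_real (snd p) * (mS (Z n) * (1 / gS (Z n)))))
        \<longlonglongrightarrow> 0 / (0 + of_real (fst p) + of_real (snd p) * 0)"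
      using that by (intro tendsto_intros ginf mg) auto
    moreover have "(1 / gS (Z n)) / (1 / gS (Z n) + of_real (fst p) + of_real (snd p) * (mS (Z n) * (1 / gS (Z n)))) = 1 / ?q n p" for n
    proof -
      have g: "gS (Z n) \<noteq> 0" by (rule upper_half(4)[OF Z(1)])
      have "1 / gS (Z n) + of_real (fst p) + of_real (snd p) * (mS (Z n) * (1 / gS (Z n))) = ?q n p / gS (Z n)"
        using g by (simp add: field_simps)
      then show ?thesis using g by simp
    qed
    ultimately show ?thesis by simp
  qed
  define S0 where "S0 = {p \<in> space H. fst p = 0}"
  have S0[measurable]: "S0 \<in> sets H" unfolding S0_def by measurable
  define I :: "real \<times> real \<Rightarrow> complex" where "I p = of_bool (fst p > 0)" for p
  have [measurable]: "I \<in> borel_measurable H" unfolding I_def by measurable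
  have qmeas[measurable]: "(\<lambda>p. ?q n p) \<in> borel_measurable H" for n by measurable
  have L1: "(\<lambda>n. \<integral>p. I p * ((1 + of_real (snd p) * mS (Z n)) / ?q n p) \<partial>H) \<longlonglongrightarrow> 0"
  proof (rule integral_tendsto_0_if_L2_bounded)
    show "AE p in H. (\<lambda>n. I p * ((1 + of_real (snd p) * mS (Z n)) / ?q n p)) \<longlonglongrightarrow> 0"
      using H_quadrant
    proof eventually_elim
      case (elim p)
      show ?case
      proof (cases "fst p > 0")
        case True
        show ?thesis
        proof (rule Lim_null_comparison)
          show "eventually (\<lambda>n. norm (I p * ((1 + of_real (snd p) * mS (Z n)) / ?q n p)) \<le> (1 + snd p * M) * norm (1 / ?q n p)) sequentially"
          proof (intro always_eventually allI)
            fix n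
            have "cmod (1 + of_real (snd p) * mS (Z n)) \<le> 1 + snd p * cmod (mS (Z n))"
              using norm_triangle_ineq[of 1 "of_real (snd p) * mS (Z n)"] elim by (simp add: norm_mult)
            also have "\<dots> \<le> 1 + snd p * M" using mbd elim by (simp add: mult_left_mono)
            finally show "norm (I p * ((1 + of_real (snd p) * mS (Z n)) / ?q n p)) \<le> (1 + snd p * M) * norm (1 / ?q n p)"
              using True by (simp add: I_def norm_divide divide_right_mono)
          qed
          show "(\<lambda>n. (1 + snd p * M) * norm (1 / ?q n p)) \<longlonglongrightarrow> 0"
            using tendsto_mult[OF tendsto_const tendsto_norm[OF qinf[OF True]]] by simp
        qed
      qed (simp add: I_def)
    qed
    fix n
    obtain \<epsilon> where nd: "nondegenerate \<epsilon> (mS (Z n)) (gS (Z n))" using nd by blast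
    let ?b = "\<lambda>p. 2 * (1 / (cmod (?q n p))\<^sup>2) + 2 * M\<^sup>2 * ((snd p)\<^sup>2 / (cmod (?q n p))\<^sup>2)"
    have ib: "integrable H ?b"
      using AB_integrable(1,5)[OF nd] by (intro Bochner_Integration.integrable_add Bochner_Integration.integrable_mult_right)
    have le: "AE p in H. norm ((cmod (I p * ((1 + of_real (snd p) * mS (Z n)) / ?q n p)))\<^sup>2) \<le> ?b p"
      using H_quadrant
    proof eventually_elim
      case (elim p)
      have "cmod (1 + of_real (snd p) * mS (Z n)) \<le> 1 + snd p * cmod (mS (Z n))"
        using norm_triangle_ineq[of 1 "of_real (snd p) * mS (Z n)"] elim by (simp add: norm_mult)
      also have "\<dots> \<le> 1 + snd p * M" using mbd elim by (simp add: mult_left_mono)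
      finally have "(cmod (1 + of_real (snd p) * mS (Z n)))\<^sup>2 \<le> (1 + snd p * M)\<^sup>2" by (intro power_mono) auto
      also have "\<dots> \<le> 2 + 2 * (M\<^sup>2 * (snd p)\<^sup>2)"
        using sum_squares_bound[of 1 "snd p * M"] by (simp add: power2_sum power_mult_distrib algebra_simps)
      finally have "(cmod (1 + of_real (snd p) * mS (Z n)))\<^sup>2 / (cmod (?q n p))\<^sup>2 \<le> (2 + 2 * (M\<^sup>2 * (snd p)\<^sup>2)) / (cmod (?q n p))\<^sup>2"
        by (rule divide_right_mono) simp
      moreover have "0 \<le> (2 + 2 * (M\<^sup>2 * (snd p)\<^sup>2)) / (cmod (?q n p))\<^sup>2" by simp
      moreover have "(2 + 2 * (M\<^sup>2 * (snd p)\<^sup>2)) / (cmod (?q n p))\<^sup>2 = ?b p"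
        by (simp only: add_divide_distrib) (simp add: mult.assoc)
      moreover have "norm ((cmod (I p * ((1 + of_real (snd p) * mS (Z n)) / ?q n p)))\<^sup>2)
          = (if fst p > 0 then (cmod (1 + of_real (snd p) * mS (Z n)))\<^sup>2 / (cmod (?q n p))\<^sup>2 else 0)"
        by (simp add: I_def norm_divide power_divide)
      ultimately show ?case by (metis (no_types, lifting))
    qed
    show "integrable H (\<lambda>p. (cmod (I p * ((1 + of_real (snd p) * mS (Z n)) / ?q n p)))\<^sup>2)"
    proof (rule Bochner_Integration.integrable_bound[OF ib])
      show "AE p in H. norm ((cmod (I p * ((1 + of_real (snd p) * mS (Z n)) / ?q n p)))\<^sup>2) \<le> norm (?b p)"
        using le by eventually_elim simp
    qed measurable
    have "(\<integral>p. (cmod (I p * ((1 + of_real (snd p) * mS (Z n)) / ?q n p)))\<^sup>2 \<partial>H) \<le> (\<integral>p. ?b p \<partial>H)"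
      by (rule integral_mono_AE'[OF ib]) (use le in \<open>eventually_elim, simp\<close>, simp)
    also have "\<dots> = 2 * B 0 (Z n) + 2 * M\<^sup>2 * B 2 (Z n)"
      using AB_integrable(1,5)[OF nd]
      by (simp only: Bochner_Integration.integral_add Bochner_Integration.integrable_mult_right
          Bochner_Integration.integral_mult_right_zero AB_int_eq)
    also have "\<dots> \<le> 2 * K0 + 2 * M\<^sup>2 * K2"
      using B0 B2 by (intro add_mono mult_left_mono) auto
    finally show "(\<integral>p. (cmod (I p * ((1 + of_real (snd p) * mS (Z n)) / ?q n p)))\<^sup>2 \<partial>H) \<le> 2 * K0 + 2 * M\<^sup>2 * K2" .
  qed measurable
  have L2: "(\<lambda>n. \<integral>p. I p * (of_real (snd p) / ?q n p) \<partial>H) \<longlonglongrightarrow> 0"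
  proof (rule integral_tendsto_0_if_L2_bounded)
    show "AE p in H. (\<lambda>n. I p * (of_real (snd p) / ?q n p)) \<longlonglongrightarrow> 0"
      using H_quadrant
    proof eventually_elim
      case (elim p)
      show ?case
      proof (cases "fst p > 0")
        case True
        then show ?thesis using tendsto_mult[OF tendsto_const[of "of_real (snd p)"] qinf[OF True]] by (simp add: I_def)
      qed (simp add: I_def)
    qed
    fix n
    obtain \<epsilon> where nd: "nondegenerate \<epsilon> (mS (Z n)) (gS (Z n))" using nd by blast
    note ib = AB_integrable(5)[OF nd]
    have le: "(cmod (I p * (of_real (snd p) / ?q n p)))\<^sup>2 \<le> (snd p)\<^sup>2 / (cmod (?q n p))\<^sup>2" for p
      by (simp add: I_def norm_divide power_divide)
    show "integrable H (\<lambda>p. (cmod (I p * (of_real (snd p) / ?q n p)))\<^sup>2)"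
    proof (rule Bochner_Integration.integrable_bound[OF ib])
      show "AE p in H. norm ((cmod (I p * (of_real (snd p) / ?q n p)))\<^sup>2) \<le> norm ((snd p)\<^sup>2 / (cmod (?q n p))\<^sup>2)"
        using le by (intro AE_I2) simp
    qed measurable
    have "(\<integral>p. (cmod (I p * (of_real (snd p) / ?q n p)))\<^sup>2 \<partial>H) \<le> (\<integral>p. (snd p)\<^sup>2 / (cmod (?q n p))\<^sup>2 \<partial>H)"
      by (rule integral_mono'[OF ib le]) simp
    also have "\<dots> \<le> K2" using B2 unfolding AB_int_eq .
    finally show "(\<integral>p. (cmod (I p * (of_real (snd p) / ?q n p)))\<^sup>2 \<partial>H) \<le> K2" .
  qed measurable
  have tq: "(\<integral>p. of_real (snd p) / ?q n p \<partial>H) = (Z n + 1 / gS (Z n)) / of_real c" for n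
    using E2[OF Z(1), of n] c by (simp add: field_simps)
  have oq: "(\<integral>p. 1 / ?q n p \<partial>H) = (- of_real (1 - c) - Z n * mS (Z n)) / of_real c" for n
    using E1[OF Z(1), of n] c by (simp add: field_simps)
  have int: "integrable H (\<lambda>p. 1 / ?q n p)" "integrable H (\<lambda>p. of_real (snd p) / ?q n p)" for n
  proof -
    obtain \<epsilon> where nd: "nondegenerate \<epsilon> (mS (Z n)) (gS (Z n))" using nd by blast
    show "integrable H (\<lambda>p. 1 / ?q n p)" "integrable H (\<lambda>p. of_real (snd p) / ?q n p)"
      using integrable_over_qd(1)[OF nd _ monomial_bounds(1)] integrable_over_qd(1)[OF nd _ monomial_bounds(3)] by auto
  qed
  \<comment> \<open>Where \<open>s = 0\<close> the quotient \<open>(1 + t m) / q\<close> equals \<open>1\<close>; the integral over the whole space is known from the system.\<close>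
  have eq1: "(\<integral>p. I p * ((1 + of_real (snd p) * mS (Z n)) / ?q n p) \<partial>H)
      = (- of_real (1 - c) + mS (Z n) * (1 / gS (Z n))) / of_real c - of_real (prob S0)" for n
  proof -
    have "(\<integral>p. I p * ((1 + of_real (snd p) * mS (Z n)) / ?q n p) \<partial>H)
       = (\<integral>p. 1 / ?q n p + mS (Z n) * (of_real (snd p) / ?q n p) - of_real (indicator S0 p) \<partial>H)"
    proof (rule integral_cong_AE)
      show "AE p in H. I p * ((1 + of_real (snd p) * mS (Z n)) / ?q n p) =
          1 / ?q n p + mS (Z n) * (of_real (snd p) / ?q n p) - of_real (indicator S0 p)"
        using qne H_quadrant AE_space
      proof eventually_elim
        case (elim p)
        show ?case
        proof (cases "fst p > 0")
          case True
          then show ?thesis by (simp add: I_def S0_def add_divide_distrib mult.commute)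
        next
          case False
          then have f: "fst p = 0" using elim by auto
          have "?q n p \<noteq> 0" using elim by blast
          then have "1 + of_real (snd p) * mS (Z n) \<noteq> 0" using f by simp
          then have "1 / (1 + of_real (snd p) * mS (Z n)) + mS (Z n) * (of_real (snd p) / (1 + of_real (snd p) * mS (Z n))) = 1"
            by (simp add: field_simps)
          then show ?thesis using f elim by (simp add: I_def S0_def)
        qed
      qed
    qed measurable
    also have "\<dots> = (\<integral>p. 1 / ?q n p \<partial>H) + mS (Z n) * (\<integral>p. of_real (snd p) / ?q n p \<partial>H) - of_real (prob S0)"
    proof -
      have "integrable H (\<lambda>p. complex_of_real (indicator S0 p))"
        by (intro integrable_of_real integrable_real_indicator) (auto simp: emeasure_eq_measure)
      moreover have "(\<integral>p. complex_of_real (indicator S0 p) \<partial>H) = of_real (prob S0)"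
        unfolding integral_complex_of_real by simp
      ultimately show ?thesis
        using int by (simp only: Bochner_Integration.integral_add Bochner_Integration.integral_diff Bochner_Integration.integrable_add
            Bochner_Integration.integrable_mult_right Bochner_Integration.integral_mult_right_zero)
    qed
    also have "\<dots> = (- of_real (1 - c) + mS (Z n) * (1 / gS (Z n))) / of_real c - of_real (prob S0)"
      unfolding tq oq using c by (simp add: field_simps)
    finally show ?thesis .
  qed
  have "(\<lambda>n. (- of_real (1 - c) + mS (Z n) * (1 / gS (Z n))) / of_real c - of_real (prob S0))
      \<longlonglongrightarrow> (- of_real (1 - c) + 0) / of_real c - of_real (prob S0)"
  proof (intro tendsto_intros)
    show "(\<lambda>n. mS (Z n) * (1 / gS (Z n))) \<longlonglongrightarrow> 0"
    proof (rule Lim_null_comparison)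
      show "eventually (\<lambda>n. norm (mS (Z n) * (1 / gS (Z n))) \<le> M * norm (1 / gS (Z n))) sequentially"
        by (intro always_eventually allI) (simp only: norm_mult, rule mult_right_mono, rule mbd, rule norm_ge_zero)
      show "(\<lambda>n. M * norm (1 / gS (Z n))) \<longlonglongrightarrow> 0"
        using tendsto_mult[OF tendsto_const[of M] tendsto_norm[OF ginf]] by simp
    qed
  qed (use c in auto)
  from LIMSEQ_unique[OF L1[unfolded eq1] this]
  have "of_real (- (1 - c) / c - prob S0) = (0 :: complex)" by simp
  then have "- (1 - c) / c - prob S0 = 0" using of_real_eq_0_iff by blast
  moreover have "- (1 - c) / c \<le> 0" using c by (simp add: divide_nonpos_pos)
  ultimately have "prob S0 = 0" using measure_nonneg[of H S0] by linarith
  then have S0_null: "AE p in H. p \<notin> S0" by (simp add: prob_eq_0)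
  have "(\<integral>p. I p * (of_real (snd p) / ?q n p) \<partial>H) = (Z n + 1 / gS (Z n)) / of_real c" for n
    unfolding tq[symmetric]
  proof (rule integral_cong_AE)
    show "AE p in H. I p * (of_real (snd p) / ?q n p) = of_real (snd p) / ?q n p"
      using S0_null H_quadrant AE_space by eventually_elim (auto simp: I_def S0_def)
  qed measurable
  then have "(\<lambda>n. (Z n + 1 / gS (Z n)) / of_real c) \<longlonglongrightarrow> 0" using L2 by simp
  moreover have "(\<lambda>n. (Z n + 1 / gS (Z n)) / of_real c) \<longlonglongrightarrow> (of_real x + 0) / of_real c"
    using c by (intro tendsto_intros Z ginf) auto
  ultimately have "of_real x / of_real c = (0 :: complex)" using LIMSEQ_unique by fastforce
  then show False using x c by simp
qed

end

section \<open>Outside the support\<close>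

context limit_system
begin

text \<open>Without signal, \<open>g = m\<close>.  Otherwise \<open>A\<^sub>1\<close> is at least a multiple of \<open>(1 + |m| + |g|)\<^sup>-\<^sup>2\<close>, so that an unbounded
ratio would force \<open>g\<close> to infinity.  The moment bounds required by \<open>no_pole_of_gS\<close> hold along such a
sequence: \<open>B\<^sub>2\<close> is bounded since \<open>V\<^sub>0 \<le> 1 / |g|\<^sup>2\<close> compensates the growth of the ratio.\<close>

lemma im_ratio_G_bounded:
  assumes x: "x > 0" and e: "\<epsilon> > 0" and gap: "AE l in Fu. \<epsilon> \<le> \<bar>l - x\<bar>"
  shows "\<exists>r>0. \<exists>K. \<forall>z. Im z > 0 \<longrightarrow> cmod (z - of_real x) < r \<longrightarrow> im_ratio G z \<le> K"
proof (rule ccontr)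
  assume neg: "\<not> ?thesis"
  define r0 where "r0 = min (\<epsilon> / 2) (x / 2)"
  have r0: "r0 > 0" using x e by (simp add: r0_def)
  have "\<exists>z. Im z > 0 \<and> cmod (z - of_real x) < r0 / real (Suc n) \<and> real n < im_ratio G z" for n
  proof -
    have "r0 / real (Suc n) > 0" using r0 by simp
    then show ?thesis using neg by (meson not_le)
  qed
  then obtain Z where Z: "\<And>n. Im (Z n) > 0" "\<And>n. cmod (Z n - of_real x) < r0 / real (Suc n)"
    "\<And>n. real n < im_ratio G (Z n)" by metis
  have Zr: "cmod (Z n - of_real x) < r0" for n
  proof -
    have "r0 / real (Suc n) \<le> r0 / 1" using r0 by (intro divide_left_mono) auto
    then show ?thesis using Z(2)[of n] by simp
  qed
  have Zlim: "Z \<longlonglongrightarrow> of_real x"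
  proof (rule LIM_zero_cancel, rule Lim_null_comparison)
    show "eventually (\<lambda>n. norm (Z n - of_real x) \<le> r0 / real (Suc n)) sequentially"
      using Z(2) by (intro always_eventually allI) (simp add: less_imp_le)
    show "(\<lambda>n. r0 / real (Suc n)) \<longlonglongrightarrow> 0" by real_asymp
  qed
  have Zn: "cmod (Z n) \<le> 2 * x" "Z n \<noteq> 0" "0 < cmod (Z n)" for n
  proof -
    have "cmod (Z n) \<le> cmod (Z n - of_real x) + x"
      using norm_triangle_ineq[of "Z n - of_real x" "of_real x"] x by simp
    then show "cmod (Z n) \<le> 2 * x" using Zr[of n] x by (simp add: r0_def)
    show "Z n \<noteq> 0" using Z(1)[of n] by auto
    then show "0 < cmod (Z n)" by simp
  qed
  have gapZ: "AE l in Fu. \<epsilon> / 2 \<le> cmod (of_real l - Z n)" for n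
    using gap by (rule gap_near) (use Zr[of n] in \<open>simp add: r0_def\<close>)
  define K where "K = 1 / (\<epsilon> / 2) + 2 * (2 * x) / (\<epsilon> / 2)\<^sup>2"
  have PF: "im_ratio Fu (Z n) \<le> K" for n
  proof -
    have "im_ratio Fu (Z n) \<le> 1 / (\<epsilon> / 2) + 2 * cmod (Z n) / (\<epsilon> / 2)\<^sup>2"
      by (rule im_ratio_integrable(4)[OF Fu Fu_nonneg _ gapZ]) (use e in simp)
    also have "\<dots> \<le> K" unfolding K_def using Zn(1)[of n] e by (intro add_mono divide_right_mono mult_left_mono) auto
    finally show ?thesis .
  qed
  have K: "K > 0" using e x by (simp add: K_def add_pos_pos)
  obtain k where k: "k > 0" "\<And>n. k \<le> im_ratio Fu (Z n)"
    using im_ratio_lower_bound[OF Fu Fu_nonneg, of "2 * x"] Zn gapZ e by (meson half_gt_zero)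
  define M where "M = 1 / (\<epsilon> / 2)"
  have M: "M > 0" using e by (simp add: M_def)
  have mbd: "cmod (mS (Z n)) \<le> M" for n
    unfolding M_def by (rule stieltjes_gap_bound[OF Fu _ gapZ]) (use e in simp)
  have zP: "cmod (Z n) * im_ratio Fu (Z n) \<le> 2 * x * K" for n
    using Zn PF[of n] upper_half(6)[OF Z(1), of n] x by (intro mult_mono) auto
  show False
  proof (cases "AE p in H. fst p = 0")
    case True
    have "im_ratio G (Z n) = im_ratio Fu (Z n)" for n
    proof -
      have "Im (Z n) * im_ratio G (Z n) = Im (Z n) * im_ratio Fu (Z n)"
        using Im_stieltjes(3)[OF Fu Fu_nonneg Z(1)] Im_stieltjes(3)[OF G G_nonneg Z(1)]
          mS_eq_gS_if_no_signal[OF True Z(1)] by simp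
      then show ?thesis using Z(1)[of n] by simp
    qed
    then have "real n < K" for n using Z(3)[of n] PF[of n] by simp
    then show False using reals_Archimedean2[of K] by (meson not_less_iff_gr_or_eq)
  next
    case False
    define a1 where "a1 = (\<integral>p. fst p / (1 + fst p + snd p)\<^sup>2 \<partial>H)"
    have a1: "a1 > 0" using fst_moment_pos[OF False] by (simp add: a1_def)
    define C where "C = 2 * x * K / (c * a1)"
    have C: "C > 0" using a1 x K c by (simp add: C_def)
    have PG: "im_ratio G (Z n) \<le> C * (1 + M + cmod (gS (Z n)))\<^sup>2" for n
    proof -
      let ?P = "im_ratio G (Z n)" and ?b = "(1 + cmod (mS (Z n)) + cmod (gS (Z n)))\<^sup>2"
      have P: "?P > 0" by (rule upper_half(7)[OF Z(1)])
      have b: "?b \<le> (1 + M + cmod (gS (Z n)))\<^sup>2" using mbd[of n] by (intro power_mono) auto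
      have "c * a1 * ?P \<le> c * (A 1 (Z n) * ?b) * ?P"
        using A1_lower_bound[OF Z(1), of n] c P unfolding a1_def by (intro mult_right_mono mult_left_mono) auto
      also have "\<dots> = (c * A 1 (Z n) * ?P) * ?b" by simp
      also have "\<dots> \<le> (2 * x * K) * ?b"
        using moment_bounds(3)[OF Z(1), of n] zP[of n] by (intro mult_right_mono) auto
      also have "\<dots> \<le> (2 * x * K) * (1 + M + cmod (gS (Z n)))\<^sup>2"
        using b x K by (intro mult_left_mono) auto
      finally show ?thesis using c a1 by (simp add: C_def field_simps)
    qed
    have ginf: "(\<lambda>n. 1 / gS (Z n)) \<longlonglongrightarrow> 0"
    proof -
      have "filterlim (\<lambda>n. cmod (gS (Z n))) at_top sequentially"
        unfolding filterlim_at_top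
      proof
        fix b :: real
        obtain n0 where n0: "C * (1 + M + \<bar>b\<bar>)\<^sup>2 < real n0" using reals_Archimedean2 by blast
        have "b \<le> cmod (gS (Z n))" if "n \<ge> n0" for n
        proof (rule ccontr)
          assume "\<not> b \<le> cmod (gS (Z n))"
          then have "C * (1 + M + cmod (gS (Z n)))\<^sup>2 \<le> C * (1 + M + \<bar>b\<bar>)\<^sup>2"
            using C M by (intro mult_left_mono power_mono) auto
          then show False using PG[of n] Z(3)[of n] n0 that by linarith
        qed
        then show "eventually (\<lambda>n. b \<le> cmod (gS (Z n))) sequentially"
          by (auto simp: eventually_sequentially)
      qed
      then have "(\<lambda>n. inverse (cmod (gS (Z n)))) \<longlonglongrightarrow> 0" by (rule tendsto_inverse_0_at_top)
      then have "(\<lambda>n. norm (1 / gS (Z n))) \<longlonglongrightarrow> 0" by (simp add: norm_divide inverse_eq_divide)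
      then show ?thesis by (rule tendsto_norm_zero_cancel)
    qed
    have "eventually (\<lambda>n. cmod (1 / gS (Z n)) < 1) sequentially"
      using tendsto_norm[OF ginf] by (intro order_tendstoD) auto
    then obtain n0 where n0: "\<And>n. n \<ge> n0 \<Longrightarrow> cmod (1 / gS (Z n)) < 1" by (auto simp: eventually_sequentially)
    define Y where "Y n = Z (n + n0)" for n
    have g1: "1 \<le> cmod (gS (Y n))" for n
      using n0[of "n + n0"] upper_half(4)[OF Z(1), of "n + n0"] by (simp add: Y_def norm_divide field_simps)
    have Y: "Im (Y n) > 0" for n using Z by (simp add: Y_def)
    have B0: "B 0 (Y n) \<le> 2 * x * K / c" for n
      using moment_bounds(2)[OF Y, of n] zP[of "n + n0"] c by (simp add: Y_def field_simps)
    have B2: "B 2 (Y n) \<le> C * (2 + M)\<^sup>2 / (c * k)" for n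
    proof -
      let ?g = "cmod (gS (Y n))"
      have "c * B 2 (Y n) * k \<le> c * B 2 (Y n) * im_ratio Fu (Y n)"
        using k(2)[of "n + n0"] c AB_int_nonneg by (intro mult_left_mono) (auto simp: Y_def)
      also have "\<dots> \<le> V0 c H (mS (Y n)) (gS (Y n)) * im_ratio G (Y n)" by (rule moment_bounds(6)[OF Y])
      also have "\<dots> \<le> (1 / ?g\<^sup>2) * (C * (1 + M + ?g)\<^sup>2)"
        using moment_bounds(4,5)[OF Y, of n] PG[of "n + n0"] upper_half(7)[OF Y, of n]
        by (intro mult_mono) (auto simp: Y_def)
      also have "\<dots> = C * ((1 + M + ?g) / ?g)\<^sup>2" by (simp add: power_divide)
      also have "\<dots> \<le> C * (2 + M)\<^sup>2"
      proof -
        have "M * 1 \<le> M * ?g" using g1 M by (intro mult_left_mono) auto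
        then have "1 + M + ?g \<le> (2 + M) * ?g" using g1[of n] by (simp add: algebra_simps)
        then have "(1 + M + ?g) / ?g \<le> 2 + M" using g1[of n] by (subst pos_divide_le_eq) auto
        then show ?thesis using C M by (intro mult_left_mono power_mono) auto
      qed
      finally show ?thesis using c k(1) by (simp add: field_simps)
    qed
    show False
    proof (rule no_pole_of_gS[OF x Y _ _ B0 B2])
      show "Y \<longlonglongrightarrow> of_real x" unfolding Y_def using Zlim by (rule LIMSEQ_ignore_initial_segment)
      show "(\<lambda>n. 1 / gS (Y n)) \<longlonglongrightarrow> 0" unfolding Y_def using ginf by (rule LIMSEQ_ignore_initial_segment)
      show "cmod (mS (Y n)) \<le> M" for n unfolding Y_def by (rule mbd)
    qed
  qed
qed

lemma gap_G:
  assumes x: "x > 0" and e: "\<epsilon> > 0" and gap: "AE l in Fu. \<epsilon> \<le> \<bar>l - x\<bar>"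
  shows "\<exists>\<rho>>0. AE l in G. \<rho> \<le> \<bar>l - x\<bar>"
proof -
  obtain r K where r: "r > 0" "\<And>z. Im z > 0 \<Longrightarrow> cmod (z - of_real x) < r \<Longrightarrow> im_ratio G z \<le> K"
    using im_ratio_G_bounded[OF assms] by blast
  define r' where "r' = min r (x / 2)"
  have r': "r' > 0" "r' \<le> r" "r' \<le> x / 2" using r x by (auto simp: r'_def)
  have "AE l in G. r' / 2 \<le> \<bar>l - x\<bar>"
  proof (rule null_if_Im_stieltjes_le[OF G r'(1), where K = "K * (2 / x)"])
    fix z assume z: "Im z > 0" "cmod (z - of_real x) < r'"
    have "x = cmod (of_real x)" using x by simp
    also have "\<dots> \<le> cmod z + cmod (z - of_real x)"
      using norm_triangle_ineq4[of z "z - of_real x"] by simp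
    finally have zx: "x / 2 \<le> cmod z" using z r' by linarith
    have "x / 2 * Im (gS z) \<le> cmod z * Im (gS z)"
      using zx upper_half(2)[OF z(1)] by (intro mult_right_mono) auto
    also have "\<dots> \<le> Im z * im_ratio G z" using Im_stieltjes(3,5)[OF G G_nonneg z(1)] by linarith
    also have "\<dots> \<le> Im z * K" using r(2)[OF z(1)] z r' by (intro mult_left_mono) auto
    finally show "Im (gS z) \<le> K * (2 / x) * Im z" using x by (simp add: field_simps)
  qed
  then show ?thesis using r' by (intro exI[of _ "r' / 2"]) auto
qed

text \<open>The identities \<open>ratio_identities\<close> are carried to the real axis by Fatou's lemma, hence as inequalities: where \<open>q\<close>
is small the integrands are not known to be dominated.\<close>

lemma gap_inequalities:
  assumes x: "x > 0" and e: "\<epsilon> > 0" and gF: "AE l in Fu. \<epsilon> \<le> \<bar>l - x\<bar>" and gG: "AE l in G. \<epsilon> \<le> \<bar>l - x\<bar>"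
  defines "m \<equiv> mS (of_real x)" and "g \<equiv> gS (of_real x)"
  shows "g \<noteq> 0" "AE p in H. qd m g p \<noteq> 0"
    "integrable H (\<lambda>p. 1 / (cmod (qd m g p))\<^sup>2)" "integrable H (\<lambda>p. fst p / (cmod (qd m g p))\<^sup>2)"
    "integrable H (\<lambda>p. snd p / (cmod (qd m g p))\<^sup>2)" "integrable H (\<lambda>p. fst p * snd p / (cmod (qd m g p))\<^sup>2)"
    "integrable H (\<lambda>p. (snd p)\<^sup>2 / (cmod (qd m g p))\<^sup>2)"
    "1 - c + c * B_int H m g 0 + c * A_int H m g 1 * im_ratio G x + c * B_int H m g 1 * im_ratio Fu x \<le> x * im_ratio Fu x"
    "x + c * B_int H m g 1 + c * B_int H m g 2 * im_ratio Fu x \<le> V0 c H m g * im_ratio G x"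
    "0 < im_ratio Fu x" "0 < im_ratio G x"
proof -
  define Z where "Z n = Complex x (1 / real (Suc n))" for n
  have Z: "Im (Z n) > 0" for n by (simp add: Z_def)
  have Zlim: "Z \<longlonglongrightarrow> of_real x"
  proof -
    have "(\<lambda>n. 1 / real (Suc n)) \<longlonglongrightarrow> 0" by real_asymp
    then have "(\<lambda>n. Complex x (1 / real (Suc n))) \<longlonglongrightarrow> Complex x 0" by (intro tendsto_intros)
    then show ?thesis unfolding Z_def by (simp add: complex_of_real_def)
  qed
  have far: "\<bar>l - x\<bar> \<le> cmod (of_real l - Z n)" for l n
    using abs_Re_le_cmod[of "of_real l - Z n"] by (simp add: Z_def)
  have gapF: "AE l in Fu. \<epsilon> \<le> cmod (of_real l - Z n)" for n
    using gF by eventually_elim (use far order_trans in blast)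
  have gapG: "AE l in G. \<epsilon> \<le> cmod (of_real l - Z n)" for n
    using gG by eventually_elim (use far order_trans in blast)
  have gapFx: "AE l in Fu. \<epsilon> \<le> cmod (of_real l - of_real x)"
    using gF by eventually_elim (simp only: of_real_diff[symmetric] norm_of_real)
  have gapGx: "AE l in G. \<epsilon> \<le> cmod (of_real l - of_real x)"
    using gG by eventually_elim (simp only: of_real_diff[symmetric] norm_of_real)
  have PF: "(\<lambda>n. im_ratio Fu (Z n)) \<longlonglongrightarrow> im_ratio Fu x" and PG: "(\<lambda>n. im_ratio G (Z n)) \<longlonglongrightarrow> im_ratio G x"
    by (rule im_ratio_tendsto[OF Fu Fu_nonneg e gapF Zlim] im_ratio_tendsto[OF G G_nonneg e gapG Zlim])+
  have m: "(\<lambda>n. mS (Z n)) \<longlonglongrightarrow> m" unfolding m_def by (rule stieltjes_tendsto_gap[OF Fu e gF Zlim])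
  have g: "(\<lambda>n. gS (Z n)) \<longlonglongrightarrow> g" unfolding g_def by (rule stieltjes_tendsto_gap[OF G e gG Zlim])
  have x0: "complex_of_real x \<noteq> 0" "cmod (of_real x) \<le> x" using x by auto
  show PFpos: "0 < im_ratio Fu x" and PGpos: "0 < im_ratio G x"
    using im_ratio_lower_bound[OF Fu Fu_nonneg, of x] im_ratio_lower_bound[OF G G_nonneg, of x] gapFx gapGx e x0
    by (meson less_le_trans)+
  have zlim: "(\<lambda>n. cmod (Z n)) \<longlonglongrightarrow> x" using tendsto_norm[OF Zlim] x by simp
  show g0: "g \<noteq> 0" by (rule gS_limit_nonzero[OF Z Zlim g])
  let ?q = "\<lambda>n. qd (mS (Z n)) (gS (Z n))"
  have ql: "(\<lambda>n. ?q n p) \<longlonglongrightarrow> qd m g p" for p by (intro tendsto_intros m g)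
  have qne: "AE p in H. \<forall>n. ?q n p \<noteq> 0"
    unfolding AE_all_countable
  proof
    fix n
    obtain \<epsilon> where "nondegenerate \<epsilon> (mS (Z n)) (gS (Z n))" using upper_half(5)[OF Z] by blast
    from nondegenerate_bounds(2)[OF this] show "AE p in H. ?q n p \<noteq> 0" by eventually_elim simp
  qed
  have int: "integrable H (\<lambda>p. 1 / (cmod (?q n p))\<^sup>2)" "integrable H (\<lambda>p. fst p / (cmod (?q n p))\<^sup>2)"
    "integrable H (\<lambda>p. snd p / (cmod (?q n p))\<^sup>2)" "integrable H (\<lambda>p. fst p * snd p / (cmod (?q n p))\<^sup>2)"
    "integrable H (\<lambda>p. (snd p)\<^sup>2 / (cmod (?q n p))\<^sup>2)" for n
    using upper_half(5)[OF Z] AB_integrable by blast+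
  obtain K where K: "\<And>n. cmod (Z n) * im_ratio Fu (Z n) \<le> K"
  proof -
    have "Bseq (\<lambda>n. cmod (Z n) * im_ratio Fu (Z n))"
      using tendsto_mult[OF zlim PF] by (intro convergent_imp_Bseq) (auto simp: convergent_def)
    then obtain K where "\<forall>n. norm (cmod (Z n) * im_ratio Fu (Z n)) \<le> K" unfolding Bseq_def by blast
    then have "cmod (Z n) * im_ratio Fu (Z n) \<le> K" for n using abs_le_D1[of "cmod (Z n) * im_ratio Fu (Z n)" K] by simp
    then show ?thesis using that by blast
  qed
  have qmeas: "(\<lambda>p. ?q n p) \<in> borel_measurable H" "qd m g \<in> borel_measurable H" for n by measurable
  show q0: "AE p in H. qd m g p \<noteq> 0"
  proof (rule AE_limit_nonzero[OF qmeas qne _ int(1), where K = "K / c"])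
    show "(\<integral>p. 1 / (cmod (?q n p))\<^sup>2 \<partial>H) \<le> K / c" for n
      using moment_bounds(2)[OF Z, of n] K[of n] c unfolding AB_int_eq by (simp add: field_simps)
  qed (use ql in auto)
  have lim: "AE p in H. (\<lambda>n. (a n p :: real) / (cmod (?q n p))\<^sup>2) \<longlonglongrightarrow> b p / (cmod (qd m g p))\<^sup>2"
    if "\<And>p. (\<lambda>n. a n p) \<longlonglongrightarrow> b p" for a b
    using q0 by eventually_elim (intro tendsto_intros that ql, simp)
  \<comment> \<open>Fatou's lemma, applied to the two positive combinations of moments in \<open>ratio_identities\<close>.\<close>
  let ?a = "\<lambda>P R p. c * (1 + fst p * P + snd p * R)"
  have 1: "integrable H (\<lambda>p. ?a (im_ratio G x) (im_ratio Fu x) p / (cmod (qd m g p))\<^sup>2)"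
    "(\<integral>p. ?a (im_ratio G x) (im_ratio Fu x) p / (cmod (qd m g p))\<^sup>2 \<partial>H) \<le> x * im_ratio Fu x - (1 - c)"
  proof -
    have f1: "(\<lambda>p. ?a (im_ratio G (Z n)) (im_ratio Fu (Z n)) p / (cmod (?q n p))\<^sup>2) \<in> borel_measurable H" for n by measurable
    have f2: "(\<lambda>p. ?a (im_ratio G x) (im_ratio Fu x) p / (cmod (qd m g p))\<^sup>2) \<in> borel_measurable H" by measurable
    have f3: "AE p in H. 0 \<le> ?a (im_ratio G (Z n)) (im_ratio Fu (Z n)) p / (cmod (?q n p))\<^sup>2" for n
      using H_quadrant by eventually_elim (use c upper_half(6,7)[OF Z, of n] in auto)
    have f4: "AE p in H. (\<lambda>n. ?a (im_ratio G (Z n)) (im_ratio Fu (Z n)) p / (cmod (?q n p))\<^sup>2) \<longlonglongrightarrow>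
        ?a (im_ratio G x) (im_ratio Fu x) p / (cmod (qd m g p))\<^sup>2"
      by (rule lim) (intro tendsto_intros PF PG)
    have eq: "?a P R p / N = c * (1 / N) + (c * P) * (fst p / N) + (c * R) * (snd p / N)" for P R p N
      by (simp add: algebra_simps add_divide_distrib)
    have f5: "integrable H (\<lambda>p. ?a (im_ratio G (Z n)) (im_ratio Fu (Z n)) p / (cmod (?q n p))\<^sup>2)" for n
      unfolding eq using int by (intro Bochner_Integration.integrable_add Bochner_Integration.integrable_mult_right)
    have f6: "(\<integral>p. ?a (im_ratio G (Z n)) (im_ratio Fu (Z n)) p / (cmod (?q n p))\<^sup>2 \<partial>H) \<le> cmod (Z n) * im_ratio Fu (Z n) - (1 - c)" for n
      unfolding eq using int ratio_identities(1)[OF Z, of n] unfolding AB_int_eq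
      by (simp only: Bochner_Integration.integral_add Bochner_Integration.integrable_add Bochner_Integration.integrable_mult_right
          Bochner_Integration.integral_mult_right_zero) (simp add: algebra_simps)
    have f7: "(\<lambda>n. cmod (Z n) * im_ratio Fu (Z n) - (1 - c)) \<longlonglongrightarrow> x * im_ratio Fu x - (1 - c)"
      by (intro tendsto_intros zlim PF)
    note F = integral_Fatou_bound[OF f1 f2 f3 f4 f5 f6 f7]
    show "integrable H (\<lambda>p. ?a (im_ratio G x) (im_ratio Fu x) p / (cmod (qd m g p))\<^sup>2)"
      "(\<integral>p. ?a (im_ratio G x) (im_ratio Fu x) p / (cmod (qd m g p))\<^sup>2 \<partial>H) \<le> x * im_ratio Fu x - (1 - c)"
      by (fact F)+
  qed
  let ?b = "\<lambda>P R p. c * (snd p + (fst p * snd p) * P + (snd p)\<^sup>2 * R)"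
  have 2: "integrable H (\<lambda>p. ?b (im_ratio G x) (im_ratio Fu x) p / (cmod (qd m g p))\<^sup>2)"
    "(\<integral>p. ?b (im_ratio G x) (im_ratio Fu x) p / (cmod (qd m g p))\<^sup>2 \<partial>H) \<le> im_ratio G x / (cmod g)\<^sup>2 - x"
  proof -
    have f1: "(\<lambda>p. ?b (im_ratio G (Z n)) (im_ratio Fu (Z n)) p / (cmod (?q n p))\<^sup>2) \<in> borel_measurable H" for n by measurable
    have f2: "(\<lambda>p. ?b (im_ratio G x) (im_ratio Fu x) p / (cmod (qd m g p))\<^sup>2) \<in> borel_measurable H" by measurable
    have f3: "AE p in H. 0 \<le> ?b (im_ratio G (Z n)) (im_ratio Fu (Z n)) p / (cmod (?q n p))\<^sup>2" for n
      using H_quadrant by eventually_elim (use c upper_half(6,7)[OF Z, of n] in auto)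
    have f4: "AE p in H. (\<lambda>n. ?b (im_ratio G (Z n)) (im_ratio Fu (Z n)) p / (cmod (?q n p))\<^sup>2) \<longlonglongrightarrow>
        ?b (im_ratio G x) (im_ratio Fu x) p / (cmod (qd m g p))\<^sup>2"
      by (rule lim) (intro tendsto_intros PF PG)
    have eq: "?b P R p / N = c * (snd p / N) + (c * P) * (fst p * snd p / N) + (c * R) * ((snd p)\<^sup>2 / N)" for P R p N
      by (simp add: algebra_simps add_divide_distrib)
    have f5: "integrable H (\<lambda>p. ?b (im_ratio G (Z n)) (im_ratio Fu (Z n)) p / (cmod (?q n p))\<^sup>2)" for n
      unfolding eq using int by (intro Bochner_Integration.integrable_add Bochner_Integration.integrable_mult_right)
    have f6: "(\<integral>p. ?b (im_ratio G (Z n)) (im_ratio Fu (Z n)) p / (cmod (?q n p))\<^sup>2 \<partial>H) \<le> im_ratio G (Z n) / (cmod (gS (Z n)))\<^sup>2 - cmod (Z n)" for n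
      unfolding eq using int ratio_identities(2)[OF Z, of n] unfolding AB_int_eq V0_def
      by (simp only: Bochner_Integration.integral_add Bochner_Integration.integrable_add Bochner_Integration.integrable_mult_right
          Bochner_Integration.integral_mult_right_zero) (simp add: algebra_simps)
    have f7: "(\<lambda>n. im_ratio G (Z n) / (cmod (gS (Z n)))\<^sup>2 - cmod (Z n)) \<longlonglongrightarrow> im_ratio G x / (cmod g)\<^sup>2 - x"
      using g0 by (intro tendsto_intros zlim PG g) simp
    note F = integral_Fatou_bound[OF f1 f2 f3 f4 f5 f6 f7]
    show "integrable H (\<lambda>p. ?b (im_ratio G x) (im_ratio Fu x) p / (cmod (qd m g p))\<^sup>2)"
      "(\<integral>p. ?b (im_ratio G x) (im_ratio Fu x) p / (cmod (qd m g p))\<^sup>2 \<partial>H) \<le> im_ratio G x / (cmod g)\<^sup>2 - x"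
      by (fact F)+
  qed
  have dom: "integrable H (\<lambda>p. a p / (cmod (qd m g p))\<^sup>2)"
    if "integrable H (\<lambda>p. b p / (cmod (qd m g p))\<^sup>2)" "a \<in> borel_measurable H" "k > 0"
      "\<And>p. 0 \<le> fst p \<Longrightarrow> 0 < snd p \<Longrightarrow> 0 \<le> k * a p \<and> k * a p \<le> b p" for a b :: "real \<times> real \<Rightarrow> real" and k
  proof -
    have "integrable H (\<lambda>p. k * a p / (cmod (qd m g p))\<^sup>2)"
    proof (rule Bochner_Integration.integrable_bound[OF that(1)])
      show "(\<lambda>p. k * a p / (cmod (qd m g p))\<^sup>2) \<in> borel_measurable H" using that(2) by measurable
      show "AE p in H. norm (k * a p / (cmod (qd m g p))\<^sup>2) \<le> norm (b p / (cmod (qd m g p))\<^sup>2)"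
        using H_quadrant
      proof eventually_elim
        case (elim p)
        then have "0 \<le> k * a p" "k * a p \<le> b p" using that(4) by auto
        then have "\<bar>k * a p\<bar> \<le> \<bar>b p\<bar>" by linarith
        then show ?case by (simp only: real_norm_def abs_divide) (simp add: divide_right_mono)
      qed
    qed
    from Bochner_Integration.integrable_mult_right[OF this, of "1 / k"] show ?thesis using that(3) by simp
  qed
  have P: "0 \<le> im_ratio G x" "0 \<le> im_ratio Fu x" using PFpos PGpos by auto
  show i: "integrable H (\<lambda>p. 1 / (cmod (qd m g p))\<^sup>2)" "integrable H (\<lambda>p. fst p / (cmod (qd m g p))\<^sup>2)"
    "integrable H (\<lambda>p. snd p / (cmod (qd m g p))\<^sup>2)" "integrable H (\<lambda>p. fst p * snd p / (cmod (qd m g p))\<^sup>2)"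
    "integrable H (\<lambda>p. (snd p)\<^sup>2 / (cmod (qd m g p))\<^sup>2)"
  proof -
    show "integrable H (\<lambda>p. 1 / (cmod (qd m g p))\<^sup>2)"
      by (rule dom[OF 1(1), of "\<lambda>_. 1" c]) (use c P in \<open>auto simp: algebra_simps\<close>)
    show "integrable H (\<lambda>p. fst p / (cmod (qd m g p))\<^sup>2)"
      by (rule dom[OF 1(1), of _ "c * im_ratio G x"]) (use c P PGpos in \<open>auto simp: algebra_simps\<close>)
    show "integrable H (\<lambda>p. snd p / (cmod (qd m g p))\<^sup>2)"
      by (rule dom[OF 2(1), of _ c]) (use c P in \<open>auto simp: algebra_simps\<close>)
    show "integrable H (\<lambda>p. fst p * snd p / (cmod (qd m g p))\<^sup>2)"
      by (rule dom[OF 2(1), of _ "c * im_ratio G x"]) (use c P PGpos in \<open>auto simp: algebra_simps\<close>)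
    show "integrable H (\<lambda>p. (snd p)\<^sup>2 / (cmod (qd m g p))\<^sup>2)"
      by (rule dom[OF 2(1), of _ "c * im_ratio Fu x"]) (use c P PFpos in \<open>auto simp: algebra_simps\<close>)
  qed
  show "1 - c + c * B_int H m g 0 + c * A_int H m g 1 * im_ratio G x + c * B_int H m g 1 * im_ratio Fu x \<le> x * im_ratio Fu x"
  proof -
    have eq: "?a P R p / N = c * (1 / N) + (c * P) * (fst p / N) + (c * R) * (snd p / N)" for P R p N
      by (simp add: algebra_simps add_divide_distrib)
    show ?thesis using 1(2) i unfolding eq unfolding AB_int_eq
      by (simp only: Bochner_Integration.integral_add Bochner_Integration.integrable_add Bochner_Integration.integrable_mult_right
          Bochner_Integration.integral_mult_right_zero) (simp add: algebra_simps)
  qed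
  show "x + c * B_int H m g 1 + c * B_int H m g 2 * im_ratio Fu x \<le> V0 c H m g * im_ratio G x"
  proof -
    have eq: "?b P R p / N = c * (snd p / N) + (c * P) * (fst p * snd p / N) + (c * R) * ((snd p)\<^sup>2 / N)" for P R p N
      by (simp add: algebra_simps add_divide_distrib)
    show ?thesis using 2(2) i unfolding eq unfolding AB_int_eq V0_def
      by (simp only: Bochner_Integration.integral_add Bochner_Integration.integrable_add Bochner_Integration.integrable_mult_right
          Bochner_Integration.integral_mult_right_zero) (simp add: algebra_simps)
  qed
qed

text \<open>The strict inequality comes from the positive term \<open>c B\<^sub>0\<close> in \<open>gap_inequalities\<close>.\<close>

lemma V_less_outside_support:
  assumes x: "x > 0" and e: "\<epsilon> > 0" and gF: "AE l in Fu. \<epsilon> \<le> \<bar>l - x\<bar>" and gG: "AE l in G. \<epsilon> \<le> \<bar>l - x\<bar>"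
  shows "V_defined c H (mS (of_real x)) (gS (of_real x))" "V c H (mS (of_real x)) (gS (of_real x)) < x"
    "c * B 0 (of_real x) \<le> x * im_ratio Fu x"
proof -
  define m g where "m = mS (of_real x)" and "g = gS (of_real x)"
  note I = gap_inequalities[OF assms, folded m_def g_def]
  let ?V0 = "V0 c H m g" and ?P = "im_ratio Fu x" and ?R = "im_ratio G x"
  have nn: "0 \<le> c * A_int H m g j" "0 \<le> c * B_int H m g j" for j
    using AB_int_nonneg c by auto
  have "0 < ?V0 * ?R"
    using I(9) x nn(2)[of 1] mult_nonneg_nonneg[OF nn(2)[of 2] less_imp_le[OF I(10)]] by linarith
  then have V0: "?V0 > 0" using I(11) by (simp add: zero_less_mult_iff)
  have "0 < B_int H m g 0"
    unfolding AB_int_eq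
    by (rule expectation_greater[OF I(3)]) (use I(2) in eventually_elim, simp)
  then have B0: "0 < c * B_int H m g 0" using c by simp
  show "c * B 0 (of_real x) \<le> x * ?P"
    using I(8) c mult_nonneg_nonneg[OF nn(1)[of 1] less_imp_le[OF I(11)]]
      mult_nonneg_nonneg[OF nn(2)[of 1] less_imp_le[OF I(10)]]
    unfolding m_def[symmetric] g_def[symmetric] by linarith
  have le: "c * B_int H m g 2 * ?P \<le> ?V0 * ?R" using I(9) x nn(2)[of 1] by linarith
  have "c\<^sup>2 * A_int H m g 1 * B_int H m g 2 / ?V0 * ?P = c * A_int H m g 1 * (c * B_int H m g 2 * ?P) / ?V0"
    by (simp add: power2_eq_square)
  also have "\<dots> \<le> c * A_int H m g 1 * (?V0 * ?R) / ?V0"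
    using le nn V0 by (intro divide_right_mono mult_left_mono) auto
  also have "\<dots> = c * A_int H m g 1 * ?R" using V0 by simp
  finally have "V c H m g * ?P \<le> c * A_int H m g 1 * ?R + c * B_int H m g 1 * ?P"
    by (simp add: V_def algebra_simps)
  also have "\<dots> < x * ?P" using I(8) c B0 by linarith
  finally show "V c H (mS (of_real x)) (gS (of_real x)) < x"
    using I(10) unfolding m_def g_def by simp
  have "AE (s, t) in H. qden m g s t \<noteq> 0" using I(2) by (simp add: case_prod_unfold)
  moreover have "integrable H (A_integrand m g j) \<and> integrable H (B_integrand m g j)" if "j \<in> {1, 2}" for j
    using that I(4-7) by (auto simp: A_integrand_def B_integrand_def case_prod_unfold)
  ultimately show "V_defined c H (mS (of_real x)) (gS (of_real x))"
    using I(1) V0 unfolding V_defined_def m_def[symmetric] g_def[symmetric] by auto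
qed

end

lemma (in spectral_pair) top_support_quadrant:
  assumes "p \<in> top_support H"
  shows "0 \<le> fst p" "0 \<le> snd p"
proof -
  have sp: "space H = UNIV" using sets_eq_imp_space_eq[OF sets_H] by simp
  have "AE p in H. \<not> fst p < 0" "AE p in H. \<not> snd p < 0"
    using H_quadrant by (eventually_elim, simp)+
  then have "emeasure H {p. fst p < 0} = 0" "emeasure H {p. snd p < 0} = 0"
    using emeasure_eq_0_AE[of "\<lambda>p. fst p < 0" H] emeasure_eq_0_AE[of "\<lambda>p. snd p < 0" H] sp by simp_all
  moreover have "open {p :: real \<times> real. fst p < 0}" "open {p :: real \<times> real. snd p < 0}"
    by (intro open_Collect_less continuous_intros)+
  ultimately show "0 \<le> fst p" "0 \<le> snd p"
    using assms unfolding top_support_def by (force simp: not_less[symmetric])+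
qed

text \<open>If \<open>q\<close> vanishes at \<open>p0\<close> for \<open>x = x0\<close>, then for all \<open>p\<close> in a neighbourhood \<open>U\<close> of \<open>p0\<close> it changes sign on
\<open>[a, b]\<close>, as it is increasing in \<open>x\<close> at \<open>p0\<close>.  Let \<open>E y z\<close> be the set of those \<open>p\<close> whose sign change lies in \<open>[y, z]\<close>.  There
\<open>|q|\<close> is of order \<open>z - y\<close> at \<open>y\<close>, and since \<open>\<integral> 1 / q\<^sup>2\<close> is bounded, \<open>E y z\<close> has measure of order
\<open>(z - y)\<^sup>2\<close>.  By subadditivity \<open>U\<close> is null.\<close>

lemma (in limit_system) no_zero_on_support:
  assumes x: "x0 > 0" and e: "\<epsilon> > 0" and gF: "AE l in Fu. \<epsilon> \<le> \<bar>l - x0\<bar>" and gG: "AE l in G. \<epsilon> \<le> \<bar>l - x0\<bar>"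
    and p0: "p0 \<in> top_support H"
  shows "qd (mS (of_real x0)) (gS (of_real x0)) p0 \<noteq> 0"
proof
  assume zero: "qd (mS (of_real x0)) (gS (of_real x0)) p0 = 0"
  define \<gamma> \<mu> where "\<gamma> x = Re (gS (of_real x))" and "\<mu> x = Re (mS (of_real x))" for x :: real
  have re: "gS (of_real x) = of_real (\<gamma> x)" "mS (of_real x) = of_real (\<mu> x)" for x :: real
    by (simp_all add: \<gamma>_def \<mu>_def stieltjes_of_real)
  define q where "q x p = 1 + fst p * \<gamma> x + snd p * \<mu> x" for x and p :: "real \<times> real"
  have qd_eq: "qd (mS (of_real x)) (gS (of_real x)) p = of_real (q x p)" for x p
    by (simp add: q_def re)
  define \<rho> where "\<rho> = min (\<epsilon> / 2) (x0 / 2)"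
  have \<rho>: "\<rho> > 0" "\<rho> \<le> \<epsilon> / 2" "\<rho> \<le> x0 / 2" using x e by (auto simp: \<rho>_def)
  define a b where "a = x0 - \<rho>" and "b = x0 + \<rho>"
  have ab: "a < x0" "x0 < b" using \<rho> by (auto simp: a_def b_def)
  define L where "L = 4 / \<epsilon>\<^sup>2"
  have L: "L > 0" using e by (simp add: L_def)
  have inc: "\<gamma> y < \<gamma> z" "\<mu> y < \<mu> z" "\<gamma> z - \<gamma> y \<le> (z - y) * L" "\<mu> z - \<mu> y \<le> (z - y) * L"
    if "a \<le> y" "y < z" "z \<le> b" for y z
  proof -
    have "\<bar>y - x0\<bar> \<le> \<epsilon> / 2" "\<bar>z - x0\<bar> \<le> \<epsilon> / 2" using that \<rho> unfolding a_def b_def by linarith+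
    from stieltjes_increasing_in_gap[OF Fu e gF this that(2)] stieltjes_increasing_in_gap[OF G e gG this that(2)]
    show "\<gamma> y < \<gamma> z" "\<mu> y < \<mu> z" "\<gamma> z - \<gamma> y \<le> (z - y) * L" "\<mu> z - \<mu> y \<le> (z - y) * L"
      by (simp_all add: \<gamma>_def \<mu>_def L_def)
  qed
  define K where "K = 2 * x0 * (2 / \<epsilon> + 4 * (2 * x0) * 2 / \<epsilon>\<^sup>2) / c"
  have B0: "(\<integral>p. 1 / (q y p)\<^sup>2 \<partial>H) \<le> K" and q_ne: "AE p in H. q y p \<noteq> 0"
    and q_int: "integrable H (\<lambda>p. 1 / (q y p)\<^sup>2)"
    if y: "a \<le> y" "y \<le> b" for y
  proof -
    have y0: "y > 0" "y \<le> 2 * x0" "\<bar>y - x0\<bar> \<le> \<epsilon> / 2" using y \<rho> x unfolding a_def b_def by linarith+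
    have e2: "\<epsilon> / 2 > 0" using e by simp
    have gF': "AE l in Fu. \<epsilon> / 2 \<le> \<bar>l - y\<bar>" using gF by eventually_elim (use y0 in linarith)
    have gG': "AE l in G. \<epsilon> / 2 \<le> \<bar>l - y\<bar>" using gG by eventually_elim (use y0 in linarith)
    have gF'': "AE l in Fu. \<epsilon> / 2 \<le> cmod (of_real l - of_real y)"
      using gF' by eventually_elim (simp only: of_real_diff[symmetric] norm_of_real)
    have "im_ratio Fu y \<le> 1 / (\<epsilon> / 2) + 2 * cmod (of_real y) / (\<epsilon> / 2)\<^sup>2"
      by (rule im_ratio_integrable(4)[OF Fu Fu_nonneg e2 gF''])
    also have "\<dots> = 2 / \<epsilon> + 4 * y * 2 / \<epsilon>\<^sup>2" using y0 by (simp add: power_divide)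
    also have "\<dots> \<le> 2 / \<epsilon> + 4 * (2 * x0) * 2 / \<epsilon>\<^sup>2" using y0 e by (intro add_mono divide_right_mono) auto
    finally have "y * im_ratio Fu y \<le> 2 * x0 * (2 / \<epsilon> + 4 * (2 * x0) * 2 / \<epsilon>\<^sup>2)"
      using y0 gap_inequalities(10)[OF y0(1) e2 gF' gG'] x by (intro mult_mono) auto
    then have "c * B 0 (of_real y) \<le> 2 * x0 * (2 / \<epsilon> + 4 * (2 * x0) * 2 / \<epsilon>\<^sup>2)"
      using V_less_outside_support(3)[OF y0(1) e2 gF' gG'] by linarith
    then have "B 0 (of_real y) \<le> K" using c by (simp add: K_def field_simps)
    then show "(\<integral>p. 1 / (q y p)\<^sup>2 \<partial>H) \<le> K" unfolding AB_int_eq qd_eq by simp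
    show "AE p in H. q y p \<noteq> 0" using gap_inequalities(2)[OF y0(1) e2 gF' gG'] unfolding qd_eq by simp
    show "integrable H (\<lambda>p. 1 / (q y p)\<^sup>2)" using gap_inequalities(3)[OF y0(1) e2 gF' gG'] unfolding qd_eq by simp
  qed
  have pos: "0 \<le> fst p0" "0 \<le> snd p0" by (rule top_support_quadrant[OF p0])+
  have q0: "q x0 p0 = 0" using zero unfolding qd_eq by simp
  have strict: "q y p0 < q z p0" if "a \<le> y" "y < z" "z \<le> b" for y z
  proof -
    have "fst p0 \<noteq> 0 \<or> snd p0 \<noteq> 0" using q0 by (auto simp: q_def)
    then have "fst p0 * \<gamma> y + snd p0 * \<mu> y < fst p0 * \<gamma> z + snd p0 * \<mu> z"
    proof
      assume "fst p0 \<noteq> 0"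
      then show ?thesis using pos inc(1,2)[OF that] by (intro add_less_le_mono mult_strict_left_mono mult_left_mono) auto
    next
      assume "snd p0 \<noteq> 0"
      then show ?thesis using pos inc(1,2)[OF that] by (intro add_le_less_mono mult_strict_left_mono mult_left_mono) auto
    qed
    then show ?thesis by (simp add: q_def)
  qed
  define U where "U = {p. q a p < 0} \<inter> {p. 0 < q b p} \<inter> {p. fst p < fst p0 + 1} \<inter> {p. snd p < snd p0 + 1}"
  have "open U" unfolding U_def q_def by (intro open_Int open_Collect_less continuous_intros)
  moreover have "p0 \<in> U" using strict[of a x0] strict[of x0 b] q0 ab by (auto simp: U_def)
  ultimately have "emeasure H U > 0" using p0 by (auto simp: top_support_def)
  moreover have U_sets: "U \<in> sets H" using \<open>open U\<close> sets_H by auto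
  ultimately have Upos: "prob U > 0" by (simp add: emeasure_eq_measure)
  have q_meas[measurable]: "q y \<in> borel_measurable H" for y unfolding q_def by measurable
  define E where "E y z = {p \<in> space H. p \<in> U \<and> 0 \<le> fst p \<and> 0 \<le> snd p \<and> q y p \<le> 0 \<and> 0 \<le> q z p}" for y z
  have [measurable]: "Measurable.pred H (\<lambda>p. p \<in> U)" using U_sets by simp
  have E_sets[measurable]: "E y z \<in> sets H" for y z unfolding E_def by measurable
  define W where "W = L * (fst p0 + snd p0 + 2)"
  have W: "W > 0" using L pos by (simp add: W_def)
  have "prob (E a b) \<le> 0"
  proof (rule subadditive_quadratic_imp_nonpos[where \<phi> = "\<lambda>y z. prob (E y z)" and K = "K * W\<^sup>2"])
    fix y u z
    have "E y z \<subseteq> E y u \<union> E u z" by (auto simp: E_def)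
    then have "prob (E y z) \<le> prob (E y u \<union> E u z)" by (intro finite_measure_mono) auto
    also have "\<dots> \<le> prob (E y u) + prob (E u z)" by (rule measure_Un_le) auto
    finally show "prob (E y z) \<le> prob (E y u) + prob (E u z)" .
  next
    fix y z assume yz: "a \<le> y" "y < z" "z \<le> b"
    have yb: "y \<le> b" using yz by simp
    let ?d = "W * (z - y)"
    have d: "?d > 0" using W yz by simp
    have "prob (E y z) * (1 / ?d\<^sup>2) = (\<integral>p. indicator (E y z) p * (1 / ?d\<^sup>2) \<partial>H)" by simp
    also have "\<dots> \<le> (\<integral>p. 1 / (q y p)\<^sup>2 \<partial>H)"
    proof (rule integral_mono_AE'[OF q_int[OF yz(1) yb]])
      show "AE p in H. indicator (E y z) p * (1 / ?d\<^sup>2) \<le> 1 / (q y p)\<^sup>2"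
        using q_ne[OF yz(1) yb]
      proof eventually_elim
        case (elim p)
        show ?case
        proof (cases "p \<in> E y z")
          case True
          then have p: "0 \<le> fst p" "0 \<le> snd p" "fst p < fst p0 + 1" "snd p < snd p0 + 1" "q y p \<le> 0" "0 \<le> q z p"
            by (auto simp: E_def U_def)
          have "q z p - q y p = fst p * (\<gamma> z - \<gamma> y) + snd p * (\<mu> z - \<mu> y)" by (simp add: q_def algebra_simps)
          also have "\<dots> \<le> (fst p0 + 1) * ((z - y) * L) + (snd p0 + 1) * ((z - y) * L)"
            using p inc[OF yz] pos by (intro add_mono mult_mono) auto
          also have "\<dots> = ?d" by (simp add: W_def algebra_simps)
          finally have "\<bar>q y p\<bar> \<le> ?d" using p by linarith
          then have "(q y p)\<^sup>2 \<le> ?d\<^sup>2" using d by (metis abs_le_square_iff abs_of_pos)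
          then have "1 / ?d\<^sup>2 \<le> 1 / (q y p)\<^sup>2"
            using elim by (intro frac_le) auto
          then show ?thesis using True by simp
        qed simp
      qed
    qed simp
    also have "\<dots> \<le> K" by (rule B0[OF yz(1) yb])
    finally have "prob (E y z) / ?d\<^sup>2 \<le> K" by (simp only: times_divide_eq_right mult_1_right)
    moreover have "0 < ?d\<^sup>2" using d by (rule zero_less_power)
    ultimately have "prob (E y z) \<le> K * ?d\<^sup>2" by (simp only: pos_divide_le_eq)
    then show "prob (E y z) \<le> K * W\<^sup>2 * (z - y)\<^sup>2" by (simp add: power_mult_distrib mult.assoc)
  qed (use ab in auto)
  moreover have "prob U = prob (E a b)"
  proof (rule finite_measure_eq_AE)
    show "AE p in H. p \<in> U \<longleftrightarrow> p \<in> E a b"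
      using H_quadrant AE_space by eventually_elim (auto simp: E_def U_def)
  qed (use U_sets in auto)
  ultimately show False using Upos by simp
qed

section \<open>The curve equation near a nondegenerate point\<close>

context spectral_pair
begin

lemma qd_perturb:
  assumes "0 \<le> fst p" "0 < snd p" "\<epsilon> * (1 + fst p + snd p) \<le> cmod (qd m0 g0 p)"
    and "cmod (m - m0) \<le> \<epsilon> / 2" "cmod (g - g0) \<le> \<epsilon> / 2"
  shows "\<epsilon> / 2 * (1 + fst p + snd p) \<le> cmod (qd m g p)"
proof -
  have e: "\<epsilon> \<ge> 0" using assms(4) norm_ge_zero[of "m - m0"] by linarith
  have "qd m0 g0 p = qd m g p - (of_real (fst p) * (g - g0) + of_real (snd p) * (m - m0))"
    by (simp add: algebra_simps)
  then have "cmod (qd m0 g0 p) \<le> cmod (qd m g p) + cmod (of_real (fst p) * (g - g0) + of_real (snd p) * (m - m0))"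
    by (metis norm_triangle_ineq4)
  also have "cmod (of_real (fst p) * (g - g0) + of_real (snd p) * (m - m0)) \<le> fst p * cmod (g - g0) + snd p * cmod (m - m0)"
    using norm_triangle_ineq[of "of_real (fst p) * (g - g0)" "of_real (snd p) * (m - m0)"] assms(1,2)
    by (simp add: norm_mult)
  also have "\<dots> \<le> fst p * (\<epsilon> / 2) + snd p * (\<epsilon> / 2)"
    using assms by (intro add_mono mult_left_mono) auto
  finally have "\<epsilon> * (1 + fst p + snd p) \<le> cmod (qd m g p) + (fst p * (\<epsilon> / 2) + snd p * (\<epsilon> / 2))"
    using assms(3) by linarith
  moreover have "\<epsilon> / 2 * (1 + s + t) \<le> N" if "\<epsilon> * (1 + s + t) \<le> N + (s * (\<epsilon> / 2) + t * (\<epsilon> / 2))" for N s t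
    using that e by (simp add: algebra_simps)
  ultimately show ?thesis by blast
qed

lemma nondegenerate_perturb:
  assumes "nondegenerate \<epsilon> m0 g0" "cmod (m - m0) \<le> \<epsilon> / 2" "cmod (g - g0) \<le> \<epsilon> / 2"
  shows "nondegenerate (\<epsilon> / 2) m g"
proof -
  have "AE p in H. \<epsilon> * (1 + fst p + snd p) \<le> cmod (qd m0 g0 p)" using assms(1) by (simp add: nondegenerate_def)
  with H_quadrant have "AE p in H. \<epsilon> / 2 * (1 + fst p + snd p) \<le> cmod (qd m g p)"
    by eventually_elim (use qd_perturb assms(2,3) in blast)
  then show ?thesis using assms(1) by (simp add: nondegenerate_def)
qed

lemma tendsto_integral_over_qd:
  assumes nd: "\<And>n. nondegenerate \<epsilon> (m n) (g n)" "nondegenerate \<epsilon> m0 g0"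
    and m: "m \<longlonglongrightarrow> m0" and g: "g \<longlonglongrightarrow> g0"
    and [measurable]: "a \<in> borel_measurable H" and a: "AE p in H. \<bar>a p\<bar> \<le> 1 + fst p + snd p"
  shows "(\<lambda>n. \<integral>p. of_real (a p) / qd (m n) (g n) p \<partial>H) \<longlonglongrightarrow> (\<integral>p. of_real (a p) / qd m0 g0 p \<partial>H)"
proof (rule integral_dominated_convergence[where w = "\<lambda>_. 1 / \<epsilon>"])
  show "AE p in H. (\<lambda>n. of_real (a p) / qd (m n) (g n) p) \<longlonglongrightarrow> of_real (a p) / qd m0 g0 p"
    using nondegenerate_bounds(2)[OF nd(2)]
  proof eventually_elim
    case (elim p)
    have "qd m0 g0 p \<noteq> 0" using elim by blast
    then show ?case by (intro tendsto_intros m g)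
  qed
  show "AE p in H. norm (of_real (a p) / qd (m n) (g n) p) \<le> 1 / \<epsilon>" for n
    using integrable_over_qd(2)[OF nd(1) assms(5) a] .
qed measurable

lemma tendsto_integral_over_qd_qd:
  assumes nd: "\<And>n. nondegenerate \<epsilon> (m n) (g n)" "\<And>n. nondegenerate \<epsilon> (m' n) (g n)" "nondegenerate \<epsilon> m0 g0"
    and m: "m \<longlonglongrightarrow> m0" "m' \<longlonglongrightarrow> m0" and g: "g \<longlonglongrightarrow> g0"
    and [measurable]: "a \<in> borel_measurable H" and a: "AE p in H. \<bar>a p\<bar> \<le> (1 + fst p + snd p)\<^sup>2"
  shows "(\<lambda>n. \<integral>p. of_real (a p) / (qd (m n) (g n) p * qd (m' n) (g n) p) \<partial>H)
    \<longlonglongrightarrow> (\<integral>p. of_real (a p) / (qd m0 g0 p * qd m0 g0 p) \<partial>H)"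
proof (rule integral_dominated_convergence[where w = "\<lambda>_. 1 / \<epsilon>\<^sup>2"])
  show "AE p in H. (\<lambda>n. of_real (a p) / (qd (m n) (g n) p * qd (m' n) (g n) p)) \<longlonglongrightarrow> of_real (a p) / (qd m0 g0 p * qd m0 g0 p)"
    using nondegenerate_bounds(2)[OF nd(3)]
  proof eventually_elim
    case (elim p)
    have "qd m0 g0 p * qd m0 g0 p \<noteq> 0" using elim by simp
    then show ?case by (intro tendsto_intros m g)
  qed
  show "AE p in H. norm (of_real (a p) / (qd (m n) (g n) p * qd (m' n) (g n) p)) \<le> 1 / \<epsilon>\<^sup>2" for n
    using integrable_over_qd_qd(2)[OF nd(1,2) assms(7) a] .
qed measurable

lemma holomorphic_integral_over_qd:
  assumes nd: "nondegenerate \<epsilon> m0 g0" and S: "open S" "S \<subseteq> cball g0 (\<epsilon> / 2)"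
    and f: "f holomorphic_on S" "f ` S \<subseteq> cball m0 (\<epsilon> / 2)"
    and [measurable]: "a \<in> borel_measurable H" and a: "AE p in H. \<bar>a p\<bar> \<le> 1 + fst p + snd p"
  shows "(\<lambda>g. \<integral>p. of_real (a p) / qd (f g) g p \<partial>H) holomorphic_on S"
proof (rule holomorphic_on_integral[OF finite_measure_axioms S(1), where B = "1 / (\<epsilon> / 2)"])
  have e: "\<epsilon> > 0" using nd by (simp add: nondegenerate_def)
  have "AE p in H. \<epsilon> * (1 + fst p + snd p) \<le> cmod (qd m0 g0 p)" using nd by (simp add: nondegenerate_def)
  with H_quadrant have low: "AE p in H. 0 < 1 + fst p + snd p \<and> (\<forall>g\<in>S. \<epsilon> / 2 * (1 + fst p + snd p) \<le> cmod (qd (f g) g p))"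
  proof eventually_elim
    case (elim p)
    have "\<epsilon> / 2 * (1 + fst p + snd p) \<le> cmod (qd (f g) g p)" if "g \<in> S" for g
      by (rule qd_perturb[of p \<epsilon> g0 m0 "f g" g]) (use elim that S(2) f(2) in \<open>auto simp: dist_norm norm_minus_commute image_subset_iff subset_iff\<close>)
    then show ?case using elim by auto
  qed
  then show "AE p in H. (\<lambda>g. of_real (a p) / qd (f g) g p) holomorphic_on S"
  proof eventually_elim
    case (elim p)
    have "qd (f g) g p \<noteq> 0" if "g \<in> S" for g
    proof -
      have "0 < \<epsilon> / 2 * (1 + fst p + snd p)" using elim e by simp
      also have "\<dots> \<le> cmod (qd (f g) g p)" using elim that by blast
      finally show ?thesis by simp
    qed
    then show ?case using f(1) by (intro holomorphic_intros) auto
  qed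
  show "AE p in H. \<forall>g\<in>S. cmod (of_real (a p) / qd (f g) g p) \<le> 1 / (\<epsilon> / 2)"
    using low a
  proof eventually_elim
    case (elim p)
    show ?case
    proof
      fix g assume g: "g \<in> S"
      have pos: "0 < \<epsilon> / 2 * (1 + fst p + snd p)" using elim e by simp
      have le: "\<epsilon> / 2 * (1 + fst p + snd p) \<le> cmod (qd (f g) g p)" using elim g by blast
      have "\<bar>a p\<bar> / cmod (qd (f g) g p) \<le> (1 + fst p + snd p) / (\<epsilon> / 2 * (1 + fst p + snd p))"
        using elim pos le by (intro frac_le) auto
      also have "\<dots> = 1 / (\<epsilon> / 2)"
      proof -
        have "u / (\<epsilon> / 2 * u) = 1 / (\<epsilon> / 2)" if "0 < u" for u :: real using that e by (simp add: field_simps)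
        then show ?thesis using elim by blast
      qed
      finally show "cmod (of_real (a p) / qd (f g) g p) \<le> 1 / (\<epsilon> / 2)" by (simp add: norm_divide)
    qed
  qed
qed measurable

definition curve :: "real \<Rightarrow> complex \<Rightarrow> complex \<Rightarrow> complex" where
  "curve c g m = of_real c * g\<^sup>2 * (\<integral>p. of_real (fst p) / qd m g p \<partial>H) + m - g"

text \<open>The divided difference of \<open>curve\<close> in its last argument; for \<open>m' = m\<close> it is the partial derivative, and
for real arguments it is \<open>g\<^sup>2 V\<^sub>0\<close>.\<close>

definition slope :: "real \<Rightarrow> complex \<Rightarrow> complex \<Rightarrow> complex \<Rightarrow> complex" where
  "slope c g m m' = 1 - of_real c * g\<^sup>2 * (\<integral>p. of_real (fst p * snd p) / (qd m g p * qd m' g p) \<partial>H)"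

lemma curve_cnj: "curve c (cnj g) (cnj m) = cnj (curve c g m)"
proof -
  have "cnj (\<integral>p. of_real (fst p) / qd m g p \<partial>H) = (\<integral>p. cnj (of_real (fst p) / qd m g p) \<partial>H)"
    by (rule Bochner_Integration.integral_cnj[symmetric])
  also have "\<dots> = (\<integral>p. of_real (fst p) / qd (cnj m) (cnj g) p \<partial>H)" by simp
  finally have "(\<integral>p. of_real (fst p) / qd (cnj m) (cnj g) p \<partial>H) = cnj (\<integral>p. of_real (fst p) / qd m g p \<partial>H)" by (rule sym)
  then show ?thesis by (simp add: curve_def)
qed

lemma curve_diff:
  assumes nd: "nondegenerate \<epsilon> m g" "nondegenerate \<epsilon> m' g"
  shows "curve c g m' - curve c g m = (m' - m) * slope c g m m'"
proof -
  note i = integrable_over_qd(1)[OF nd(1) measurable_coordinates(1) monomial_bounds(2)]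
    integrable_over_qd(1)[OF nd(2) measurable_coordinates(1) monomial_bounds(2)]
  have "(\<integral>p. of_real (fst p) / qd m' g p \<partial>H) - (\<integral>p. of_real (fst p) / qd m g p \<partial>H)
      = (\<integral>p. of_real (fst p) / qd m' g p - of_real (fst p) / qd m g p \<partial>H)"
    using i by (simp only: Bochner_Integration.integral_diff)
  also have "\<dots> = (\<integral>p. (m - m') * (of_real (fst p * snd p) / (qd m g p * qd m' g p)) \<partial>H)"
  proof (rule integral_cong_AE)
    show "AE p in H. of_real (fst p) / qd m' g p - of_real (fst p) / qd m g p = (m - m') * (of_real (fst p * snd p) / (qd m g p * qd m' g p))"
      using nondegenerate_bounds(2)[OF nd(1)] nondegenerate_bounds(2)[OF nd(2)]
    proof eventually_elim
      case (elim p)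
      have "s / q' - s / q = (s * (q - q')) / (q * q')" if "q \<noteq> 0" "q' \<noteq> 0" for s q q' :: complex
        using that by (simp add: field_simps)
      from this[of "qd m g p" "qd m' g p"] elim
      have "of_real (fst p) / qd m' g p - of_real (fst p) / qd m g p = of_real (fst p) * (qd m g p - qd m' g p) / (qd m g p * qd m' g p)"
        by blast
      also have "of_real (fst p) * (qd m g p - qd m' g p) = (m - m') * of_real (fst p * snd p)" by (simp add: algebra_simps)
      finally show ?case by (simp only: times_divide_eq_right)
    qed
  qed measurable
  also have "\<dots> = (m - m') * (\<integral>p. of_real (fst p * snd p) / (qd m g p * qd m' g p) \<partial>H)"
    by (rule Bochner_Integration.integral_mult_right_zero)
  finally have eq: "(\<integral>p. of_real (fst p) / qd m' g p \<partial>H) = (\<integral>p. of_real (fst p) / qd m g p \<partial>H)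
      + (m - m') * (\<integral>p. of_real (fst p * snd p) / (qd m g p * qd m' g p) \<partial>H)"
    by (simp only: diff_eq_eq add.commute)
  have alg: "of_real c * g\<^sup>2 * (S + (m - m') * J) + m' - g - (of_real c * g\<^sup>2 * S + m - g)
      = (m' - m) * (1 - of_real c * g\<^sup>2 * J)" for S J :: complex
    by (simp add: algebra_simps)
  show ?thesis unfolding curve_def eq slope_def by (rule alg)
qed

lemma slope_near:
  assumes nd: "nondegenerate \<epsilon> m0 g0" and "slope c g0 m0 m0 \<noteq> 0" "\<delta> > 0"
  shows "\<exists>\<rho>>0. \<rho> \<le> \<delta> \<and> (\<forall>g\<in>ball g0 \<rho>. \<forall>m\<in>ball m0 \<rho>. \<forall>m'\<in>ball m0 \<rho>.
    cmod (slope c g m m' - slope c g0 m0 m0) \<le> cmod (slope c g0 m0 m0) / 2)"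
proof (rule ccontr)
  assume neg: "\<not> ?thesis"
  define k where "k = cmod (slope c g0 m0 m0) / 2"
  have k: "k > 0" using assms(2) by (simp add: k_def)
  have e: "\<epsilon> > 0" using nd by (simp add: nondegenerate_def)
  define \<rho> where "\<rho> n = min \<delta> (\<epsilon> / 2) / real (Suc n)" for n
  have \<rho>: "\<rho> n > 0" "\<rho> n \<le> min \<delta> (\<epsilon> / 2)" for n
  proof -
    show "\<rho> n > 0" using e assms(3) by (simp add: \<rho>_def)
    have "min \<delta> (\<epsilon> / 2) / real (Suc n) \<le> min \<delta> (\<epsilon> / 2) / 1" using e assms(3) by (intro divide_left_mono) auto
    then show "\<rho> n \<le> min \<delta> (\<epsilon> / 2)" by (simp add: \<rho>_def)
  qed
  have "\<exists>g m m'. g \<in> ball g0 (\<rho> n) \<and> m \<in> ball m0 (\<rho> n) \<and> m' \<in> ball m0 (\<rho> n) \<and> k < cmod (slope c g m m' - slope c g0 m0 m0)" for n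
  proof -
    have "\<rho> n \<le> \<delta>" using \<rho>(2)[of n] by simp
    then show ?thesis using neg \<rho>(1)[of n] unfolding k_def[symmetric] by (meson not_le)
  qed
  then obtain g m m' where gm: "\<And>n. g n \<in> ball g0 (\<rho> n)" "\<And>n. m n \<in> ball m0 (\<rho> n)" "\<And>n. m' n \<in> ball m0 (\<rho> n)"
    and far: "\<And>n. k < cmod (slope c (g n) (m n) (m' n) - slope c g0 m0 m0)" by metis
  have \<rho>0: "\<rho> \<longlonglongrightarrow> 0" unfolding \<rho>_def by real_asymp
  have conv: "u \<longlonglongrightarrow> u0" if "\<And>n. u n \<in> ball u0 (\<rho> n)" for u :: "nat \<Rightarrow> complex" and u0
    by (rule LIM_zero_cancel, rule Lim_null_comparison[OF _ \<rho>0])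
       (use that in \<open>auto simp: dist_norm norm_minus_commute less_imp_le intro!: always_eventually\<close>)
  have nd2: "nondegenerate (\<epsilon> / 2) (u n) (g n)" if "\<And>n. u n \<in> ball m0 (\<rho> n)" for u n
  proof (rule nondegenerate_perturb[OF nd])
    have "dist m0 (u n) < \<rho> n" "dist g0 (g n) < \<rho> n" using that gm(1) by auto
    then show "cmod (u n - m0) \<le> \<epsilon> / 2" "cmod (g n - g0) \<le> \<epsilon> / 2"
      using \<rho>(2)[of n] by (auto simp: dist_norm norm_minus_commute)
  qed
  have nd0: "nondegenerate (\<epsilon> / 2) m0 g0" by (rule nondegenerate_perturb[OF nd]) (use e in auto)
  have meas: "(\<lambda>p. fst p * snd p) \<in> borel_measurable H" by measurable
  have "(\<lambda>n. slope c (g n) (m n) (m' n)) \<longlonglongrightarrow> slope c g0 m0 m0"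
    unfolding slope_def
    by (intro tendsto_intros conv gm tendsto_integral_over_qd_qd[OF nd2[of m] nd2[of m'] nd0] meas monomial_bounds(7))
  then have "(\<lambda>n. cmod (slope c (g n) (m n) (m' n) - slope c g0 m0 m0)) \<longlonglongrightarrow> cmod (slope c g0 m0 m0 - slope c g0 m0 m0)"
    by (intro tendsto_intros)
  then have "k \<le> cmod (slope c g0 m0 m0 - slope c g0 m0 m0)"
    by (rule LIMSEQ_le_const) (use far in \<open>auto intro: less_imp_le\<close>)
  then show False using k by simp
qed

text \<open>The solution is the fixed point of \<open>m \<mapsto> m - curve c g m / k\<close>, where \<open>k\<close> is the derivative at the base
point; this map is a contraction with factor \<open>1 / 2\<close>.  The iterates are holomorphic in \<open>g\<close> and converge
uniformly.\<close>

lemma implicit_curve: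
  assumes nd: "nondegenerate \<epsilon> m0 g0" and on: "curve c g0 m0 = 0" and sl: "slope c g0 m0 m0 \<noteq> 0" and "\<delta> > 0"
  obtains r \<rho> h where "0 < r" "r \<le> \<delta>" "0 < \<rho>" "\<rho> \<le> \<delta>" "h holomorphic_on ball g0 r"
    "\<And>g. g \<in> ball g0 r \<Longrightarrow> h g \<in> ball m0 \<rho>"
    "\<And>g m. g \<in> ball g0 r \<Longrightarrow> m \<in> ball m0 \<rho> \<Longrightarrow> curve c g m = 0 \<longleftrightarrow> m = h g"
proof -
  have e: "\<epsilon> > 0" using nd by (simp add: nondegenerate_def)
  define k where "k = slope c g0 m0 m0"
  have k: "cmod k > 0" using sl by (simp add: k_def)
  obtain \<rho> where \<rho>: "\<rho> > 0" "\<rho> \<le> min \<delta> (\<epsilon> / 2)"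
    and near: "\<And>g m m'. g \<in> ball g0 \<rho> \<Longrightarrow> m \<in> ball m0 \<rho> \<Longrightarrow> m' \<in> ball m0 \<rho> \<Longrightarrow> cmod (slope c g m m' - k) \<le> cmod k / 2"
    using slope_near[OF nd sl, of "min \<delta> (\<epsilon> / 2)"] e \<open>\<delta> > 0\<close> unfolding k_def by auto
  have nd2: "nondegenerate (\<epsilon> / 2) m g" if "g \<in> ball g0 \<rho>" "m \<in> ball m0 \<rho>" for g m
  proof (rule nondegenerate_perturb[OF nd])
    show "cmod (m - m0) \<le> \<epsilon> / 2" "cmod (g - g0) \<le> \<epsilon> / 2"
      using that \<rho>(2) by (auto simp: dist_norm norm_minus_commute)
  qed
  \<comment> \<open>Half the radius, so that the fixed points stay inside the ball on which \<open>slope\<close> is under control.\<close>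
  define R where "R = \<rho> / 2"
  have R: "R > 0" "R < \<rho>" using \<rho> by (auto simp: R_def)
  define T where "T g m = m - curve c g m / k" for g m
  have contract: "cmod (T g m' - T g m) \<le> 1 / 2 * cmod (m' - m)"
    if "g \<in> ball g0 \<rho>" "m \<in> ball m0 \<rho>" "m' \<in> ball m0 \<rho>" for g m m'
  proof -
    have "T g m' - T g m = (m' - m) - (curve c g m' - curve c g m) / k" by (simp add: T_def diff_divide_distrib)
    also have "\<dots> = (m' - m) - (m' - m) * slope c g m m' / k"
      using curve_diff[OF nd2[OF that(1,2)] nd2[OF that(1,3)]] by simp
    also have "\<dots> = - ((m' - m) * ((slope c g m m' - k) / k))" using k by (simp add: field_simps)
    finally have "cmod (T g m' - T g m) = cmod (m' - m) * (cmod (slope c g m m' - k) / cmod k)"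
      by (simp add: norm_mult norm_divide)
    also have "\<dots> \<le> cmod (m' - m) * (1 / 2)"
      using near[OF that] k by (intro mult_left_mono) (auto simp: divide_le_eq)
    finally show ?thesis by simp
  qed
  have "isCont (\<lambda>g. curve c g m0) g0"
  proof -
    have "(\<lambda>g. \<integral>p. of_real (fst p) / qd m0 g p \<partial>H) holomorphic_on ball g0 (\<epsilon> / 2)"
      by (rule holomorphic_integral_over_qd[OF nd, where f = "\<lambda>_. m0"]) (use e monomial_bounds(2) in auto)
    then have "(\<lambda>g. curve c g m0) holomorphic_on ball g0 (\<epsilon> / 2)"
      unfolding curve_def by (intro holomorphic_intros)
    then show ?thesis
      using e by (meson centre_in_ball continuous_on_eq_continuous_at half_gt_zero holomorphic_on_imp_continuous_on open_ball)
  qed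
  then have "\<exists>d>0. \<forall>g. dist g g0 < d \<longrightarrow> dist (curve c g m0) (curve c g0 m0) < cmod k * R / 2"
    using k R unfolding continuous_at_eps_delta by (meson half_gt_zero mult_pos_pos)
  then obtain d where d: "d > 0" "\<And>g. dist g g0 < d \<Longrightarrow> cmod (curve c g m0) < cmod k * R / 2"
    using on by auto
  define r where "r = min d \<rho>"
  have r: "r > 0" "r \<le> d" "r \<le> \<rho>" using d \<rho> by (auto simp: r_def)
  have small: "cmod (curve c g m0) / cmod k < R / 2" if "g \<in> ball g0 r" for g
    using d(2)[of g] that r k by (auto simp: dist_commute field_simps)
  have T0: "cmod (T g m0 - m0) < R / 2" if "g \<in> ball g0 r" for g
    using small[OF that] by (simp add: T_def norm_divide)
  have into: "T g m \<in> cball m0 R" if "g \<in> ball g0 r" "m \<in> cball m0 R" for g m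
  proof -
    have gm: "g \<in> ball g0 \<rho>" "m \<in> ball m0 \<rho>" "m0 \<in> ball m0 \<rho>" using that r R by auto
    have "cmod (T g m - m0) \<le> cmod (T g m - T g m0) + cmod (T g m0 - m0)"
      using norm_triangle_ineq[of "T g m - T g m0" "T g m0 - m0"] by simp
    also have "\<dots> \<le> 1 / 2 * cmod (m - m0) + R / 2"
      using contract[OF gm(1,3,2)] T0[OF that(1)] by linarith
    also have "\<dots> \<le> R" using that(2) by (simp add: dist_norm norm_minus_commute)
    finally show ?thesis by (simp add: dist_norm norm_minus_commute)
  qed
  have "\<exists>m. m \<in> cball m0 R \<and> T g m = m" if g: "g \<in> ball g0 r" for g
  proof -
    have "\<exists>!m. m \<in> cball m0 R \<and> T g m = m"
    proof (rule Banach_fix[OF compact_imp_complete[OF compact_cball], where c = "1 / 2"])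
      show "T g ` cball m0 R \<subseteq> cball m0 R" using into[OF g] by blast
      show "dist (T g x) (T g y) \<le> 1 / 2 * dist x y" if "x \<in> cball m0 R" "y \<in> cball m0 R" for x y
        unfolding dist_norm by (rule contract) (use that g r R in auto)
    qed (use R in auto)
    then show ?thesis by blast
  qed
  then obtain h where h: "\<And>g. g \<in> ball g0 r \<Longrightarrow> h g \<in> cball m0 R" "\<And>g. g \<in> ball g0 r \<Longrightarrow> T g (h g) = h g"
    by metis
  have h_in: "h g \<in> ball m0 \<rho>" if "g \<in> ball g0 r" for g using h(1)[OF that] R by auto
  have h_curve: "curve c g (h g) = 0" if "g \<in> ball g0 r" for g
    using h(2)[OF that] k by (auto simp: T_def)
  have unique: "curve c g m = 0 \<longleftrightarrow> m = h g" if "g \<in> ball g0 r" "m \<in> ball m0 \<rho>" for g m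
  proof
    assume "curve c g m = 0"
    then have "T g m = m" by (simp add: T_def)
    moreover have "g \<in> ball g0 \<rho>" using that(1) r by auto
    ultimately have "cmod (m - h g) \<le> 1 / 2 * cmod (m - h g)"
      using contract[of g "h g" m] h(2)[OF that(1)] h_in[OF that(1)] that(2) by simp
    then show "m = h g" by simp
  qed (use h_curve that in auto)
  define it where "it n g = (T g ^^ n) m0" for n g
  have it_in: "it n g \<in> cball m0 R" if "g \<in> ball g0 r" for n g
    by (induction n) (use R into[OF that] in \<open>auto simp: it_def\<close>)
  have it_close: "cmod (it n g - h g) \<le> R / 2 ^ n" if g: "g \<in> ball g0 r" for n g
  proof (induction n)
    case 0
    show ?case using h(1)[OF g] by (simp add: it_def dist_norm)
  next
    case (Suc n)
    have "cmod (T g (it n g) - T g (h g)) \<le> 1 / 2 * cmod (it n g - h g)"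
      by (rule contract) (use g r R it_in[OF g, of n] h(1)[OF g] in auto)
    then show ?case using Suc h(2)[OF g] by (simp add: it_def)
  qed
  have it_hol: "it n holomorphic_on ball g0 r" for n
  proof (induction n)
    case 0
    show ?case by (simp add: it_def[abs_def])
  next
    case (Suc n)
    have eq: "it (Suc n) = (\<lambda>g. it n g - curve c g (it n g) / k)" by (simp add: it_def T_def fun_eq_iff)
    have "(\<lambda>g. \<integral>p. of_real (fst p) / qd (it n g) g p \<partial>H) holomorphic_on ball g0 r"
    proof (rule holomorphic_integral_over_qd[OF nd _ _ Suc.IH])
      have "cball m0 R \<subseteq> cball m0 (\<epsilon> / 2)" using R \<rho> by (intro subset_cball) auto
      then show "it n ` ball g0 r \<subseteq> cball m0 (\<epsilon> / 2)" using it_in by blast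
      show "ball g0 r \<subseteq> cball g0 (\<epsilon> / 2)" using r \<rho> by auto
    qed (use monomial_bounds(2) in auto)
    then show ?case unfolding eq curve_def using k by (intro holomorphic_intros Suc.IH) auto
  qed
  have lim: "uniform_limit (ball g0 r) it h sequentially"
  proof (rule uniform_limitI)
    fix e :: real assume "e > 0"
    have "(\<lambda>n. R / 2 ^ n) \<longlonglongrightarrow> 0" by real_asymp
    then have "eventually (\<lambda>n. R / 2 ^ n < e) sequentially" using \<open>e > 0\<close> by (rule order_tendstoD)
    then show "eventually (\<lambda>n. \<forall>g\<in>ball g0 r. dist (it n g) (h g) < e) sequentially"
    proof eventually_elim
      case (elim n)
      then show ?case unfolding dist_norm using it_close[of _ n] le_less_trans by blast
    qed
  qed
  have "h holomorphic_on ball g0 r"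
  proof (rule holomorphic_uniform_sequence[OF open_ball it_hol])
    fix x assume "x \<in> ball g0 r"
    then obtain d where "d > 0" "cball x d \<subseteq> ball g0 r" using open_contains_cball open_ball by blast
    then show "\<exists>d>0. cball x d \<subseteq> ball g0 r \<and> uniform_limit (cball x d) it h sequentially"
      using uniform_limit_on_subset[OF lim] by blast
  qed
  then show ?thesis
    by (rule that[of r \<rho> h, rotated 4]) (use r \<rho> h_in unique in auto)
qed

end

section \<open>Points given by the curve\<close>

text \<open>The powers of \<open>y - x\<close> are real, so taking real parts of the coefficients is enough.\<close>

lemma real_analytic_on_Re:
  assumes "f holomorphic_on ball (of_real x0) r"
  shows "real_analytic_on (\<lambda>x. Re (f (of_real x))) {x0 - r<..<x0 + r}"
  unfolding real_analytic_on_def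
proof
  fix x assume x: "x \<in> {x0 - r<..<x0 + r}"
  define d where "d = r - \<bar>x - x0\<bar>"
  have d: "d > 0" using x by (auto simp: d_def)
  have sub: "ball (complex_of_real x) d \<subseteq> ball (of_real x0) r"
  proof
    fix z assume "z \<in> ball (complex_of_real x) d"
    moreover have "dist (complex_of_real x0) (of_real x) = \<bar>x - x0\<bar>"
      by (metis abs_minus_commute dist_norm norm_of_real of_real_diff)
    ultimately show "z \<in> ball (of_real x0) r"
      using dist_triangle[of "of_real x0" z "of_real x"] by (simp add: d_def)
  qed
  then have hol: "f holomorphic_on ball (of_real x) d" using assms holomorphic_on_subset by blast
  define a where "a n = Re ((deriv ^^ n) f (of_real x) / fact n)" for n
  have "(\<lambda>n. a n * (y - x) ^ n) sums Re (f (of_real y))" if "\<bar>y - x\<bar> < d" for y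
  proof -
    have "dist (complex_of_real x) (of_real y) = \<bar>y - x\<bar>"
      by (metis abs_minus_commute dist_norm norm_of_real of_real_diff)
    then have "of_real y \<in> ball (complex_of_real x) d" using that by simp
    from holomorphic_power_series[OF hol this]
    have "(\<lambda>n. Re ((deriv ^^ n) f (of_real x) / fact n * (of_real y - of_real x) ^ n)) sums Re (f (of_real y))"
      by (rule sums_Re)
    moreover have "Re ((deriv ^^ n) f (of_real x) / fact n * (of_real y - of_real x) ^ n) = a n * (y - x) ^ n" for n
    proof -
      have "(of_real y - of_real x) ^ n = complex_of_real ((y - x) ^ n)" by simp
      moreover have "Re (w * of_real t) = Re w * t" for w t by simp
      ultimately show ?thesis unfolding a_def by (simp only:)
    qed
    ultimately show ?thesis by simp
  qed
  then show "\<exists>r>0. \<exists>a. \<forall>y. \<bar>y - x\<bar> < r \<longrightarrow> (\<lambda>n. a n * (y - x) ^ n) sums Re (f (of_real y))"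
    using d by blast
qed

context spectral_pair
begin

text \<open>For \<open>m0, g0 > 0\<close> the denominator is at least \<open>1 + k (s + t)\<close>.  For \<open>m0, g0 < 0\<close> its zeros in the quadrant form
a segment.  So its modulus grows linearly at infinity, and on the remaining compact part of the
support it attains a positive minimum.\<close>

lemma nondegenerate_if_same_sign:
  assumes sign: "0 < m0 * g0" and supp: "\<And>p. p \<in> top_support H \<Longrightarrow> 1 + fst p * g0 + snd p * m0 \<noteq> 0"
  shows "\<exists>\<epsilon>. nondegenerate \<epsilon> (of_real m0) (of_real g0)"
proof -
  have cm: "cmod (qd (of_real m0) (of_real g0) p) = \<bar>1 + fst p * g0 + snd p * m0\<bar>" for p
  proof -
    have "qd (of_real m0) (of_real g0) p = of_real (1 + fst p * g0 + snd p * m0)" by simp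
    then show ?thesis by (simp only: norm_of_real)
  qed
  define k where "k = min \<bar>m0\<bar> \<bar>g0\<bar>"
  have k: "k > 0" using sign by (auto simp: k_def)
  have "\<exists>\<epsilon>>0. \<forall>p\<in>top_support H. 0 \<le> fst p \<longrightarrow> 0 \<le> snd p \<longrightarrow> \<epsilon> * (1 + fst p + snd p) \<le> \<bar>1 + fst p * g0 + snd p * m0\<bar>"
  proof (cases "0 < m0")
    case True
    then have g: "0 < g0" using sign by (simp add: zero_less_mult_iff)
    have "min 1 k * (1 + s + t) \<le> \<bar>1 + s * g0 + t * m0\<bar>" if "0 \<le> s" "0 \<le> t" for s t
    proof -
      have "min 1 k * (1 + s + t) = min 1 k * 1 + s * min 1 k + t * min 1 k" by (simp add: algebra_simps)
      also have "\<dots> \<le> 1 + s * g0 + t * m0"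
        using that True g by (intro add_mono mult_left_mono) (auto simp: k_def)
      finally show ?thesis by linarith
    qed
    then show ?thesis using k by (intro exI[of _ "min 1 k"]) auto
  next
    case False
    then have neg: "m0 < 0" "g0 < 0" using sign by (auto simp: zero_less_mult_iff)
    \<comment> \<open>Outside the box \<open>k (s + t) > 2\<close>, and \<open>q \<le> 1 - k (s + t)\<close> has modulus at least \<open>k (s + t) / 2\<close>.\<close>
    define C where "C = top_support H \<inter> cbox (0, 0) (2 / k, 2 / k)"
    have C: "compact C" unfolding C_def by (intro closed_Int_compact closed_top_support compact_cbox)
    obtain \<delta> where \<delta>: "\<delta> > 0" "\<And>p. p \<in> C \<Longrightarrow> \<delta> \<le> \<bar>1 + fst p * g0 + snd p * m0\<bar>"
    proof (cases "C = {}")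
      case False
      have "continuous_on C (\<lambda>p. \<bar>1 + fst p * g0 + snd p * m0\<bar>)" by (intro continuous_intros)
      from continuous_attains_inf[OF C False this] obtain p where p: "p \<in> C"
        "\<forall>p'\<in>C. \<bar>1 + fst p * g0 + snd p * m0\<bar> \<le> \<bar>1 + fst p' * g0 + snd p' * m0\<bar>" by blast
      show ?thesis by (rule that[of "\<bar>1 + fst p * g0 + snd p * m0\<bar>"]) (use p supp in \<open>auto simp: C_def\<close>)
    qed (use that[of 1] in auto)
    \<comment> \<open>The first constant serves the part \<open>k (s + t) \<ge> 2\<close>, the second one the box with side length \<open>2 / k\<close>.\<close>
    define \<epsilon> where "\<epsilon> = min (k / (k + 2)) (\<delta> / (1 + 4 / k))"
    have e: "\<epsilon> > 0" using k \<delta>(1) by (auto simp: \<epsilon>_def intro!: divide_pos_pos add_pos_pos)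
    have "\<epsilon> * (1 + fst p + snd p) \<le> \<bar>1 + fst p * g0 + snd p * m0\<bar>"
      if p: "p \<in> top_support H" "0 \<le> fst p" "0 \<le> snd p" for p
    proof (cases "2 \<le> k * (fst p + snd p)")
      case True
      have "k * (fst p + snd p) = fst p * k + snd p * k" by (simp add: algebra_simps)
      also have "\<dots> \<le> fst p * (- g0) + snd p * (- m0)"
        using p neg by (intro add_mono mult_left_mono) (auto simp: k_def)
      finally have 1: "k * (fst p + snd p) / 2 \<le> \<bar>1 + fst p * g0 + snd p * m0\<bar>" using True by linarith
      have "\<epsilon> * (1 + fst p + snd p) \<le> k / (k + 2) * (1 + fst p + snd p)"
        using p by (intro mult_right_mono) (auto simp: \<epsilon>_def)
      also have "\<dots> \<le> k / (k + 2) * ((k + 2) * (fst p + snd p) / 2)"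
        using True k by (intro mult_left_mono) (auto simp: algebra_simps)
      also have "\<dots> = k * (fst p + snd p) / 2" using k by simp
      finally show ?thesis using 1 by linarith
    next
      case False
      have "0 \<le> k * fst p" "0 \<le> k * snd p" using p k by simp_all
      then have "k * fst p \<le> 2" "k * snd p \<le> 2" using False unfolding distrib_left by linarith+
      then have le: "fst p \<le> 2 / k" "snd p \<le> 2 / k" using k by (simp_all add: field_simps)
      then have "p \<in> C" using p by (cases p) (auto simp: C_def cbox_Pair_eq)
      have "\<epsilon> * (1 + fst p + snd p) \<le> \<delta> / (1 + 4 / k) * (1 + 4 / k)"
        using le p \<delta>(1) k by (intro mult_mono) (auto simp: \<epsilon>_def)
      also have "\<dots> = \<delta>"
      proof -
        have "1 + 4 / k > 0" using k by (intro add_pos_pos) auto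
        then show ?thesis by simp
      qed
      finally show ?thesis using \<delta>(2)[OF \<open>p \<in> C\<close>] by linarith
    qed
    then show ?thesis using e by blast
  qed
  then obtain \<epsilon> where e: "\<epsilon> > 0" "\<And>p. p \<in> top_support H \<Longrightarrow> 0 \<le> fst p \<Longrightarrow> 0 \<le> snd p \<Longrightarrow>
      \<epsilon> * (1 + fst p + snd p) \<le> \<bar>1 + fst p * g0 + snd p * m0\<bar>" by blast
  have "AE p in H. \<epsilon> * (1 + fst p + snd p) \<le> cmod (qd (of_real m0) (of_real g0) p)"
    using H_quadrant AE_in_top_support[OF sets_H] unfolding cm by eventually_elim (use e(2) in simp)
  then show ?thesis using e(1) by (auto simp: nondegenerate_def)
qed

lemma curve_eq_iff:
  assumes nd: "nondegenerate \<epsilon> (of_real \<mu>) (of_real \<gamma>)"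
  shows "curve_eq c H \<gamma> \<mu> \<longleftrightarrow> curve c (of_real \<gamma>) (of_real \<mu>) = 0"
proof -
  have eq: "complex_of_real (fst p) / qd (of_real \<mu>) (of_real \<gamma>) p = of_real (fst p / (1 + fst p * \<gamma> + snd p * \<mu>))" for p
    by simp
  have i: "integrable H (\<lambda>p. fst p / (1 + fst p * \<gamma> + snd p * \<mu>))"
    using integrable_over_qd(1)[OF nd measurable_coordinates(1) monomial_bounds(2)]
    unfolding eq complex_of_real_integrable_eq .
  have ne: "AE p in H. 1 + fst p * \<gamma> + snd p * \<mu> \<noteq> 0"
    using nondegenerate_bounds(2)[OF nd]
  proof eventually_elim
    case (elim p)
    have "qd (of_real \<mu>) (of_real \<gamma>) p = of_real (1 + fst p * \<gamma> + snd p * \<mu>)" by simp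
    then show ?case using elim by (metis of_real_0)
  qed
  have "curve c (of_real \<gamma>) (of_real \<mu>) = of_real (c * \<gamma>\<^sup>2 * (\<integral>p. fst p / (1 + fst p * \<gamma> + snd p * \<mu>) \<partial>H) + \<mu> - \<gamma>)"
    unfolding curve_def eq integral_complex_of_real by simp
  then have "curve c (of_real \<gamma>) (of_real \<mu>) = 0 \<longleftrightarrow> c * \<gamma>\<^sup>2 * (\<integral>p. fst p / (1 + fst p * \<gamma> + snd p * \<mu>) \<partial>H) + \<mu> - \<gamma> = 0"
    by (simp only: of_real_eq_0_iff)
  then show ?thesis using i ne by (simp add: curve_eq_def case_prod_unfold)
qed

lemma solves_E_if_curve:
  assumes nd: "nondegenerate \<epsilon> m g" and ne: "m \<noteq> 0" "g \<noteq> 0" and on: "curve c g m = 0"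
    and z: "z = - 1 / g + of_real c * (\<integral>p. of_real (snd p) / qd m g p \<partial>H)"
  shows "solves_E c H z m g"
proof -
  define I S T where "I = (\<integral>p. 1 / qd m g p \<partial>H)" and "S = (\<integral>p. of_real (fst p) / qd m g p \<partial>H)"
    and "T = (\<integral>p. of_real (snd p) / qd m g p \<partial>H)"
  have I: "I = 1 - g * S - m * T" using curve_identity[OF nd] by (simp add: I_def S_def T_def algebra_simps)
  have "g * (of_real c * g * S) = g - m" using on by (simp add: curve_def S_def power2_eq_square algebra_simps)
  then have gS: "of_real c * g * S = 1 - m / g" using ne by (simp add: field_simps)
  have zT: "z = - 1 / g + of_real c * T" using z by (simp add: T_def)
  have "z * m = - (m / g) + of_real c * (m * T)" unfolding zT by (simp add: algebra_simps)
  also have "\<dots> = - of_real (1 - c) - of_real c * I"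
    unfolding I using gS by (simp add: algebra_simps)
  finally have "z = (- of_real (1 - c) - of_real c * I) / m" by (simp only: nonzero_eq_divide_eq[OF ne(1)])
  then have "z = - of_real (1 - c) / m - of_real c / m * I" by (simp only: diff_divide_distrib times_divide_eq_left)
  moreover have "AE p in H. qd m g p \<noteq> 0" using nondegenerate_bounds(2)[OF nd] by eventually_elim blast
  moreover have "integrable H (\<lambda>p. 1 / qd m g p)" "integrable H (\<lambda>p. of_real (snd p) / qd m g p)"
    using integrable_over_qd(1)[OF nd _ monomial_bounds(1)] integrable_over_qd(1)[OF nd _ monomial_bounds(3)] by auto
  ultimately show ?thesis using ne z by (simp add: solves_E_def case_prod_unfold I_def)
qed

end

context limit_system
begin

text \<open>If \<open>s\<close> is not almost surely \<open>0\<close>, then \<open>A\<^sub>1\<close> and \<open>B\<^sub>2\<close> are bounded below along bounded sequences, and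
\<open>c\<^sup>2 A\<^sub>1 B\<^sub>2 \<le> |z| V\<^sub>0\<close>.  Otherwise \<open>V\<^sub>0 = 1 / |g|\<^sup>2\<close>.\<close>

lemma V0_bounded_below:
  assumes Z: "\<And>n. Im (Z n) > 0" and lim: "Z \<longlonglongrightarrow> z" "(\<lambda>n. mS (Z n)) \<longlonglongrightarrow> m" "(\<lambda>n. gS (Z n)) \<longlonglongrightarrow> g"
  shows "\<exists>v>0. \<forall>n. v \<le> V0 c H (mS (Z n)) (gS (Z n))"
proof -
  have bd: "\<exists>b. \<forall>n. cmod (u n) \<le> b" if "u \<longlonglongrightarrow> l" for u :: "nat \<Rightarrow> complex" and l
    using convergent_imp_Bseq[of u] that by (auto simp: convergent_def Bseq_def)
  obtain b1 b2 b3 where b': "\<And>n. cmod (Z n) \<le> b1" "\<And>n. cmod (mS (Z n)) \<le> b2" "\<And>n. cmod (gS (Z n)) \<le> b3"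
    using bd[OF lim(1)] bd[OF lim(2)] bd[OF lim(3)] by blast
  define b where "b = max b1 (max b2 b3)"
  have b: "cmod (Z n) \<le> b" "cmod (mS (Z n)) \<le> b" "cmod (gS (Z n)) \<le> b" for n
    using b'[of n] by (auto simp: b_def)
  have "0 < cmod (gS (Z 0))" using upper_half(4)[OF Z] by simp
  then have b0: "b > 0" using b(3)[of 0] by linarith
  show ?thesis
  proof (cases "AE p in H. fst p = 0")
    case True
    have "1 / b\<^sup>2 \<le> V0 c H (mS (Z n)) (gS (Z n))" for n
    proof -
      have "A 2 (Z n) = 0"
        unfolding AB_int_eq by (rule integral_eq_zero_AE) (use True in eventually_elim, simp)
      moreover have "1 / b\<^sup>2 \<le> 1 / (cmod (gS (Z n)))\<^sup>2"
        using b(3)[of n] upper_half(4)[OF Z, of n] by (intro frac_le power_mono) auto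
      ultimately show ?thesis by (simp add: V0_def)
    qed
    then show ?thesis using b0 by (intro exI[of _ "1 / b\<^sup>2"]) auto
  next
    case False
    define a1 where "a1 = (\<integral>p. fst p / (1 + fst p + snd p)\<^sup>2 \<partial>H)"
    define a2 where "a2 = (\<integral>p. (snd p)\<^sup>2 / (1 + fst p + snd p)\<^sup>2 \<partial>H)"
    have a1: "a1 > 0" using fst_moment_pos[OF False] by (simp add: a1_def)
    have a2: "a2 > 0"
    proof -
      have "AE p in H. norm ((snd p)\<^sup>2 / (1 + fst p + snd p)\<^sup>2) \<le> 1"
        using monomial_bounds(8) H_quadrant by eventually_elim (auto simp: divide_le_eq)
      then have "integrable H (\<lambda>p. (snd p)\<^sup>2 / (1 + fst p + snd p)\<^sup>2)"
        by (rule integrable_const_bound) measurable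
      then show ?thesis unfolding a2_def
        by (rule expectation_greater) (use H_quadrant in eventually_elim, auto)
    qed
    define D where "D = (1 + 2 * b)\<^sup>2"
    have D: "D > 0" using b0 by (simp add: D_def)
    have le: "a1 / D \<le> A 1 (Z n)" "a2 / D \<le> B 2 (Z n)" for n
    proof -
      obtain \<epsilon> where nd: "nondegenerate \<epsilon> (mS (Z n)) (gS (Z n))" using upper_half(5)[OF Z] by blast
      have bD: "(1 + cmod (mS (Z n)) + cmod (gS (Z n)))\<^sup>2 \<le> D"
        unfolding D_def using b[of n] by (intro power_mono) auto
      have pos: "0 < (1 + cmod (mS (Z n)) + cmod (gS (Z n)))\<^sup>2" by (intro zero_less_power add_pos_nonneg) auto
      have q: "AE p in H. 0 \<le> fst p \<and> fst p \<le> (1 + fst p + snd p)\<^sup>2" "AE p in H. 0 \<le> (snd p)\<^sup>2 \<and> (snd p)\<^sup>2 \<le> (1 + fst p + snd p)\<^sup>2"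
        using monomial_bounds(5) monomial_bounds(8) H_quadrant by (eventually_elim, auto)+
      have "a1 / D \<le> a1 / (1 + cmod (mS (Z n)) + cmod (gS (Z n)))\<^sup>2"
        using bD pos a1 by (intro divide_left_mono mult_pos_pos D) auto
      also have "\<dots> \<le> A 1 (Z n)"
        using moment_lower_bound[OF nd _ q(1)] unfolding a1_def AB_int_eq by simp
      finally show "a1 / D \<le> A 1 (Z n)" .
      have "a2 / D \<le> a2 / (1 + cmod (mS (Z n)) + cmod (gS (Z n)))\<^sup>2"
        using bD pos a2 by (intro divide_left_mono mult_pos_pos D) auto
      also have "\<dots> \<le> B 2 (Z n)"
        using moment_lower_bound[OF nd _ q(2)] unfolding a2_def AB_int_eq by simp
      finally show "a2 / D \<le> B 2 (Z n)" .
    qed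
    define v where "v = c\<^sup>2 * (a1 / D) * (a2 / D) / b"
    have "v \<le> V0 c H (mS (Z n)) (gS (Z n))" for n
    proof -
      let ?V = "V0 c H (mS (Z n)) (gS (Z n))"
      have "c\<^sup>2 * (a1 / D) * (a2 / D) \<le> c\<^sup>2 * A 1 (Z n) * B 2 (Z n)"
        using le[of n] a1 a2 D AB_int_nonneg by (intro mult_mono mult_nonneg_nonneg) auto
      also have "\<dots> \<le> cmod (Z n) * ?V" by (rule moment_bounds(7)[OF Z])
      also have "\<dots> \<le> b * ?V" using b(1)[of n] moment_bounds(4)[OF Z, of n] by (intro mult_right_mono) auto
      finally show ?thesis unfolding v_def pos_divide_le_eq[OF b0] mult.commute[of _ b] .
    qed
    moreover have "v > 0" using a1 a2 D b0 c by (simp add: v_def)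
    ultimately show ?thesis by blast
  qed
qed

text \<open>By the curve equation \<open>1 - m / g = c g \<integral> s / q dH\<close>.  Split
\<open>|g| s / |q| \<le> (s / t + |g|\<^sup>2 s t / |q|\<^sup>2) / 2\<close>; the first part is controlled by the hypothesis on \<open>s / t\<close>, the second
part is \<open>|g|\<^sup>2 A\<^sub>2\<close> and thus given by \<open>V\<^sub>0\<close>.\<close>

lemma ratio_mS_gS:
  assumes st: "integrable H (\<lambda>p. fst p / snd p)" "(\<integral>p. fst p / snd p \<partial>H) \<le> 1 / c" and z: "Im z > 0"
  shows "cmod (1 - mS z / gS z) \<le> 1 - (cmod (gS z))\<^sup>2 * V0 c H (mS z) (gS z) / 2"
proof -
  obtain \<epsilon> where nd: "nondegenerate \<epsilon> (mS z) (gS z)" using upper_half(5)[OF z] by blast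
  let ?q = "qd (mS z) (gS z)" and ?g = "cmod (gS z)"
  have g: "gS z \<noteq> 0" by (rule upper_half(4)[OF z])
  define S where "S = (\<integral>p. of_real (fst p) / ?q p \<partial>H)"
  have "gS z * (of_real c * gS z * S) = gS z * (1 - mS z / gS z)"
  proof -
    have "of_real c * (gS z)\<^sup>2 * S + mS z - gS z = 0" using curve_upper_half[OF z] by (simp only: S_def)
    then show ?thesis using g by (simp add: power2_eq_square algebra_simps)
  qed
  then have eq: "1 - mS z / gS z = of_real c * gS z * S" using mult_left_cancel[OF g] by metis
  have i2: "integrable H (\<lambda>p. fst p * snd p / (cmod (?q p))\<^sup>2)" by (rule AB_integrable[OF nd])
  have "?g * cmod S \<le> ?g * (\<integral>p. cmod (of_real (fst p) / ?q p) \<partial>H)"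
    unfolding S_def by (intro mult_left_mono integral_norm_bound) simp
  also have "\<dots> = (\<integral>p. ?g * cmod (of_real (fst p) / ?q p) \<partial>H)"
    by (rule Bochner_Integration.integral_mult_right_zero[symmetric])
  also have "\<dots> \<le> (\<integral>p. 1 / 2 * (fst p / snd p) + ?g\<^sup>2 / 2 * (fst p * snd p / (cmod (?q p))\<^sup>2) \<partial>H)"
  proof (rule integral_mono_AE')
    show "integrable H (\<lambda>p. 1 / 2 * (fst p / snd p) + ?g\<^sup>2 / 2 * (fst p * snd p / (cmod (?q p))\<^sup>2))"
      using st(1) i2 by (intro Bochner_Integration.integrable_add Bochner_Integration.integrable_mult_right)
    show "AE p in H. ?g * cmod (of_real (fst p) / ?q p) \<le> 1 / 2 * (fst p / snd p) + ?g\<^sup>2 / 2 * (fst p * snd p / (cmod (?q p))\<^sup>2)"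
      using H_quadrant
    proof eventually_elim
      case (elim p)
      define r where "r = ?g / cmod (?q p)"
      have "snd p * r \<le> (1 + (snd p * r)\<^sup>2) / 2" using sum_squares_bound[of 1 "snd p * r"] by simp
      then have "fst p / snd p * (snd p * r) \<le> fst p / snd p * ((1 + (snd p * r)\<^sup>2) / 2)"
        using elim by (intro mult_left_mono) auto
      also have "fst p / snd p * (snd p * r) = fst p * r" using elim by simp
      also have "fst p / snd p * ((1 + (snd p * r)\<^sup>2) / 2) = 1 / 2 * (fst p / snd p) + 1 / 2 * (fst p * snd p * r\<^sup>2)"
        using elim by (simp add: field_simps power2_eq_square)
      finally show ?case using elim by (simp add: r_def norm_divide power_divide mult.commute)
    qed
    show "AE p in H. 0 \<le> 1 / 2 * (fst p / snd p) + ?g\<^sup>2 / 2 * (fst p * snd p / (cmod (?q p))\<^sup>2)"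
      using H_quadrant by eventually_elim auto
  qed
  also have "\<dots> = 1 / 2 * (\<integral>p. fst p / snd p \<partial>H) + ?g\<^sup>2 / 2 * A 2 z"
    using st(1) i2
    by (simp only: Bochner_Integration.integral_add Bochner_Integration.integrable_mult_right
        Bochner_Integration.integral_mult_right_zero AB_int_eq)
  also have "\<dots> \<le> 1 / 2 * (1 / c) + ?g\<^sup>2 / 2 * A 2 z" using st(2) by simp
  finally have "c * (?g * cmod S) \<le> c * (1 / 2 * (1 / c) + ?g\<^sup>2 / 2 * A 2 z)"
    using c by (intro mult_left_mono) auto
  also have "\<dots> = 1 - ?g\<^sup>2 * V0 c H (mS z) (gS z) / 2"
    using c g by (simp add: V0_def field_simps)
  finally show ?thesis unfolding eq using c by (simp add: norm_mult mult.assoc)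
qed

text \<open>The bound in \<open>ratio_mS_gS\<close> together with \<open>V0_bounded_below\<close> gives \<open>|1 - m0 / g0| < 1\<close> in the limit, so
\<open>m0\<close> and \<open>g0\<close> have the same sign and the denominators are nondegenerate.  After that all equations pass
to the limit.\<close>

lemma extended_point:
  assumes st: "integrable H (\<lambda>p. fst p / snd p)" "(\<integral>p. fst p / snd p \<partial>H) \<le> 1 / c"
    and Z: "\<And>n. Im (Z n) > 0" and Zlim: "Z \<longlonglongrightarrow> of_real x0"
    and m: "(\<lambda>n. mS (Z n)) \<longlonglongrightarrow> of_real m0" and g: "(\<lambda>n. gS (Z n)) \<longlonglongrightarrow> of_real g0"
    and supp: "\<And>p. p \<in> top_support H \<Longrightarrow> 1 + fst p * g0 + snd p * m0 \<noteq> 0"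
  obtains \<epsilon> where "nondegenerate \<epsilon> (of_real m0) (of_real g0)" "m0 \<noteq> 0" "g0 \<noteq> 0"
    "curve c (of_real g0) (of_real m0) = 0" "slope c (of_real g0) (of_real m0) (of_real m0) \<noteq> 0"
    "of_real x0 = - 1 / of_real g0 + of_real c * (\<integral>p. of_real (snd p) / qd (of_real m0) (of_real g0) p \<partial>H)"
proof -
  have "complex_of_real g0 \<noteq> 0" by (rule gS_limit_nonzero[OF Z Zlim g])
  then have g0: "g0 \<noteq> 0" by simp
  obtain v where v: "v > 0" "\<And>n. v \<le> V0 c H (mS (Z n)) (gS (Z n))" using V0_bounded_below[OF Z Zlim m g] by blast
  have "cmod (1 - of_real m0 / of_real g0) \<le> 1 - (cmod (of_real g0))\<^sup>2 * v / 2"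
  proof (rule LIMSEQ_le)
    show "(\<lambda>n. cmod (1 - mS (Z n) / gS (Z n))) \<longlonglongrightarrow> cmod (1 - of_real m0 / of_real g0)"
      using g0 by (intro tendsto_intros m g) simp
    show "(\<lambda>n. 1 - (cmod (gS (Z n)))\<^sup>2 * v / 2) \<longlonglongrightarrow> 1 - (cmod (of_real g0))\<^sup>2 * v / 2"
      by (intro tendsto_intros g) simp
    have "cmod (1 - mS (Z n) / gS (Z n)) \<le> 1 - (cmod (gS (Z n)))\<^sup>2 * v / 2" for n
    proof -
      have "(cmod (gS (Z n)))\<^sup>2 * v \<le> (cmod (gS (Z n)))\<^sup>2 * V0 c H (mS (Z n)) (gS (Z n))"
        by (intro mult_left_mono v(2)) simp
      then show ?thesis using ratio_mS_gS[OF st Z, of n] by linarith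
    qed
    then show "\<exists>N. \<forall>n\<ge>N. cmod (1 - mS (Z n) / gS (Z n)) \<le> 1 - (cmod (gS (Z n)))\<^sup>2 * v / 2" by blast
  qed
  also have "\<dots> < 1" using v(1) g0 by simp
  also have "cmod (1 - of_real m0 / of_real g0) = \<bar>1 - m0 / g0\<bar>"
    by (metis norm_of_real of_real_1 of_real_diff of_real_divide)
  finally have "0 < m0 / g0" by linarith
  then have sign: "0 < m0 * g0" by (simp add: zero_less_divide_iff zero_less_mult_iff)
  then have m0: "m0 \<noteq> 0" by auto
  obtain \<epsilon> where nd: "nondegenerate \<epsilon> (of_real m0) (of_real g0)"
    using nondegenerate_if_same_sign[OF sign supp] by blast
  then have e: "\<epsilon> / 2 > 0" by (simp add: nondegenerate_def)
  have "eventually (\<lambda>n. dist (mS (Z n)) (of_real m0) < \<epsilon> / 2 \<and> dist (gS (Z n)) (of_real g0) < \<epsilon> / 2) sequentially"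
    using tendstoD[OF m e] tendstoD[OF g e] by eventually_elim auto
  then obtain n0 where n0: "\<And>n. n \<ge> n0 \<Longrightarrow> dist (mS (Z n)) (of_real m0) < \<epsilon> / 2 \<and> dist (gS (Z n)) (of_real g0) < \<epsilon> / 2"
    by (auto simp: eventually_sequentially)
  define Y where "Y n = Z (n + n0)" for n
  have Y: "Im (Y n) > 0" for n using Z by (simp add: Y_def)
  have Ylim: "Y \<longlonglongrightarrow> of_real x0" "(\<lambda>n. mS (Y n)) \<longlonglongrightarrow> of_real m0" "(\<lambda>n. gS (Y n)) \<longlonglongrightarrow> of_real g0"
    unfolding Y_def using Zlim m g by (auto intro: LIMSEQ_ignore_initial_segment)
  have nd2: "nondegenerate (\<epsilon> / 2) (mS (Y n)) (gS (Y n))" for n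
    using n0[of "n + n0"] by (intro nondegenerate_perturb[OF nd]) (auto simp: Y_def dist_norm)
  have nd0: "nondegenerate (\<epsilon> / 2) (of_real m0) (of_real g0)"
    using e by (intro nondegenerate_perturb[OF nd]) auto
  note tend = tendsto_integral_over_qd[OF nd2 nd0 Ylim(2,3)]
  have "(\<lambda>n. curve c (gS (Y n)) (mS (Y n))) \<longlonglongrightarrow> curve c (of_real g0) (of_real m0)"
    unfolding curve_def
    by (intro tendsto_intros Ylim tend measurable_coordinates monomial_bounds)
  moreover have "curve c (gS (Y n)) (mS (Y n)) = 0" for n
    unfolding curve_def by (rule curve_upper_half[OF Y])
  ultimately have on: "curve c (of_real g0) (of_real m0) = 0" by (simp add: LIMSEQ_const_iff)
  have "(\<lambda>n. - 1 / gS (Y n) + of_real c * (\<integral>p. of_real (snd p) / qd (mS (Y n)) (gS (Y n)) p \<partial>H)) \<longlonglongrightarrow>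
      - 1 / of_real g0 + of_real c * (\<integral>p. of_real (snd p) / qd (of_real m0) (of_real g0) p \<partial>H)"
    using g0 by (intro tendsto_intros Ylim tend measurable_coordinates monomial_bounds) simp
  moreover have "- 1 / gS (Y n) + of_real c * (\<integral>p. of_real (snd p) / qd (mS (Y n)) (gS (Y n)) p \<partial>H) = Y n" for n
    unfolding E2[OF Y] by simp
  ultimately have "Y \<longlonglongrightarrow> - 1 / of_real g0 + of_real c * (\<integral>p. of_real (snd p) / qd (of_real m0) (of_real g0) p \<partial>H)"
    by (simp only:)
  from LIMSEQ_unique[OF Ylim(1) this] have x0: "of_real x0 = - 1 / of_real g0 + of_real c * (\<integral>p. of_real (snd p) / qd (of_real m0) (of_real g0) p \<partial>H)" .
  define J where "J = (\<integral>p. fst p * snd p / (1 + fst p * g0 + snd p * m0)\<^sup>2 \<partial>H)"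
  have J: "J \<le> (1 / (cmod (of_real g0))\<^sup>2 - v) / c"
    unfolding J_def
  proof (rule integral_Fatou_bound(2))
    show "AE p in H. 0 \<le> fst p * snd p / (cmod (qd (mS (Y n)) (gS (Y n)) p))\<^sup>2" for n
      using H_quadrant by eventually_elim auto
    show "AE p in H. (\<lambda>n. fst p * snd p / (cmod (qd (mS (Y n)) (gS (Y n)) p))\<^sup>2) \<longlonglongrightarrow> fst p * snd p / (1 + fst p * g0 + snd p * m0)\<^sup>2"
      using nondegenerate_bounds(2)[OF nd]
    proof eventually_elim
      case (elim p)
      have eq: "qd (of_real m0) (of_real g0) p = of_real (1 + fst p * g0 + snd p * m0)" by simp
      have "(\<lambda>n. fst p * snd p / (cmod (qd (mS (Y n)) (gS (Y n)) p))\<^sup>2) \<longlonglongrightarrow> fst p * snd p / (cmod (qd (of_real m0) (of_real g0) p))\<^sup>2"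
        using elim by (intro tendsto_intros Ylim) auto
      then show ?case unfolding eq norm_of_real power2_abs .
    qed
    show "integrable H (\<lambda>p. fst p * snd p / (cmod (qd (mS (Y n)) (gS (Y n)) p))\<^sup>2)" for n by (rule AB_integrable[OF nd2])
    show "(\<integral>p. fst p * snd p / (cmod (qd (mS (Y n)) (gS (Y n)) p))\<^sup>2 \<partial>H) \<le> (1 / (cmod (gS (Y n)))\<^sup>2 - v) / c" for n
      using v(2)[of "n + n0"] c unfolding V0_def AB_int_eq Y_def by (simp add: pos_le_divide_eq algebra_simps)
    show "(\<lambda>n. (1 / (cmod (gS (Y n)))\<^sup>2 - v) / c) \<longlonglongrightarrow> (1 / (cmod (of_real g0))\<^sup>2 - v) / c"
      using g0 c by (intro tendsto_intros Ylim) auto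
  qed measurable
  have "c * J < 1 / g0\<^sup>2"
  proof -
    have "c * J \<le> 1 / g0\<^sup>2 - v" using J c by (simp add: pos_le_divide_eq mult.commute)
    then show ?thesis using v(1) by linarith
  qed
  then have "1 - c * g0\<^sup>2 * J \<noteq> 0" using g0 by (auto simp: field_simps)
  moreover have "slope c (of_real g0) (of_real m0) (of_real m0) = of_real (1 - c * g0\<^sup>2 * J)"
  proof -
    have "complex_of_real (fst p * snd p) / (qd (of_real m0) (of_real g0) p * qd (of_real m0) (of_real g0) p)
        = of_real (fst p * snd p / (1 + fst p * g0 + snd p * m0)\<^sup>2)" for p
      by (simp add: power2_eq_square)
    then show ?thesis unfolding slope_def J_def by (simp only: integral_complex_of_real) simp
  qed
  ultimately have "slope c (of_real g0) (of_real m0) (of_real m0) \<noteq> 0" by (simp only: of_real_eq_0_iff) simp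
  then show ?thesis using that nd m0 g0 on x0 by blast
qed

end

text \<open>A point \<open>z\<close> might admit other solutions of the system.  But near the given sequence \<open>m\<close> and \<open>g\<close> lie in the region where \<open>h\<close> is the only solution of the curve equation, and the
identity theorem extends the resulting equality to a half disc.\<close>

lemma (in limit_system) curve_interval:
  assumes st: "integrable H (\<lambda>p. fst p / snd p)" "(\<integral>p. fst p / snd p \<partial>H) \<le> 1 / c"
    and Z: "\<And>n. Im (Z n) > 0" and Zlim: "Z \<longlonglongrightarrow> of_real x0"
    and m: "(\<lambda>n. mS (Z n)) \<longlonglongrightarrow> of_real m0" and g: "(\<lambda>n. gS (Z n)) \<longlonglongrightarrow> of_real g0"
    and supp: "\<And>p. p \<in> top_support H \<Longrightarrow> 1 + fst p * g0 + snd p * m0 \<noteq> 0"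
  shows "\<exists>a b J mf xf. a < g0 \<and> g0 < b \<and> open J \<and> m0 \<in> J \<and>
     (\<forall>\<gamma>\<in>{a<..<b}. mf \<gamma> \<in> J \<and> (\<forall>\<mu>\<in>J. curve_eq c H \<gamma> \<mu> \<longleftrightarrow> \<mu> = mf \<gamma>)) \<and> mf g0 = m0 \<and>
     real_analytic_on xf {a<..<b} \<and> xf g0 = x0 \<and>
     (\<forall>\<gamma>\<in>{a<..<b}. solves_E c H (of_real (xf \<gamma>)) (of_real (mf \<gamma>)) (of_real \<gamma>)) \<and>
     (deriv xf g0 \<noteq> 0 \<longrightarrow> (\<exists>e>0. AE l in Fu. e \<le> \<bar>l - x0\<bar>))"
proof -
  obtain \<epsilon> where nd: "nondegenerate \<epsilon> (of_real m0) (of_real g0)" and m0: "m0 \<noteq> 0" and g0: "g0 \<noteq> 0"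
    and on: "curve c (of_real g0) (of_real m0) = 0" and sl: "slope c (of_real g0) (of_real m0) (of_real m0) \<noteq> 0"
    and x0: "of_real x0 = - 1 / of_real g0 + of_real c * (\<integral>p. of_real (snd p) / qd (of_real m0) (of_real g0) p \<partial>H)"
    using extended_point[OF assms] by blast
  have e: "\<epsilon> > 0" using nd by (simp add: nondegenerate_def)
  define \<delta> where "\<delta> = min (\<epsilon> / 2) (min \<bar>m0\<bar> \<bar>g0\<bar>)"
  have \<delta>: "\<delta> > 0" "\<delta> \<le> \<epsilon> / 2" "\<delta> \<le> \<bar>m0\<bar>" "\<delta> \<le> \<bar>g0\<bar>" using e m0 g0 by (auto simp: \<delta>_def)
  obtain r \<rho> h where r: "0 < r" "r \<le> \<delta>" and \<rho>: "0 < \<rho>" "\<rho> \<le> \<delta>" and hol: "h holomorphic_on ball (of_real g0) r"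
    and h_in: "\<And>w. w \<in> ball (of_real g0) r \<Longrightarrow> h w \<in> ball (of_real m0) \<rho>"
    and h: "\<And>w v. w \<in> ball (of_real g0) r \<Longrightarrow> v \<in> ball (of_real m0) \<rho> \<Longrightarrow> curve c w v = 0 \<longleftrightarrow> v = h w"
    by (rule implicit_curve[OF nd on sl \<delta>(1)]) (rule that)
  let ?B = "ball (complex_of_real g0) r"
  have nd2: "nondegenerate (\<epsilon> / 2) v w" if "w \<in> ?B" "v \<in> ball (of_real m0) \<rho>" for v w
    using that r \<rho> \<delta> by (intro nondegenerate_perturb[OF nd]) (auto simp: dist_norm norm_minus_commute)
  have B_ne: "w \<noteq> 0" if "w \<in> ?B" for w using that r \<delta> by (auto simp: dist_norm)
  have m_ne: "v \<noteq> 0" if "v \<in> ball (complex_of_real m0) \<rho>" for v using that \<rho> \<delta> by (auto simp: dist_norm)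
  have g0B: "of_real g0 \<in> ?B" using r by simp
  have h0: "h (of_real g0) = of_real m0"
    using h[OF g0B, of "of_real m0"] on \<rho> by simp
  \<comment> \<open>The function \<open>x\<close> on the curve, continued to complex arguments.\<close>
  define X where "X w = - 1 / w + of_real c * (\<integral>p. of_real (snd p) / qd (h w) w p \<partial>H)" for w
  have X_hol: "X holomorphic_on ?B"
  proof -
    have "(\<lambda>w. \<integral>p. of_real (snd p) / qd (h w) w p \<partial>H) holomorphic_on ?B"
    proof (rule holomorphic_integral_over_qd[OF nd open_ball _ hol])
      have "ball (complex_of_real m0) \<rho> \<subseteq> cball (of_real m0) (\<epsilon> / 2)" using \<rho> \<delta> by auto
      then show "h ` ?B \<subseteq> cball (of_real m0) (\<epsilon> / 2)" using h_in by blast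
      show "?B \<subseteq> cball (of_real g0) (\<epsilon> / 2)" using r \<delta> by auto
    qed (use monomial_bounds(3) in auto)
    then show ?thesis unfolding X_def using B_ne by (intro holomorphic_intros) auto
  qed
  have X0: "X (of_real g0) = of_real x0" unfolding X_def h0 x0 by simp
  have cnjB: "cnj w \<in> ball (complex_of_real u) s" if "w \<in> ball (complex_of_real u) s" for w u s
  proof -
    have "of_real u - cnj w = cnj (of_real u - w)" by simp
    then show ?thesis using that by (simp only: mem_ball dist_norm complex_mod_cnj)
  qed
  have h_cnj: "h (cnj w) = cnj (h w)" if "w \<in> ?B" for w
  proof -
    have "curve c (cnj w) (cnj (h w)) = 0" unfolding curve_cnj using h[OF that h_in[OF that]] by simp
    then show ?thesis using h[OF cnjB[OF that] cnjB[OF h_in[OF that]]] by simp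
  qed
  have X_cnj: "X (cnj w) = cnj (X w)" if "w \<in> ?B" for w
  proof -
    have "cnj (\<integral>p. of_real (snd p) / qd (h w) w p \<partial>H) = (\<integral>p. cnj (of_real (snd p) / qd (h w) w p) \<partial>H)"
      by (rule Bochner_Integration.integral_cnj[symmetric])
    also have "\<dots> = (\<integral>p. of_real (snd p) / qd (h (cnj w)) (cnj w) p \<partial>H)" by (simp add: h_cnj[OF that])
    finally show ?thesis unfolding X_def by simp
  qed
  have real_fix: "v = of_real (Re v)" if "cnj v = v" for v
    using that by (simp add: complex_eq_iff)
  have inB: "of_real \<gamma> \<in> ?B" if "\<gamma> \<in> {g0 - r<..<g0 + r}" for \<gamma>
  proof -
    have "dist (complex_of_real g0) (of_real \<gamma>) = \<bar>g0 - \<gamma>\<bar>" by (metis dist_norm norm_of_real of_real_diff)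
    then show ?thesis using that by auto
  qed
  define mf where "mf \<gamma> = Re (h (of_real \<gamma>))" for \<gamma>
  define xf where "xf \<gamma> = Re (X (of_real \<gamma>))" for \<gamma>
  have mf: "h (of_real \<gamma>) = of_real (mf \<gamma>)" and xf: "X (of_real \<gamma>) = of_real (xf \<gamma>)"
    if "\<gamma> \<in> {g0 - r<..<g0 + r}" for \<gamma>
    using real_fix[of "h (of_real \<gamma>)"] real_fix[of "X (of_real \<gamma>)"] h_cnj[OF inB[OF that]] X_cnj[OF inB[OF that]]
    by (simp_all add: mf_def xf_def)
  define J where "J = {m0 - \<rho><..<m0 + \<rho>}"
  have J: "\<mu> \<in> J \<longleftrightarrow> of_real \<mu> \<in> ball (complex_of_real m0) \<rho>" for \<mu>
  proof -
    have "dist (complex_of_real m0) (of_real \<mu>) = \<bar>m0 - \<mu>\<bar>" by (metis dist_norm norm_of_real of_real_diff)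
    then show ?thesis by (auto simp: J_def)
  qed
  have curve_J: "mf \<gamma> \<in> J \<and> (\<forall>\<mu>\<in>J. curve_eq c H \<gamma> \<mu> \<longleftrightarrow> \<mu> = mf \<gamma>)" if \<gamma>: "\<gamma> \<in> {g0 - r<..<g0 + r}" for \<gamma>
  proof (intro conjI ballI)
    show "mf \<gamma> \<in> J" using h_in[OF inB[OF \<gamma>]] unfolding J mf[OF \<gamma>] .
    fix \<mu> assume \<mu>: "\<mu> \<in> J"
    have "curve_eq c H \<gamma> \<mu> \<longleftrightarrow> curve c (of_real \<gamma>) (of_real \<mu>) = 0"
      by (rule curve_eq_iff[OF nd2[OF inB[OF \<gamma>]]]) (use \<mu> J in blast)
    also have "\<dots> \<longleftrightarrow> complex_of_real \<mu> = h (of_real \<gamma>)" using h[OF inB[OF \<gamma>]] \<mu> J by blast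
    finally show "curve_eq c H \<gamma> \<mu> \<longleftrightarrow> \<mu> = mf \<gamma>" unfolding mf[OF \<gamma>] of_real_eq_iff .
  qed
  have solves: "solves_E c H (of_real (xf \<gamma>)) (of_real (mf \<gamma>)) (of_real \<gamma>)" if \<gamma>: "\<gamma> \<in> {g0 - r<..<g0 + r}" for \<gamma>
  proof -
    have hB: "h (of_real \<gamma>) \<in> ball (of_real m0) \<rho>" by (rule h_in[OF inB[OF \<gamma>]])
    have "solves_E c H (X (of_real \<gamma>)) (h (of_real \<gamma>)) (of_real \<gamma>)"
      by (rule solves_E_if_curve[OF nd2[OF inB[OF \<gamma>] hB] m_ne[OF hB] B_ne[OF inB[OF \<gamma>]]])
         (use h[OF inB[OF \<gamma>] hB] in \<open>simp_all only: X_def\<close>)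
    then show ?thesis unfolding mf[OF \<gamma>] xf[OF \<gamma>] .
  qed
  have gap: "\<exists>e>0. AE l in Fu. e \<le> \<bar>l - x0\<bar>" if dx: "deriv xf g0 \<noteq> 0"
  proof -
    have "(X has_field_derivative deriv X (of_real g0)) (at (of_real g0))"
      by (rule holomorphic_derivI[OF X_hol open_ball g0B])
    from has_field_derivative_Re[OF has_vector_derivative_real_field[OF this, of UNIV]]
    have "(xf has_field_derivative Re (deriv X (of_real g0))) (at g0)" unfolding xf_def .
    then have "deriv xf g0 = Re (deriv X (of_real g0))" by (rule DERIV_imp_deriv)
    then have "deriv X (of_real g0) \<noteq> 0" using dx by auto
    from has_complex_derivative_locally_invertible[OF X_hol g0B open_ball this]
    obtain r1 where r1: "r1 > 0" "ball (of_real g0) r1 \<subseteq> ?B" "open (X ` ball (of_real g0) r1)" "inj_on X (ball (of_real g0) r1)" .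
    let ?B1 = "ball (complex_of_real g0) r1"
    have "X holomorphic_on ?B1" using X_hol r1(2) holomorphic_on_subset by blast
    from holomorphic_has_inverse[OF this open_ball r1(4)]
    obtain \<psi> where \<psi>: "\<psi> holomorphic_on X ` ?B1" "\<And>w. w \<in> ?B1 \<Longrightarrow> \<psi> (X w) = w" by metis
    have "of_real x0 \<in> X ` ?B1" using X0 r1(1) by (metis centre_in_ball image_eqI)
    then obtain \<sigma> where \<sigma>: "\<sigma> > 0" "ball (of_real x0) \<sigma> \<subseteq> X ` ?B1" using r1(3) openE by blast
    have \<psi>_in: "\<psi> z \<in> ?B1" "X (\<psi> z) = z" if "z \<in> ball (of_real x0) \<sigma>" for z
    proof -
      obtain w where w: "w \<in> ?B1" "z = X w" using \<sigma>(2) \<open>z \<in> ball (of_real x0) \<sigma>\<close> by blast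
      then show "\<psi> z \<in> ?B1" "X (\<psi> z) = z" using \<psi>(2) by auto
    qed
    have f_hol: "(h \<circ> \<psi>) holomorphic_on ball (of_real x0) \<sigma>"
    proof (rule holomorphic_on_compose)
      show "\<psi> holomorphic_on ball (of_real x0) \<sigma>" using \<psi>(1) \<sigma>(2) holomorphic_on_subset by blast
      show "h holomorphic_on \<psi> ` ball (of_real x0) \<sigma>" using hol \<psi>_in(1) r1(2) holomorphic_on_subset by blast
    qed
    let ?W = "ball (of_real x0) \<sigma> \<inter> {z. Im z > 0}"
    have W: "open ?W" "connected ?W"
      by (rule open_Int[OF open_ball open_halfspace_Im_gt], rule convex_connected[OF convex_Int[OF convex_ball convex_halfspace_Im_gt]])
    have mS_hol: "mS holomorphic_on ?W" and gS_hol: "gS holomorphic_on ?W"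
      by (rule holomorphic_on_subset[OF stieltjes_upper_half(1)[OF Fu] Int_lower2]
          holomorphic_on_subset[OF stieltjes_upper_half(1)[OF G] Int_lower2])+
    define D where "D = (?W \<inter> mS -` ball (of_real m0) \<rho>) \<inter> (?W \<inter> gS -` ?B1)"
    have D_open: "open D" unfolding D_def
      by (intro open_Int continuous_open_preimage W open_ball holomorphic_on_imp_continuous_on mS_hol gS_hol)
    have D_ne: "D \<noteq> {}"
    proof -
      have "eventually (\<lambda>n. dist (Z n) (of_real x0) < \<sigma> \<and> dist (mS (Z n)) (of_real m0) < \<rho> \<and> dist (gS (Z n)) (of_real g0) < r1) sequentially"
        using tendstoD[OF Zlim \<sigma>(1)] tendstoD[OF m \<rho>(1)] tendstoD[OF g r1(1)] by eventually_elim auto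
      then obtain n where "dist (Z n) (of_real x0) < \<sigma>" "dist (mS (Z n)) (of_real m0) < \<rho>" "dist (gS (Z n)) (of_real g0) < r1"
        by (auto simp: eventually_sequentially)
      then have "Z n \<in> D" using Z[of n] by (auto simp: D_def dist_commute)
      then show ?thesis by blast
    qed
    have D_eq: "mS z = (h \<circ> \<psi>) z" if "z \<in> D" for z
    proof -
      have z: "Im z > 0" "mS z \<in> ball (of_real m0) \<rho>" "gS z \<in> ?B1" using that by (auto simp: D_def)
      then have gB: "gS z \<in> ?B" using r1(2) by blast
      have "curve c (gS z) (mS z) = 0" unfolding curve_def by (rule curve_upper_half[OF z(1)])
      then have mh: "mS z = h (gS z)" using h[OF gB z(2)] by blast
      have "X (gS z) = z" unfolding X_def mh[symmetric] E2[OF z(1)] by simp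
      then have "\<psi> z = gS z" using \<psi>(2)[OF z(3)] by simp
      then show ?thesis using mh by simp
    qed
    have W_eq: "mS z = (h \<circ> \<psi>) z" if "z \<in> ?W" for z
    proof (rule analytic_continuation_open[OF D_open W(1) D_ne W(2) _ mS_hol _ D_eq that])
      show "D \<subseteq> ?W" by (auto simp: D_def)
      show "(h \<circ> \<psi>) holomorphic_on ?W" using f_hol holomorphic_on_subset by blast
    qed
    show ?thesis
    proof (rule gap_if_real_extension[OF Fu f_hol \<sigma>(1)])
      fix x assume x: "of_real x \<in> ball (complex_of_real x0) \<sigma>"
      let ?w = "\<psi> (of_real x)"
      have w: "?w \<in> ?B1" "?w \<in> ?B" using \<psi>_in(1)[OF x] r1(2) by blast+
      have "X (cnj ?w) = X ?w" unfolding X_cnj[OF w(2)] \<psi>_in(2)[OF x] by simp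
      then have "cnj ?w = ?w" using r1(4) cnjB[OF w(1)] w(1) by (meson inj_onD)
      then have "cnj (h ?w) = h ?w" using h_cnj[OF w(2)] by simp
      then show "Im ((h \<circ> \<psi>) (of_real x)) = 0" by (simp add: complex_eq_iff)
    qed (use W_eq in auto)
  qed
  have "real_analytic_on xf {g0 - r<..<g0 + r}" unfolding xf_def by (rule real_analytic_on_Re[OF X_hol])
  moreover have "mf g0 = m0" "xf g0 = x0" by (simp_all add: mf_def xf_def h0 X0)
  moreover have "open J" "m0 \<in> J" using \<rho> by (simp_all add: J_def)
  moreover have "g0 - r < g0" "g0 < g0 + r" using r by simp_all
  ultimately show ?thesis using curve_J solves gap
    by - (rule exI[of _ "g0 - r"], rule exI[of _ "g0 + r"], rule exI[of _ J], rule exI[of _ mf], rule exI[of _ xf],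
        intro conjI ballI impI; simp)
qed

section \<open>The spectral model\<close>

lemma scalar_prod_mult_adjoint:
  fixes Y :: "complex Matrix.mat"
  assumes Y: "Y \<in> carrier_mat n k" and v: "v \<in> carrier_vec n"
  defines "w \<equiv> mult_mat_vec (mat_adjoint Y) v"
  shows "scalar_prod (mult_mat_vec (Y * mat_adjoint Y) v) (conjugate v) = scalar_prod w (conjugate w)"
proof -
  have adj: "mat_adjoint Y \<in> carrier_mat k n" using Y unfolding mat_adjoint_def by auto
  have w: "w \<in> carrier_vec k" unfolding w_def using adj v by auto
  have cv: "conjugate v \<in> carrier_vec n" using v by auto
  have tr: "mult_mat_vec (transpose_mat Y) (conjugate v) = conjugate w"
  proof (rule eq_vecI)
    show "dim_vec (mult_mat_vec (transpose_mat Y) (conjugate v)) = dim_vec (conjugate w)" using Y w by auto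
    fix i assume "i < dim_vec (conjugate w)"
    then have i: "i < k" using w by auto
    have "vec_index w i = scalar_prod (conjugate (Matrix.col Y i)) v"
      unfolding w_def using i adj Y by (simp add: mat_adjoint_def mat_of_rows_row)
    moreover have "conjugate (scalar_prod (conjugate (Matrix.col Y i)) v) = scalar_prod (Matrix.col Y i) (conjugate v)"
      using v Y i by (simp add: scalar_prod_def sum_conjugate)
    ultimately show "vec_index (mult_mat_vec (transpose_mat Y) (conjugate v)) i = vec_index (conjugate w) i"
      using i w Y by simp
  qed
  have "mult_mat_vec (Y * mat_adjoint Y) v = mult_mat_vec Y w"
    unfolding w_def by (rule assoc_mult_mat_vec[OF Y adj v])
  then have "scalar_prod (mult_mat_vec (Y * mat_adjoint Y) v) (conjugate v) = scalar_prod (conjugate v) (mult_mat_vec Y w)"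
    using cv w Y by (simp add: comm_scalar_prod[of _ n])
  also have "\<dots> = scalar_prod (mult_mat_vec (transpose_mat Y) (conjugate v)) w"
    by (rule transpose_vec_mult_scalar[OF Y w cv, symmetric])
  also have "\<dots> = scalar_prod w (conjugate w)" unfolding tr using w by (intro comm_scalar_prod[of _ k]) auto
  finally show ?thesis .
qed

lemma esd_gram_negative:
  fixes Y :: "complex Matrix.mat"
  assumes Y: "Y \<in> carrier_mat n k" and r: "r \<ge> 0" and x: "x < 0"
  shows "esd (of_real r \<cdot>\<^sub>m (Y * mat_adjoint Y)) x = 0"
proof -
  define A where "A = of_real r \<cdot>\<^sub>m (Y * mat_adjoint Y)"
  have adj: "mat_adjoint Y \<in> carrier_mat k n" using Y unfolding mat_adjoint_def by auto
  have A: "A \<in> carrier_mat n n" using Y adj by (simp add: A_def)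
  have "a \<ge> 0" if "poly (char_poly A) (complex_of_real a) = 0" for a
  proof -
    have "eigenvalue A (of_real a)" using that eigenvalue_root_char_poly[OF A] by blast
    then obtain v where v: "v \<in> carrier_vec n" "v \<noteq> 0\<^sub>v n" "mult_mat_vec A v = of_real a \<cdot>\<^sub>v v"
      using A unfolding eigenvalue_def eigenvector_def by auto
    define w where "w = mult_mat_vec (mat_adjoint Y) v"
    have w: "w \<in> carrier_vec k" unfolding w_def using adj v by auto
    have cv: "conjugate v \<in> carrier_vec n" using v by auto
    have YY: "mult_mat_vec (Y * mat_adjoint Y) v \<in> carrier_vec n" using Y adj v by auto
    have Av: "mult_mat_vec A v = of_real r \<cdot>\<^sub>v mult_mat_vec (Y * mat_adjoint Y) v"
    proof -
      have "mult_mat_vec (k \<cdot>\<^sub>m C) v = k \<cdot>\<^sub>v mult_mat_vec C v" if "C \<in> carrier_mat n n" for k and C :: "complex Matrix.mat"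
        using that v(1) by (intro eq_vecI) auto
      then show ?thesis unfolding A_def using Y adj by simp
    qed
    have "of_real a * scalar_prod v (conjugate v) = scalar_prod (mult_mat_vec A v) (conjugate v)"
      unfolding v(3) using v cv by simp
    also have "\<dots> = of_real r * scalar_prod w (conjugate w)"
      unfolding Av w_def using scalar_prod_mult_adjoint[OF Y v(1)] YY cv by simp
    finally have eq: "of_real a * scalar_prod v (conjugate v) = of_real r * scalar_prod w (conjugate w)" .
    have "scalar_prod v (conjugate v) > 0" using v by simp
    moreover have "scalar_prod w (conjugate w) \<ge> 0" by (rule conjugate_square_ge_0_vec)
    ultimately have "Re (scalar_prod v (conjugate v)) > 0" "Im (scalar_prod v (conjugate v)) = 0"
      "Re (scalar_prod w (conjugate w)) \<ge> 0"
      by (auto simp: less_complex_def less_eq_complex_def)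
    moreover have "a * Re (scalar_prod v (conjugate v)) = r * Re (scalar_prod w (conjugate w))"
      using arg_cong[OF eq, of Re] by simp
    ultimately have "0 \<le> a * Re (scalar_prod v (conjugate v))" using r by simp
    then show ?thesis using \<open>Re (scalar_prod v (conjugate v)) > 0\<close> by (simp add: zero_le_mult_iff)
  qed
  then have "{a. poly (char_poly A) (complex_of_real a) = 0 \<and> a \<le> x} = {}" using x by force
  then have none: "(\<Sum>a | poly (char_poly A) (complex_of_real a) = 0 \<and> a \<le> x.
      real (Polynomial.order (of_real a) (char_poly A))) = 0" by (simp only: sum.empty)
  show ?thesis unfolding esd_def A_def[symmetric] none by simp
qed

text \<open>The random spectral distributions have no mass on the negative half line, and neither has their weak
limit.\<close>

lemma (in info_plus_noise) cdf_F_negative: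
  assumes "x < 0"
  shows "cdf F x = 0"
proof -
  interpret F: real_distribution F by (rule F_distr)
  obtain \<omega> where \<omega>: "weak_conv
      (\<lambda>n. let Y = R n + Th n * Matrix.mat n (N n) (\<lambda>(j, k). X n j k \<omega>)
            in esd (of_real (1 / real (N n)) \<cdot>\<^sub>m (Y * mat_adjoint Y))) (cdf F)"
    using conv_F by (metis (mono_tags, lifting) AE_prob_1 eventually_happens trivial_limit_def ae_filter_eq_bot_iff emeasure_space_1 zero_neq_one)
  have "countable {a. \<not> isCont (cdf F) a}"
    by (rule mono_ctble_discont) (simp add: mono_def F.cdf_nondecreasing)
  moreover have "uncountable {x<..<0}" using assms by (simp add: uncountable_open_interval)
  ultimately have "\<not> {x<..<0} \<subseteq> {a. \<not> isCont (cdf F) a}" using countable_subset by blast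
  then obtain y where y: "x < y" "y < 0" "isCont (cdf F) y" by auto
  let ?esd = "\<lambda>n. let Y = R n + Th n * Matrix.mat n (N n) (\<lambda>(j, k). X n j k \<omega>)
            in esd (of_real (1 / real (N n)) \<cdot>\<^sub>m (Y * mat_adjoint Y))"
  have zero: "?esd n y = 0" for n
    unfolding Let_def
  proof (rule esd_gram_negative)
    have "Th n \<in> carrier_mat n n" using Th_psd by (simp add: psd_mat_def)
    then show "R n + Th n * Matrix.mat n (N n) (\<lambda>(j, k). X n j k \<omega>) \<in> carrier_mat n (N n)"
      by (intro add_carrier_mat mult_carrier_mat) auto
  qed (use y in auto)
  have "(\<lambda>n. ?esd n y) \<longlonglongrightarrow> cdf F y" using \<omega> y(3) unfolding weak_conv_def by blast
  then have "(\<lambda>n::nat. 0::real) \<longlonglongrightarrow> cdf F y" unfolding zero .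
  then have "cdf F y = 0" by (simp add: LIMSEQ_const_iff)
  then show ?thesis using F.cdf_nondecreasing[of x y] F.cdf_nonneg[of x] y by simp
qed

text \<open>With \<open>1 + c g = - 1 / (z \<gamma>)\<close> for the co-solution \<open>\<gamma>\<close>, the denominators in the equations of the companion function become
\<open>- z (1 + s \<gamma> + t m)\<close>.\<close>

lemma limit_system_of_model:
  assumes model: "info_plus_noise M c H N X T Th R u \<sigma> \<tau> F"
    and companion: "is_companion c H F g"
    and int_t: "(\<integral>\<^sup>+ p. ennreal (snd p) \<partial>H) < \<infinity>"
    and int_inv_t: "(\<integral>\<^sup>+ p. inverse (ennreal (snd p)) \<partial>H) < \<infinity>"
  obtains G where "limit_system H c (underF c F) G" "\<And>z. Im z > 0 \<Longrightarrow> underg c g z = stieltjes G z"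
proof -
  interpret M: info_plus_noise M c H N X T Th R u \<sigma> \<tau> F by (rule model)
  interpret H: prob_space H by (rule M.H_prob)
  note sets_H[measurable_cong] = M.H_borel
  have coord[measurable]: "fst \<in> borel_measurable H" "snd \<in> borel_measurable H"
    by (auto simp: measurable_cong_sets[OF sets_H refl] intro!: borel_measurable_continuous_onI continuous_intros)
  have "(\<lambda>p. inverse (ennreal (snd p))) \<in> borel_measurable H" by measurable
  then have "AE p in H. inverse (ennreal (snd p)) \<noteq> \<infinity>"
    by (rule nn_integral_PInf_AE) (use int_inv_t in auto)
  moreover have "AE p in H. 0 \<le> fst p \<and> 0 \<le> snd p" using M.H_nonneg by (simp add: case_prod_unfold)
  ultimately have quad: "AE p in H. 0 \<le> fst p \<and> 0 < snd p"
  proof eventually_elim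
    case (elim p)
    have "snd p \<noteq> 0" using elim(1) by auto
    then show ?case using elim(2) by auto
  qed
  interpret spectral_pair H by unfold_locales (fact sets_H, fact quad)
  have t_int: "integrable H snd"
  proof (rule integrableI_nonneg[OF coord(2) _ int_t])
    show "AE p in H. 0 \<le> snd p" using quad by eventually_elim simp
  qed
  obtain G where G: "real_distribution G" "AE x in G. 0 \<le> x" "\<And>z. Im z > 0 \<Longrightarrow> underg c g z = stieltjes G z"
    using companion unfolding is_companion_def by blast
  note uF = underF_mixture[OF M.F_distr M.c_pos M.c_le_1]
  have neg: "\<forall>x<0. cdf F x = 0" using M.cdf_F_negative by blast
  have mF: "stieltjes (underF c F) z = - of_real (1 - c) / z + of_real c * stieltjes F z" if z: "Im z > 0" for z
  proof -
    have "cmod (1 / (of_real l - z)) \<le> 1 / Im z" for l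
      using cmod_of_real_diff_ge_Im[of z l] z by (simp add: norm_divide frac_le)
    moreover have "(\<lambda>l. 1 / (complex_of_real l - z)) \<in> borel_measurable borel" by measurable
    ultimately show ?thesis
      using uF(3)[OF neg, of "\<lambda>l. 1 / (of_real l - z)" "1 / Im z"] by (simp add: stieltjes_def diff_divide_distrib)
  qed
  have den: "of_real s / (1 + of_real c * g z) - (1 + of_real c * stieltjes F z * of_real t) * z + of_real (t * (1 - c))
      = - z * qden (stieltjes (underF c F) z) (stieltjes G z) s t"
    and zg: "z * (1 + of_real c * g z) = - 1 / stieltjes G z" if z: "Im z > 0" for z s t
  proof -
    have gS: "stieltjes G z = - 1 / (z * (1 + of_real c * g z))" using G(3)[OF z] by (simp add: underg_def)
    have "0 < Im (stieltjes G z)" by (rule Im_stieltjes(4)[OF G(1,2) z])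
    then have ne: "z \<noteq> 0" "1 + of_real c * g z \<noteq> 0" unfolding gS by auto
    show "z * (1 + of_real c * g z) = - 1 / stieltjes G z" unfolding gS by simp
    have "z * (of_real s * stieltjes G z) = - (of_real s / (1 + of_real c * g z))"
    proof -
      have "w * (r * (- 1 / (w * a))) = - (r / a)" if "w \<noteq> 0" for w r a :: complex using that by simp
      then show ?thesis unfolding gS using ne(1) by blast
    qed
    moreover have "z * (of_real t * stieltjes (underF c F) z) = - of_real (t * (1 - c)) + of_real c * stieltjes F z * of_real t * z"
      unfolding mF[OF z] using ne by (simp add: field_simps)
    ultimately show "of_real s / (1 + of_real c * g z) - (1 + of_real c * stieltjes F z * of_real t) * z + of_real (t * (1 - c))
      = - z * qden (stieltjes (underF c F) z) (stieltjes G z) s t"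
      by (simp add: algebra_simps)
  qed
  have int: "stieltjes F z = (\<integral>p. 1 / (- z * qd (stieltjes (underF c F) z) (stieltjes G z) p) \<partial>H)"
    "g z = (\<integral>p. of_real (snd p) / (- z * qd (stieltjes (underF c F) z) (stieltjes G z) p) \<partial>H)" if z: "Im z > 0" for z
  proof -
    have *: "has_bochner_integral H (\<lambda>(s, t). 1 / (of_real s / (1 + of_real c * g z) - (1 + of_real c * stieltjes F z * of_real t) * z + of_real (t * (1 - c)))) (stieltjes F z)"
      "has_bochner_integral H (\<lambda>(s, t). of_real t / (of_real s / (1 + of_real c * g z) - (1 + of_real c * stieltjes F z * of_real t) * z + of_real (t * (1 - c)))) (g z)"
      using companion z unfolding is_companion_def Let_def by blast+
    show "stieltjes F z = (\<integral>p. 1 / (- z * qd (stieltjes (underF c F) z) (stieltjes G z) p) \<partial>H)"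
      "g z = (\<integral>p. of_real (snd p) / (- z * qd (stieltjes (underF c F) z) (stieltjes G z) p) \<partial>H)"
      using has_bochner_integral_integral_eq[OF *(1)] has_bochner_integral_integral_eq[OF *(2)]
      unfolding den[OF z] by (simp_all only: case_prod_unfold)
  qed
  have pull: "z * (\<integral>p. f p / (- z * w p) \<partial>H) = - (\<integral>p. f p / w p \<partial>H)" if "Im z > 0" for z and f w :: "real \<times> real \<Rightarrow> complex"
  proof -
    have "z \<noteq> 0" using that by auto
    then have eq: "f p / (- z * w p) = (- 1 / z) * (f p / w p)" for p by simp
    show ?thesis unfolding eq Bochner_Integration.integral_mult_right_zero using \<open>z \<noteq> 0\<close> by simp
  qed
  have "limit_system H c (underF c F) G"
  proof (rule limit_system.intro[OF spectral_pair_axioms limit_system_axioms.intro])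
    show "0 < c" "c \<le> 1" by (fact M.c_pos M.c_le_1)+
    show "real_distribution (underF c F)" "AE l in underF c F. 0 \<le> l" by (rule uF(1,2)[OF neg])+
    fix z assume z: "Im z > 0"
    then have z0: "z \<noteq> 0" by auto
    have "z * stieltjes (underF c F) z = - of_real (1 - c) + of_real c * (z * stieltjes F z)"
      unfolding mF[OF z] using z0 by (simp add: field_simps)
    also have "z * stieltjes F z = - (\<integral>p. 1 / qd (stieltjes (underF c F) z) (stieltjes G z) p \<partial>H)"
      by (subst int(1)[OF z]) (rule pull[OF z])
    finally show "z * stieltjes (underF c F) z = - of_real (1 - c) - of_real c * (\<integral>p. 1 / qd (stieltjes (underF c F) z) (stieltjes G z) p \<partial>H)"
      by (simp only: mult_minus_right diff_conv_add_uminus)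
    have "- 1 / stieltjes G z = z + of_real c * (z * g z)"
      unfolding zg[OF z, symmetric] by (simp only: distrib_left mult_1_right mult.left_commute)
    also have "z * g z = - (\<integral>p. of_real (snd p) / qd (stieltjes (underF c F) z) (stieltjes G z) p \<partial>H)"
      by (subst int(2)[OF z]) (rule pull[OF z])
    finally show "- 1 / stieltjes G z = z - of_real c * (\<integral>p. of_real (snd p) / qd (stieltjes (underF c F) z) (stieltjes G z) p \<partial>H)"
      by (simp only: mult_minus_right diff_conv_add_uminus)
  qed (fact G(1) G(2) t_int)+
  then show ?thesis using that G(3) by blast
qed

theorem theorem5:
  fixes M :: "'w measure"
    and c :: real
    and H :: "(real \<times> real) measure"
    and N :: "nat \<Rightarrow> nat"
    and X :: "nat \<Rightarrow> nat \<Rightarrow> nat \<Rightarrow> 'w \<Rightarrow> complex"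
    and T Th R :: "nat \<Rightarrow> complex Matrix.mat"
    and u :: "nat \<Rightarrow> nat \<Rightarrow> complex Matrix.vec"
    and \<sigma> \<tau> :: "nat \<Rightarrow> nat \<Rightarrow> real"
    and F :: "real measure"
    and g :: "complex \<Rightarrow> complex"
  assumes model: "info_plus_noise M c H N X T Th R u \<sigma> \<tau> F"
    and companion: "is_companion c H F g"
    and int_t: "(\<integral>\<^sup>+ p. ennreal (snd p) \<partial>H) < \<infinity>"
    and int_inv_t: "(\<integral>\<^sup>+ p. inverse (ennreal (snd p)) \<partial>H) < \<infinity>"
    and int_s_t: "(\<integral>\<^sup>+ p. ennreal (fst p) / ennreal (snd p) \<partial>H) \<le> ennreal (1 / c)"
  shows
    "(\<forall>x0 :: real. x0 > 0 \<and> x0 \<notin> df_support (cdf (underF c F)) \<longrightarrow>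
        (\<exists>D g'. open D \<and> of_real x0 \<in> D \<and>
           (\<forall>z\<in>D. integrable (underF c F) (\<lambda>t. 1 / (of_real t - z))) \<and>
           stieltjes (underF c F) analytic_on D \<and> g' analytic_on D \<and>
           (\<forall>z\<in>D. Im z > 0 \<longrightarrow> g' z = underg c g z) \<and>
           (\<forall>x :: real. x > 0 \<and> of_real x \<in> D \<longrightarrow>
              extended_solution c F g (of_real x) (stieltjes (underF c F) (of_real x)) (g' (of_real x)) \<and>
              V_defined c H (stieltjes (underF c F) (of_real x)) (g' (of_real x)) \<and>
              V c H (stieltjes (underF c F) (of_real x)) (g' (of_real x)) < x) \<and>
           (\<forall>(s, t) \<in> top_support H.
              of_real s * g' (of_real x0) + of_real t * stieltjes (underF c F) (of_real x0) \<noteq> -1)))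
     \<and>
     (\<forall>x0 m0 g0 :: real. x0 > 0 \<and>
        extended_solution c F g (of_real x0) (of_real m0) (of_real g0) \<and>
        (\<forall>(s, t) \<in> top_support H. s * g0 + t * m0 \<noteq> -1) \<longrightarrow>
        (\<exists>a b J mf xf. a < g0 \<and> g0 < b \<and> open J \<and> m0 \<in> J \<and>
           (\<forall>\<gamma>\<in>{a<..<b}. mf \<gamma> \<in> J \<and> (\<forall>\<mu>\<in>J. curve_eq c H \<gamma> \<mu> \<longleftrightarrow> \<mu> = mf \<gamma>)) \<and>
           mf g0 = m0 \<and>
           real_analytic_on xf {a<..<b} \<and> xf g0 = x0 \<and>
           (\<forall>\<gamma>\<in>{a<..<b}. solves_E c H (of_real (xf \<gamma>)) (of_real (mf \<gamma>)) (of_real \<gamma>)) \<and>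
           (deriv xf g0 \<noteq> 0 \<longrightarrow> x0 \<notin> df_support (cdf (underF c F)))))"
proof -
  obtain G where sys: "limit_system H c (underF c F) G" and gG: "\<And>z. Im z > 0 \<Longrightarrow> underg c g z = stieltjes G z"
    using limit_system_of_model[OF model companion int_t int_inv_t] by blast
  interpret limit_system H c "underF c F" G by (rule sys)
  have st_nn: "(\<integral>\<^sup>+ p. ennreal (fst p / snd p) \<partial>H) \<le> ennreal (1 / c)"
  proof -
    have "(\<integral>\<^sup>+ p. ennreal (fst p / snd p) \<partial>H) = (\<integral>\<^sup>+ p. ennreal (fst p) / ennreal (snd p) \<partial>H)"
      by (rule nn_integral_cong_AE) (use H_quadrant in eventually_elim, simp add: divide_ennreal)
    then show ?thesis using int_s_t by simp
  qed
  have st_pos: "AE p in H. 0 \<le> fst p / snd p" using H_quadrant by eventually_elim simp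
  have st: "integrable H (\<lambda>p. fst p / snd p)"
    by (rule integrableI_nonneg) (use st_pos st_nn in \<open>auto simp: le_less_trans\<close>)
  have st_le: "(\<integral>p. fst p / snd p \<partial>H) \<le> 1 / c"
    using st_nn c unfolding nn_integral_eq_integral[OF st st_pos] by (simp add: ennreal_le_iff)
  show ?thesis
  proof (intro conjI allI impI)
    fix x0 :: real assume x0: "x0 > 0 \<and> x0 \<notin> df_support (cdf (underF c F))"
    obtain \<epsilon> where e: "\<epsilon> > 0" and gF: "AE l in underF c F. \<epsilon> \<le> \<bar>l - x0\<bar>"
      using not_in_df_support_iff[OF Fu] x0 by blast
    obtain \<rho> where \<rho>: "\<rho> > 0" and gG0: "AE l in G. \<rho> \<le> \<bar>l - x0\<bar>"
      using gap_G[OF _ e gF] x0 by blast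
    define d where "d = min \<epsilon> \<rho>"
    have d: "d > 0" "d / 2 > 0" using e \<rho> by (auto simp: d_def)
    have gaps: "AE l in underF c F. d \<le> \<bar>l - x0\<bar>" "AE l in G. d \<le> \<bar>l - x0\<bar>"
      using gF by (eventually_elim, simp add: d_def) (use gG0 in \<open>eventually_elim, simp add: d_def\<close>)
    define D where "D = ball (complex_of_real x0) (d / 2)"
    have dist: "dist (complex_of_real x0) (of_real y) = \<bar>y - x0\<bar>" for y
      by (metis abs_minus_commute dist_norm norm_of_real of_real_diff)
    have off: "AE l in underF c F. of_real l \<notin> D" "AE l in G. of_real l \<notin> D"
      unfolding D_def mem_ball dist
      using gaps(1) by (eventually_elim, use d in simp) (use gaps(2) in \<open>eventually_elim, use d in simp\<close>)
    have open_D: "open D" by (simp add: D_def)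
    note F_hol = stieltjes_holomorphic[OF Fu open_D off(1)] and G_hol = stieltjes_holomorphic[OF G open_D off(2)]
    have real_points: "extended_solution c F g (of_real x) (mS (of_real x)) (gS (of_real x)) \<and>
        V_defined c H (mS (of_real x)) (gS (of_real x)) \<and> V c H (mS (of_real x)) (gS (of_real x)) < x"
      if x: "x > 0" "of_real x \<in> D" for x :: real
    proof -
      have near: "\<bar>x - x0\<bar> < d / 2" using x(2) unfolding D_def mem_ball dist .
      have gx: "AE l in underF c F. d / 2 \<le> \<bar>l - x\<bar>" "AE l in G. d / 2 \<le> \<bar>l - x\<bar>"
        using gaps(1) by (eventually_elim, use near in linarith) (use gaps(2) in \<open>eventually_elim, use near in linarith\<close>)
      define Z where "Z n = Complex x (1 / real (Suc n))" for n
      have Z: "Im (Z n) > 0" for n by (simp add: Z_def)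
      have Zlim: "Z \<longlonglongrightarrow> of_real x"
      proof -
        have "(\<lambda>n. 1 / real (Suc n)) \<longlonglongrightarrow> 0" by real_asymp
        then have "(\<lambda>n. Complex x (1 / real (Suc n))) \<longlonglongrightarrow> Complex x 0" by (intro tendsto_intros)
        then show ?thesis unfolding Z_def by (simp add: complex_of_real_def)
      qed
      have "extended_solution c F g (of_real x) (mS (of_real x)) (gS (of_real x))"
        unfolding extended_solution_def
      proof (intro exI[of _ Z] conjI allI Z Zlim)
        show "(\<lambda>n. mS (Z n)) \<longlonglongrightarrow> mS (of_real x)" by (rule stieltjes_tendsto_gap[OF Fu d(2) gx(1) Zlim])
        show "(\<lambda>n. underg c g (Z n)) \<longlonglongrightarrow> gS (of_real x)"
          unfolding gG[OF Z] by (rule stieltjes_tendsto_gap[OF G d(2) gx(2) Zlim])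
      qed
      then show ?thesis using V_less_outside_support(1,2)[OF x(1) d(2) gx] by blast
    qed
    have "qd (mS (of_real x0)) (gS (of_real x0)) p \<noteq> 0" if "p \<in> top_support H" for p
      by (rule no_zero_on_support[OF _ d(1) gaps that]) (use x0 in simp)
    then have "\<forall>(s, t) \<in> top_support H. of_real s * gS (of_real x0) + of_real t * mS (of_real x0) \<noteq> -1"
      by (fastforce simp: add.assoc)
    moreover have "of_real x0 \<in> D" using d by (simp add: D_def)
    moreover have "mS analytic_on D" "gS analytic_on D" using F_hol(1) G_hol(1) open_D by (simp_all add: analytic_on_open)
    ultimately show "\<exists>D g'. open D \<and> of_real x0 \<in> D \<and>
           (\<forall>z\<in>D. integrable (underF c F) (\<lambda>t. 1 / (of_real t - z))) \<and>
           stieltjes (underF c F) analytic_on D \<and> g' analytic_on D \<and>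
           (\<forall>z\<in>D. Im z > 0 \<longrightarrow> g' z = underg c g z) \<and>
           (\<forall>x :: real. x > 0 \<and> of_real x \<in> D \<longrightarrow>
              extended_solution c F g (of_real x) (stieltjes (underF c F) (of_real x)) (g' (of_real x)) \<and>
              V_defined c H (stieltjes (underF c F) (of_real x)) (g' (of_real x)) \<and>
              V c H (stieltjes (underF c F) (of_real x)) (g' (of_real x)) < x) \<and>
           (\<forall>(s, t) \<in> top_support H.
              of_real s * g' (of_real x0) + of_real t * stieltjes (underF c F) (of_real x0) \<noteq> -1)"
      using open_D F_hol(2) real_points gG
      by - (rule exI[of _ D], rule exI[of _ gS], intro conjI allI impI; simp)
  next
    fix x0 m0 g0 :: real
    assume A: "x0 > 0 \<and> extended_solution c F g (of_real x0) (of_real m0) (of_real g0) \<and>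
        (\<forall>(s, t) \<in> top_support H. s * g0 + t * m0 \<noteq> -1)"
    then obtain Z where Z: "\<And>n. Im (Z n) > 0" "Z \<longlonglongrightarrow> of_real x0" "(\<lambda>n. mS (Z n)) \<longlonglongrightarrow> of_real m0"
      "(\<lambda>n. underg c g (Z n)) \<longlonglongrightarrow> of_real g0"
      unfolding extended_solution_def by blast
    have gZ: "(\<lambda>n. gS (Z n)) \<longlonglongrightarrow> of_real g0" using Z(4) unfolding gG[OF Z(1)] .
    have "1 + fst p * g0 + snd p * m0 \<noteq> 0" if "p \<in> top_support H" for p
    proof -
      have "fst p * g0 + snd p * m0 \<noteq> -1" using A that by (auto simp: case_prod_unfold)
      then show ?thesis by linarith
    qed
    from curve_interval[OF st st_le Z(1-3) gZ this]
    show "\<exists>a b J mf xf. a < g0 \<and> g0 < b \<and> open J \<and> m0 \<in> J \<and>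
           (\<forall>\<gamma>\<in>{a<..<b}. mf \<gamma> \<in> J \<and> (\<forall>\<mu>\<in>J. curve_eq c H \<gamma> \<mu> \<longleftrightarrow> \<mu> = mf \<gamma>)) \<and>
           mf g0 = m0 \<and>
           real_analytic_on xf {a<..<b} \<and> xf g0 = x0 \<and>
           (\<forall>\<gamma>\<in>{a<..<b}. solves_E c H (of_real (xf \<gamma>)) (of_real (mf \<gamma>)) (of_real \<gamma>)) \<and>
           (deriv xf g0 \<noteq> 0 \<longrightarrow> x0 \<notin> df_support (cdf (underF c F)))"
      unfolding not_in_df_support_iff[OF Fu] .
  qed
qed

end
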